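(* Let $\mathcal T$ be a triangulation of a surface $S$ of topological type $(g,n)$ and let $\Theta:E\to[0,\pi)$ satisfy $\mathbf{(C1)}$. In Euclidean background geometry, for any initial $r(0)\in\mathbb R_+^{|V|}$ the solution $r(t)$ of $$\frac{dr_i}{dt}=(K_{av}-K_i)r_i,\qquad i=1,\dots,|V|,\qquad K_{av}=2\pi\chi(S)/|V|,$$ exists for all $t\ge0$, and the following are equivalent: $(E_1)$ $r(t)$ converges as $t\to+\infty$; $(E_2)$ $(K_{av},\dots,K_{av})$ belongs to the image of the curvature map; $(E_3)$ for every proper non-empty subset $A\subsetneq V$, $2\pi\chi(S)|A|/|V|>-\sum_{(e,v)\in Lk(A)}(\pi-\Theta(e))+2\pi\chi(G(A)\setminus\partial S)+\pi\chi(G(A)\cap\partial S)$. Moreover, if one of these holds, then $r(t)$ converges exponentially fast to a radius vector producing a Euclidean cone metric $\mu$ on $S$ all of whose vertex curvatures equal $K_{av}$, such that $(S,\mu)$ supports a circle pattern $\mathcal P$ realizing $(\mathcal T,\Theta)$.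
   Context: $S$: compact oriented surface of genus $g$ with $n\ge0$ boundary circles, $\chi(S)=2-2g-n$. $\mathcal T$: vertices $V=\{v_1,\dots,v_{|V|}\}$, edges $E$, triangles $F$, boundary vertices $V_\partial$. $\mathbf{(C1)}$: whenever $e_1,e_2,e_3$ bound a triangle, $I(e_1)+I(e_2)I(e_3)\ge0$ and cyclic analogues, $I=\cos\Theta$. Euclidean curvature: for $r\in\mathbb R_+^{|V|}$ each triangle $v_iv_jv_k$ is the Euclidean triangle with side lengths $l_{ij}=\sqrt{r_i^2+r_j^2+2r_ir_j\cos\Theta([v_i,v_j])}$ etc.; glued they give a Euclidean cone metric; $\sigma(v_i)$ is the total angle at $v_i$; $K_i=2\pi-\sigma(v_i)$ for interior, $\pi-\sigma(v_i)$ for boundary vertices; the curvature map is $r\mapsto(K_1,\dots,K_{|V|})$. A circle pattern realizing $(\mathcal T,\Theta)$: circles centered at the vertices with the given radii, intersecting along each edge $e$ at exterior angle $\Theta(e)$. $G(A)$: union of open cells of $\mathcal T$ having a vertex in $A$; $\chi$ of a union of open cells is #0-cells − #1-cells + #2-cells. $Lk(A)$: pairs $(e,v)$, $v\in A$, $e\in E$ with no endpoint in $A$, forming a triangle with $v$. *)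

theory Defs
  imports "HOL-Analysis.Analysis"
begin

section \<open>Combinatorial triangulations (triangles glued along sides)\<close>

text \<open>
  A triangulation is given by a finite nonempty set F of triangles (type 'f).
  Every triangle f has three corners (f,0),(f,1),(f,2) and three sides; side (f,i)
  is the side opposite to corner (f,i), joining corners (f,nxt i) and (f,prv i).
  The map se labels each side by the edge (type 'e) it lies on; the map cv labels
  each corner by the vertex (type 'v) it lies at.  Each edge carries one side
  (boundary edge) or two sides (interior edge); two sides on the same edge are
  glued orientation-reversingly (all triangles carry the orientation induced by
  the cyclic order 0,1,2 of their corners, so the resulting surface is oriented),
  and vertices are exactly the classes of corners identified by these gluings.
  This describes exactly the triangulations (in the generalized, Delta-complex
  sense) of compact connected oriented surfaces.
\<close>

definition nxt :: "nat \<Rightarrow> nat" where "nxt i = (i + 1) mod 3"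
definition prv :: "nat \<Rightarrow> nat" where "prv i = (i + 2) mod 3"

definition corners :: "'f set \<Rightarrow> ('f \<times> nat) set" where
  "corners F = F \<times> {0, 1, 2}"

text \<open>sides lying on the same edge as side s\<close>
definition side_mates :: "'f set \<Rightarrow> ('f \<times> nat \<Rightarrow> 'e) \<Rightarrow> 'f \<times> nat \<Rightarrow> ('f \<times> nat) set" where
  "side_mates F se s = {s' \<in> corners F. se s' = se s}"

text \<open>identification of corners induced by (orientation reversing) gluing of sides\<close>
definition glue_rel :: "'f set \<Rightarrow> ('f \<times> nat \<Rightarrow> 'e) \<Rightarrow> (('f \<times> nat) \<times> ('f \<times> nat)) set" where
  "glue_rel F se =
     {((f, nxt i), (f', prv j)) | f i f' j. (f, i) \<in> corners F \<and> (f', j) \<in> corners F \<and>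
          (f, i) \<noteq> (f', j) \<and> se (f, i) = se (f', j)}
   \<union> {((f, prv i), (f', nxt j)) | f i f' j. (f, i) \<in> corners F \<and> (f', j) \<in> corners F \<and>
          (f, i) \<noteq> (f', j) \<and> se (f, i) = se (f', j)}"

definition face_adj :: "'f set \<Rightarrow> ('f \<times> nat \<Rightarrow> 'e) \<Rightarrow> ('f \<times> 'f) set" where
  "face_adj F se = {(f, f') | f f' i j. (f, i) \<in> corners F \<and> (f', j) \<in> corners F \<and> se (f, i) = se (f', j)}"

definition triangulation :: "'f set \<Rightarrow> ('f \<times> nat \<Rightarrow> 'v) \<Rightarrow> ('f \<times> nat \<Rightarrow> 'e) \<Rightarrow> bool" where
  "triangulation F cv se \<longleftrightarrow>
     finite F \<and> F \<noteq> {} \<and>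
     (\<forall>s \<in> corners F. card (side_mates F se s) \<in> {1, 2}) \<and>
     (\<forall>c \<in> corners F. \<forall>c' \<in> corners F. cv c = cv c' \<longleftrightarrow> (c, c') \<in> (glue_rel F se)\<^sup>*) \<and>
     (\<forall>f \<in> F. \<forall>f' \<in> F. (f, f') \<in> (face_adj F se)\<^sup>*)"

definition verts :: "'f set \<Rightarrow> ('f \<times> nat \<Rightarrow> 'v) \<Rightarrow> 'v set" where
  "verts F cv = cv ` corners F"

definition edges :: "'f set \<Rightarrow> ('f \<times> nat \<Rightarrow> 'e) \<Rightarrow> 'e set" where
  "edges F se = se ` corners F"

definition bdry_edges :: "'f set \<Rightarrow> ('f \<times> nat \<Rightarrow> 'e) \<Rightarrow> 'e set" where
  "bdry_edges F se = {se s | s. s \<in> corners F \<and> card (side_mates F se s) = 1}"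

text \<open>e has an endpoint in A\<close>
definition edge_meets :: "'f set \<Rightarrow> ('f \<times> nat \<Rightarrow> 'v) \<Rightarrow> ('f \<times> nat \<Rightarrow> 'e) \<Rightarrow> 'v set \<Rightarrow> 'e \<Rightarrow> bool" where
  "edge_meets F cv se A e \<longleftrightarrow>
     (\<exists>f i. (f, i) \<in> corners F \<and> se (f, i) = e \<and> (cv (f, nxt i) \<in> A \<or> cv (f, prv i) \<in> A))"

text \<open>boundary vertices V_bd: endpoints of boundary edges\<close>
definition bdry_verts :: "'f set \<Rightarrow> ('f \<times> nat \<Rightarrow> 'v) \<Rightarrow> ('f \<times> nat \<Rightarrow> 'e) \<Rightarrow> 'v set" where
  "bdry_verts F cv se = {v \<in> verts F cv. \<exists>e \<in> bdry_edges F se. edge_meets F cv se {v} e}"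

text \<open>Euler characteristic chi(S) = |V| - |E| + |F|\<close>
definition euler_char :: "'f set \<Rightarrow> ('f \<times> nat \<Rightarrow> 'v) \<Rightarrow> ('f \<times> nat \<Rightarrow> 'e) \<Rightarrow> int" where
  "euler_char F cv se = int (card (verts F cv)) - int (card (edges F se)) + int (card F)"

text \<open>chi(G(A) minus boundary): open cells with a vertex in A not lying in the boundary\<close>
definition chi_G_int :: "'f set \<Rightarrow> ('f \<times> nat \<Rightarrow> 'v) \<Rightarrow> ('f \<times> nat \<Rightarrow> 'e) \<Rightarrow> 'v set \<Rightarrow> int" where
  "chi_G_int F cv se A =
     int (card (A \<inter> verts F cv - bdry_verts F cv se))
     - int (card {e \<in> edges F se - bdry_edges F se. edge_meets F cv se A e})
     + int (card {f \<in> F. \<exists>i \<in> {0, 1, 2}. cv (f, i) \<in> A})"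

text \<open>chi(G(A) intersected with the boundary)\<close>
definition chi_G_bd :: "'f set \<Rightarrow> ('f \<times> nat \<Rightarrow> 'v) \<Rightarrow> ('f \<times> nat \<Rightarrow> 'e) \<Rightarrow> 'v set \<Rightarrow> int" where
  "chi_G_bd F cv se A =
     int (card (A \<inter> bdry_verts F cv se))
     - int (card {e \<in> bdry_edges F se. edge_meets F cv se A e})"

text \<open>Lk(A): a vertex v in A together with the opposite edge e of a triangle having
  no endpoint in A; recorded as the corner (f,i) of that triangle at v (so that the
  pair is counted once per triangle it forms).\<close>
definition Lk :: "'f set \<Rightarrow> ('f \<times> nat \<Rightarrow> 'v) \<Rightarrow> 'v set \<Rightarrow> ('f \<times> nat) set" where
  "Lk F cv A = {(f, i) \<in> corners F. cv (f, i) \<in> A \<and> cv (f, nxt i) \<notin> A \<and> cv (f, prv i) \<notin> A}"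

section \<open>Euclidean circle pattern geometry\<close>

text \<open>Length of side (f,i): l_{jk} = sqrt(r_j^2 + r_k^2 + 2 r_j r_k cos Theta)\<close>
definition side_len ::
  "('f \<times> nat \<Rightarrow> 'v) \<Rightarrow> ('f \<times> nat \<Rightarrow> 'e) \<Rightarrow> ('e \<Rightarrow> real) \<Rightarrow> ('v \<Rightarrow> real) \<Rightarrow> 'f \<times> nat \<Rightarrow> real" where
  "side_len cv se \<Theta> r s = (case s of (f, i) \<Rightarrow>
     sqrt ((r (cv (f, nxt i)))\<^sup>2 + (r (cv (f, prv i)))\<^sup>2
           + 2 * r (cv (f, nxt i)) * r (cv (f, prv i)) * cos (\<Theta> (se (f, i)))))"

text \<open>inner angle at corner (f,i) of the Euclidean triangle with these side lengths
  (law of cosines)\<close>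
definition corner_angle ::
  "('f \<times> nat \<Rightarrow> 'v) \<Rightarrow> ('f \<times> nat \<Rightarrow> 'e) \<Rightarrow> ('e \<Rightarrow> real) \<Rightarrow> ('v \<Rightarrow> real) \<Rightarrow> 'f \<times> nat \<Rightarrow> real" where
  "corner_angle cv se \<Theta> r c = (case c of (f, i) \<Rightarrow>
     (let a = side_len cv se \<Theta> r (f, i);
          b = side_len cv se \<Theta> r (f, nxt i);
          d = side_len cv se \<Theta> r (f, prv i)
      in arccos ((b\<^sup>2 + d\<^sup>2 - a\<^sup>2) / (2 * b * d))))"

text \<open>total cone angle sigma(v)\<close>
definition cone_angle ::
  "'f set \<Rightarrow> ('f \<times> nat \<Rightarrow> 'v) \<Rightarrow> ('f \<times> nat \<Rightarrow> 'e) \<Rightarrow> ('e \<Rightarrow> real) \<Rightarrow> ('v \<Rightarrow> real) \<Rightarrow> 'v \<Rightarrow> real" where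
  "cone_angle F cv se \<Theta> r v = (\<Sum>c \<in> {c \<in> corners F. cv c = v}. corner_angle cv se \<Theta> r c)"

text \<open>discrete curvature K_i (the curvature map is r |-> (K_v)_{v in V})\<close>
definition curv ::
  "'f set \<Rightarrow> ('f \<times> nat \<Rightarrow> 'v) \<Rightarrow> ('f \<times> nat \<Rightarrow> 'e) \<Rightarrow> ('e \<Rightarrow> real) \<Rightarrow> ('v \<Rightarrow> real) \<Rightarrow> 'v \<Rightarrow> real" where
  "curv F cv se \<Theta> r v =
     (if v \<in> bdry_verts F cv se then pi else 2 * pi) - cone_angle F cv se \<Theta> r v"

text \<open>condition (C1), with I = cos Theta\<close>
definition cond_C1 :: "'f set \<Rightarrow> ('f \<times> nat \<Rightarrow> 'e) \<Rightarrow> ('e \<Rightarrow> real) \<Rightarrow> bool" where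
  "cond_C1 F se \<Theta> \<longleftrightarrow>
     (\<forall>(f, i) \<in> corners F. cos (\<Theta> (se (f, i))) + cos (\<Theta> (se (f, nxt i))) * cos (\<Theta> (se (f, prv i))) \<ge> 0)"

text \<open>K_av = 2 pi chi(S) / |V|\<close>
definition K_av :: "'f set \<Rightarrow> ('f \<times> nat \<Rightarrow> 'v) \<Rightarrow> ('f \<times> nat \<Rightarrow> 'e) \<Rightarrow> real" where
  "K_av F cv se = 2 * pi * of_int (euler_char F cv se) / real (card (verts F cv))"

text \<open>r is a solution on [0,+infinity) of dr_i/dt = (K_av - K_i) r_i with r(0) = r0,
  staying in R_+^|V|\<close>
definition flow_solution ::
  "'f set \<Rightarrow> ('f \<times> nat \<Rightarrow> 'v) \<Rightarrow> ('f \<times> nat \<Rightarrow> 'e) \<Rightarrow> ('e \<Rightarrow> real) \<Rightarrow> ('v \<Rightarrow> real)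
     \<Rightarrow> (real \<Rightarrow> 'v \<Rightarrow> real) \<Rightarrow> bool" where
  "flow_solution F cv se \<Theta> r0 r \<longleftrightarrow>
     (\<forall>v \<in> verts F cv. r 0 v = r0 v) \<and>
     (\<forall>t \<ge> 0. \<forall>v \<in> verts F cv. r t v > 0 \<and>
        ((\<lambda>s. r s v) has_real_derivative
            ((K_av F cv se - curv F cv se \<Theta> (r t) v) * r t v)) (at t within {0..}))"

end

theory Submission
  imports Defs
begin

text \<open>
  In the logarithmic radii \<open>u = ln r\<close> the flow reads \<open>du/dt = K_av - K(u)\<close>. In each triangle the
  derivatives of the angles are minus a weighted graph Laplacian whose weights are nonnegative by
  (C1), at most one of them vanishing, and bounded. Hence \<open>K\<close> is globally Lipschitz, which gives
  global existence, and two solutions approach each other in the Euclidean norm; on a bounded region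
  they do so exponentially fast, provided that they have the same sum of coordinates, which the flow
  preserves by Gauss--Bonnet. Comparing a bounded solution with its own time translates shows that it
  converges exponentially, and the limit has constant curvature. If some metric of constant curvature
  exists, the distance to it stays bounded. If (E3) holds, boundedness comes from an invariant region:
  when the radii at \<open>A\<close> are far smaller than the others, the angles at \<open>A\<close> are almost maximal, and by
  (E3) the sum of \<open>u\<close> over \<open>A\<close> increases. Conversely, the angles are always strictly below these
  maxima, which yields (E3).
\<close>

section \<open>Ordinary differential equations\<close>

text \<open>No convex potential is used: its properness is replaced by linear inequalities for sums
  over vertex sets, and its convexity by monotonicity of the angles. A metric of constant curvature
  is itself produced by running the flow from an arbitrary start, so that passing from (E3) to (E2)
  needs no degree or continuity argument for the image of the curvature map. Two degeneracies shape
  the estimates. Rescaling all radii preserves the angles, so contraction is only possible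
  transversally to the constants; there a Poincare inequality, resting on connectedness of the
  surface, turns differences inside triangles into the full norm. And a weight vanishes on a tangent
  edge (\<open>\<Theta> = 0\<close>) whose two neighbours in the triangle have supplementary angles;
  the two remaining weights still control all differences of the three coordinates. The weights have
  to be bounded over all radii and not only over compact sets, since the global Lipschitz bound is
  needed before any a priori estimate. The bound comes from comparing the numerator of a weight with
  the area of the triangle through one common factor, \<open>I3 + I1 * I2\<close>.\<close>

definition picard_step :: "('a \<Rightarrow> real) \<Rightarrow> (('a \<Rightarrow> real) \<Rightarrow> 'a \<Rightarrow> real) \<Rightarrow> (real \<Rightarrow> 'a \<Rightarrow> real) \<Rightarrow> real \<Rightarrow> 'a \<Rightarrow> real"
  where "picard_step u0 f x t v = u0 v + integral {0..t} (\<lambda>s. f (x s) v)"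

text \<open>Lipschitz continuity for the maximum norm over \<open>V\<close>, with a free bound
  \<open>d\<close> in place of a maximum. Taking \<open>d = 0\<close> shows that \<open>f\<close> on
  \<open>V\<close> depends only on the values on \<open>V\<close>, so functions on the whole type
  can stand for vectors.\<close>

definition sup_lipschitz_on :: "'a set \<Rightarrow> real \<Rightarrow> (('a \<Rightarrow> real) \<Rightarrow> 'a \<Rightarrow> real) \<Rightarrow> bool" where
  "sup_lipschitz_on V L f \<longleftrightarrow> 0 \<le> L \<and>
     (\<forall>x y d. (\<forall>w\<in>V. \<bar>x w - y w\<bar> \<le> d) \<longrightarrow> (\<forall>v\<in>V. \<bar>f x v - f y v\<bar> \<le> L * d))"

lemma sup_lipschitz_onD:
  assumes "sup_lipschitz_on V L f" "v \<in> V" "\<And>w. w \<in> V \<Longrightarrow> \<bar>x w - y w\<bar> \<le> d"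
  shows "\<bar>f x v - f y v\<bar> \<le> L * d"
  using assms unfolding sup_lipschitz_on_def by blast

lemma sup_lipschitz_continuous_on:
  fixes f :: "('a \<Rightarrow> real) \<Rightarrow> 'a \<Rightarrow> real" and x :: "'b::topological_space \<Rightarrow> 'a \<Rightarrow> real"
  assumes fin: "finite V" and v: "v \<in> V" and lip: "sup_lipschitz_on V L f"
    and cont: "\<And>w. w \<in> V \<Longrightarrow> continuous_on S (\<lambda>s. x s w)"
  shows "continuous_on S (\<lambda>s. f (x s) v)"
  unfolding continuous_on_def
proof
  fix t assume t: "t \<in> S"
  have "((\<lambda>s. L * (\<Sum>w\<in>V. \<bar>x s w - x t w\<bar>)) \<longlongrightarrow> L * (\<Sum>w\<in>V. \<bar>x t w - x t w\<bar>)) (at t within S)"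
    using cont[unfolded continuous_on_def] t by (intro tendsto_intros) blast
  then have lim: "((\<lambda>s. L * (\<Sum>w\<in>V. \<bar>x s w - x t w\<bar>)) \<longlongrightarrow> 0) (at t within S)" by simp
  have le: "\<bar>f (x s) v - f (x t) v\<bar> \<le> L * (\<Sum>w\<in>V. \<bar>x s w - x t w\<bar>)" for s
    by (rule sup_lipschitz_onD[OF lip v]) (rule member_le_sum, use fin in auto)
  have "((\<lambda>s. f (x s) v - f (x t) v) \<longlongrightarrow> 0) (at t within S)"
    by (rule Lim_null_comparison[OF always_eventually lim]) (rule allI, unfold real_norm_def, rule le)
  then show "((\<lambda>s. f (x s) v) \<longlongrightarrow> f (x t) v) (at t within S)"
    by (rule LIM_zero_cancel)
qed

text \<open>Measured against the weight \<open>exp (M * s)\<close>, integration gains a factor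
  \<open>1 / M\<close>; this is the contraction behind the Picard iteration.\<close>

lemma integral_exp_le:
  fixes M :: real
  assumes M: "M > 0" and t: "t \<ge> 0" and g: "g integrable_on {0..t}" and "C \<ge> 0"
    and le: "\<And>s. 0 \<le> s \<Longrightarrow> s \<le> t \<Longrightarrow> \<bar>g s\<bar> \<le> C * exp (M * s)"
  shows "\<bar>integral {0..t} g\<bar> \<le> C / M * exp (M * t)"
proof -
  have I: "((\<lambda>s. C * exp (M * s)) has_integral (C / M * exp (M * t) - C / M * exp (M * 0))) {0..t}"
  proof (rule fundamental_theorem_of_calculus[OF t])
    fix s assume "s \<in> {0..t}"
    show "((\<lambda>s. C / M * exp (M * s)) has_vector_derivative C * exp (M * s)) (at s within {0..t})"
      unfolding has_real_derivative_iff_has_vector_derivative[symmetric]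
      by (rule derivative_eq_intros refl | use M in simp)+
  qed
  have "\<bar>integral {0..t} g\<bar> \<le> integral {0..t} (\<lambda>s. C * exp (M * s))"
    using integral_norm_bound_integral[OF g, of "\<lambda>s. C * exp (M * s)"] I le by auto
  also have "\<dots> = C / M * exp (M * t) - C / M" using integral_unique[OF I] by simp
  also have "\<dots> \<le> C / M * exp (M * t)" using M \<open>C \<ge> 0\<close> by simp
  finally show ?thesis .
qed

text \<open>In the norm weighted by \<open>exp (- M * t)\<close> the Picard map contracts by
  \<open>L / M\<close>, at most 1/2 for \<open>M = 2 * L + 1\<close>, on the whole ray at once.
  Hence no local solutions have to be continued.\<close>

lemma picard_lindeloef_sup_lipschitz:
  fixes f :: "('a \<Rightarrow> real) \<Rightarrow> 'a \<Rightarrow> real"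
  assumes fin: "finite V" and sup_lip: "sup_lipschitz_on V L f"
  shows "\<exists>u. (\<forall>v\<in>V. u 0 v = u0 v) \<and>
    (\<forall>t\<ge>0. \<forall>v\<in>V. ((\<lambda>s. u s v) has_real_derivative f (u t) v) (at t within {0..}))"
proof -
  have L: "0 \<le> L" using sup_lip by (simp add: sup_lipschitz_on_def)
  note lip = sup_lipschitz_onD[OF sup_lip]
  define X where "X k = (picard_step u0 f ^^ k) (\<lambda>t v. u0 v)" for k
  have X0: "X 0 t v = u0 v" for t v by (simp add: X_def)
  have XS: "X (Suc k) t v = u0 v + integral {0..t} (\<lambda>s. f (X k s) v)" for k t v
    by (simp add: X_def picard_step_def)
  have lip_cont: "continuous_on S (\<lambda>s. f (x s) v)"
    if "\<And>w. w \<in> V \<Longrightarrow> continuous_on S (\<lambda>s. x s w)" "v \<in> V" for x S v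
    by (rule sup_lipschitz_continuous_on[OF fin that(2) sup_lip], rule that(1))
  have Xcont: "continuous_on {0..T} (\<lambda>t. X k t v)" if "v \<in> V" for k v T
    using that
  proof (induction k arbitrary: v)
    case 0 then show ?case by (simp add: X0)
  next
    case (Suc k)
    have "continuous_on {0..T} (\<lambda>s. f (X k s) v)"
      using Suc by (intro lip_cont) auto
    then show ?case unfolding XS
      by (intro continuous_intros indefinite_integral_continuous_1 integrable_continuous_interval)
  qed
  have fXint: "(\<lambda>s. f (X k s) v) integrable_on {0..t}" if "v \<in> V" for k t v
    using that Xcont by (intro integrable_continuous_interval lip_cont) auto
  define M where "M = 2 * L + 1"
  have M: "M > 0" "L / M \<le> 1 / 2" using L by (auto simp: M_def field_simps)
  define B where "B = (\<Sum>v\<in>V. \<bar>f u0 v\<bar>) / M"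
  have B: "B \<ge> 0" using M by (simp add: B_def sum_nonneg)
  have step: "\<bar>X (Suc k) t v - X k t v\<bar> \<le> B * (1/2)^k * exp (M * t)" if "v \<in> V" "t \<ge> 0" for k t v
    using that
  proof (induction k arbitrary: t v)
    case 0
    have "\<bar>integral {0..t} (\<lambda>s. f u0 v)\<bar> \<le> (\<Sum>v\<in>V. \<bar>f u0 v\<bar>) / M * exp (M * t)"
    proof (rule integral_exp_le[OF M(1) 0(2)])
      fix s :: real assume "0 \<le> s"
      have "\<bar>f u0 v\<bar> \<le> (\<Sum>v\<in>V. \<bar>f u0 v\<bar>) * 1"
        using fin 0 by (auto intro!: member_le_sum)
      also have "\<dots> \<le> (\<Sum>v\<in>V. \<bar>f u0 v\<bar>) * exp (M * s)"
        using \<open>0 \<le> s\<close> M by (intro mult_left_mono sum_nonneg) auto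
      finally show "\<bar>f u0 v\<bar> \<le> (\<Sum>v\<in>V. \<bar>f u0 v\<bar>) * exp (M * s)" .
    qed (auto intro: sum_nonneg integrable_const_ivl)
    moreover have "X 0 = (\<lambda>t. u0)" by (intro ext) (simp add: X0)
    ultimately show ?case unfolding XS B_def by simp
  next
    case (Suc k)
    have "X (Suc (Suc k)) t v - X (Suc k) t v = integral {0..t} (\<lambda>s. f (X (Suc k) s) v - f (X k s) v)"
      unfolding XS[of "Suc k" t v] XS[of k t v] using fXint Suc.prems by (subst Henstock_Kurzweil_Integration.integral_diff) auto
    also have "\<bar>\<dots>\<bar> \<le> (L * (B * (1/2)^k)) / M * exp (M * t)"
    proof (rule integral_exp_le[OF M(1) Suc.prems(2)])
      show "(\<lambda>s. f (X (Suc k) s) v - f (X k s) v) integrable_on {0..t}"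
        using fXint Suc.prems by (intro integrable_diff) auto
      fix s :: real assume "0 \<le> s" "s \<le> t"
      then show "\<bar>f (X (Suc k) s) v - f (X k s) v\<bar> \<le> L * (B * (1/2)^k) * exp (M * s)"
        using lip[OF Suc.prems(1) Suc.IH] by (simp add: mult.assoc)
    qed (use L B in auto)
    also have "\<dots> = (L / M) * (B * (1/2)^k * exp (M * t))" by simp
    also have "\<dots> \<le> (1/2) * (B * (1/2)^k * exp (M * t))"
      using B M by (intro mult_right_mono) auto
    finally show ?case by simp
  qed
  define u where "u t v = lim (\<lambda>k. X k t v)" for t v
  \<comment> \<open>The factor \<open>1 - (1/2)^j\<close> is the exact partial geometric sum and
    makes the bound inductive in \<open>j\<close>.\<close>
  have tail: "\<bar>X (k + j) t v - X k t v\<bar> \<le> 2 * B * (1/2)^k * exp (M * t) * (1 - (1/2)^j)"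
    if "v \<in> V" "t \<ge> 0" for k j t v
  proof (induction j)
    case (Suc j)
    then show ?case
      using step[OF that, of "k + j"] by (simp add: power_add algebra_simps)
  qed simp
  have tail': "\<bar>X (k + j) t v - X k t v\<bar> \<le> 2 * B * (1/2)^k * exp (M * t)"
    if "v \<in> V" "t \<ge> 0" for k j t v
  proof -
    have "2 * B * (1/2)^k * exp (M * t) * (1 - (1/2)^j) \<le> 2 * B * (1/2)^k * exp (M * t) * 1"
      using B by (intro mult_left_mono) auto
    then show ?thesis using tail[OF that, of k j] by linarith
  qed
  have half: "(\<lambda>k. C * (1/2)^k * E) \<longlonglongrightarrow> 0" for C E :: real
    by (intro tendsto_mult_left_zero tendsto_mult_right_zero LIMSEQ_power_zero) auto
  have conv: "(\<lambda>k. X k t v) \<longlonglongrightarrow> u t v" if "v \<in> V" "t \<ge> 0" for t v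
  proof -
    have "Cauchy (\<lambda>k. X k t v)"
      unfolding Cauchy_altdef
    proof (intro allI impI)
      fix e :: real assume "0 < e"
      then have "\<forall>\<^sub>F k in sequentially. 2 * B * (1/2)^k * exp (M * t) < e"
        by (rule order_tendstoD(2)[OF half[of "2 * B" "exp (M * t)"]])
      then obtain N where N: "\<And>k. k \<ge> N \<Longrightarrow> 2 * B * (1/2)^k * exp (M * t) < e"
        by (auto simp: eventually_sequentially)
      show "\<exists>N. \<forall>m\<ge>N. \<forall>n>m. dist (X m t v) (X n t v) < e"
      proof (intro exI allI impI)
        fix m n assume "N \<le> m" "m < n"
        then show "dist (X m t v) (X n t v) < e"
          using tail'[OF that, of m "n - m"] N[of m] by (simp add: dist_real_def abs_minus_commute)
      qed
    qed
    then show ?thesis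
      unfolding u_def by (simp add: Cauchy_convergent_iff convergent_LIMSEQ_iff)
  qed
  have err: "\<bar>u t v - X k t v\<bar> \<le> 2 * B * (1/2)^k * exp (M * t)" if "v \<in> V" "t \<ge> 0" for k t v
  proof (rule tendsto_upperbound)
    show "(\<lambda>j. \<bar>X (k + j) t v - X k t v\<bar>) \<longlonglongrightarrow> \<bar>u t v - X k t v\<bar>"
      using LIMSEQ_ignore_initial_segment[OF conv[OF that], of k]
      by (intro tendsto_intros) (simp add: add.commute)
  qed (use tail'[OF that] in auto)
  have ucont: "continuous_on {0..T} (\<lambda>t. u t v)" if "v \<in> V" for v T
  proof (rule uniform_limit_theorem[where F = sequentially and f = "\<lambda>k t. X k t v"])
    show "\<forall>\<^sub>F n in sequentially. continuous_on {0..T} (\<lambda>t. X n t v)"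
      using Xcont that by auto
    show "uniform_limit {0..T} (\<lambda>k t. X k t v) (\<lambda>t. u t v) sequentially"
      unfolding uniform_limit_iff
    proof (intro allI impI)
      fix e :: real assume "0 < e"
      then have "\<forall>\<^sub>F k in sequentially. 2 * B * (1/2)^k * exp (M * T) < e"
        by (rule order_tendstoD(2)[OF half[of "2 * B" "exp (M * T)"]])
      then show "\<forall>\<^sub>F n in sequentially. \<forall>t\<in>{0..T}. dist (X n t v) (u t v) < e"
      proof (rule eventually_mono, intro ballI)
        fix k t assume k: "2 * B * (1/2)^k * exp (M * T) < e" and t: "t \<in> {0..T}"
        have "2 * B * (1/2)^k * exp (M * t) \<le> 2 * B * (1/2)^k * exp (M * T)"
          using t M B by (intro mult_left_mono) auto
        then show "dist (X k t v) (u t v) < e"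
          using err[OF that, of t k] k t by (simp add: dist_real_def abs_minus_commute)
      qed
    qed
  qed auto
  have fucont: "continuous_on {0..T} (\<lambda>t. f (u t) v)" if "v \<in> V" for v T
    using that ucont by (intro lip_cont) auto
  have fuint: "(\<lambda>s. f (u s) v) integrable_on {0..t}" if "v \<in> V" for v t
    using fucont[OF that] by (rule integrable_continuous_interval)
  have u_eq: "u t v = u0 v + integral {0..t} (\<lambda>s. f (u s) v)" if v: "v \<in> V" and t: "t \<ge> 0" for t v
  proof -
    have "\<bar>u t v - (u0 v + integral {0..t} (\<lambda>s. f (u s) v))\<bar> \<le> 2 * B * (1/2)^k * exp (M * t)" for k
    proof -
      have "\<bar>X (Suc k) t v - (u0 v + integral {0..t} (\<lambda>s. f (u s) v))\<bar>
        = \<bar>integral {0..t} (\<lambda>s. f (X k s) v - f (u s) v)\<bar>"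
        unfolding XS using fXint fuint v
        by (subst Henstock_Kurzweil_Integration.integral_diff) auto
      also have "\<dots> \<le> (L * (2 * B * (1/2)^k)) / M * exp (M * t)"
      proof (rule integral_exp_le[OF M(1) t])
        show "(\<lambda>s. f (X k s) v - f (u s) v) integrable_on {0..t}"
          using fXint fuint v by (intro integrable_diff) auto
        fix s :: real assume "0 \<le> s" "s \<le> t"
        then show "\<bar>f (X k s) v - f (u s) v\<bar> \<le> L * (2 * B * (1/2)^k) * exp (M * s)"
          using lip[OF v, of "X k s" "u s" "2 * B * (1/2)^k * exp (M * s)"] err
          by (simp add: mult.assoc abs_minus_commute)
      qed (use L B in auto)
      also have "\<dots> = (L / M) * (2 * B * (1/2)^k * exp (M * t))" by simp
      also have "\<dots> \<le> (1/2) * (2 * B * (1/2)^k * exp (M * t))"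
        using B M by (intro mult_right_mono) auto
      finally show ?thesis using err[OF v t, of "Suc k"] by simp
    qed
    then have "\<bar>u t v - (u0 v + integral {0..t} (\<lambda>s. f (u s) v))\<bar> \<le> 0"
      by (intro tendsto_lowerbound[OF half[of "2 * B" "exp (M * t)"]]) auto
    then show ?thesis by simp
  qed
  show ?thesis
  proof (intro exI conjI ballI allI impI)
    show "u 0 v = u0 v" if "v \<in> V" for v using u_eq[OF that] by simp
    fix t :: real and v assume t: "0 \<le> t" and v: "v \<in> V"
    \<comment> \<open>The fundamental theorem gives a derivative within \<open>{0..t+1}\<close>; as
      \<open>t\<close> is not the right end, it agrees with the derivative within
      \<open>{0..}\<close>.\<close>
    have "((\<lambda>s. u0 v + integral {0..s} (\<lambda>s. f (u s) v)) has_real_derivative f (u t) v) (at t within {0..t+1})"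
      using integral_has_real_derivative[OF fucont[OF v], of t "t+1"] t
      by (auto intro!: derivative_eq_intros)
    then have "((\<lambda>s. u s v) has_real_derivative f (u t) v) (at t within {0..t+1})"
      by (rule has_field_derivative_transform_within[OF _ zero_less_one]) (use t v u_eq in auto)
    then have "((\<lambda>s. u s v) has_real_derivative f (u t) v) (at t within {0..t+1} \<inter> {..<t+1})"
      by (rule has_field_derivative_subset) auto
    moreover have "at t within {0..t+1} \<inter> {..<t+1} = at t within {0..}"
      using t by (intro at_within_nhd[of t "{..<t+1}"]) auto
    ultimately show "((\<lambda>s. u s v) has_real_derivative f (u t) v) (at t within {0..})" by simp
  qed
qed

section \<open>Three mutually intersecting circles\<close>

definition tri_len2 :: "real \<Rightarrow> real \<Rightarrow> real \<Rightarrow> real" where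
  "tri_len2 I r s = r\<^sup>2 + s\<^sup>2 + 2 * r * s * I"

text \<open>Scalar product of the two sides at vertex 1, by polarization half of the sum of their
  squared lengths minus the squared opposite side. Throughout, \<open>I1\<close> belongs to the side
  opposite vertex 1, so the cosines rotate together with the radii.\<close>

definition tri_dot :: "real \<Rightarrow> real \<Rightarrow> real \<Rightarrow> real \<Rightarrow> real \<Rightarrow> real \<Rightarrow> real" where
  "tri_dot I1 I2 I3 r1 r2 r3 = r1\<^sup>2 + r1 * r2 * I3 + r1 * r3 * I2 - r2 * r3 * I1"

text \<open>Gram determinant of the two sides at a vertex, that is, four times the squared area,
  expanded so that (C1) makes every summand nonnegative.\<close>

definition tri_area2 :: "real \<Rightarrow> real \<Rightarrow> real \<Rightarrow> real \<Rightarrow> real \<Rightarrow> real \<Rightarrow> real" where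
  "tri_area2 I1 I2 I3 r1 r2 r3 =
     r1\<^sup>2 * r2\<^sup>2 * (1 - I3\<^sup>2) + r2\<^sup>2 * r3\<^sup>2 * (1 - I1\<^sup>2) + r3\<^sup>2 * r1\<^sup>2 * (1 - I2\<^sup>2)
     + 2 * r1 * r2 * r3 * (r1 * (I1 + I2 * I3) + r2 * (I2 + I3 * I1) + r3 * (I3 + I1 * I2))"

definition tri_angle :: "real \<Rightarrow> real \<Rightarrow> real \<Rightarrow> real \<Rightarrow> real \<Rightarrow> real \<Rightarrow> real" where
  "tri_angle I1 I2 I3 r1 r2 r3 =
     arccos (tri_dot I1 I2 I3 r1 r2 r3 / (sqrt (tri_len2 I2 r3 r1) * sqrt (tri_len2 I3 r1 r2)))"

definition tri_num :: "real \<Rightarrow> real \<Rightarrow> real \<Rightarrow> real \<Rightarrow> real \<Rightarrow> real \<Rightarrow> real" where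
  "tri_num I1 I2 I3 r1 r2 r3 =
     r1 * r2 * (1 - I3\<^sup>2) + r1 * r3 * (I1 + I2 * I3) + r2 * r3 * (I2 + I3 * I1)"

text \<open>Weight of the side between vertices 1 and 2: the derivative of the angle at 1 with
  respect to \<open>ln r2\<close>. For mutually tangent circles it is the inradius divided by the
  length of that side.\<close>

definition tri_cond :: "real \<Rightarrow> real \<Rightarrow> real \<Rightarrow> real \<Rightarrow> real \<Rightarrow> real \<Rightarrow> real" where
  "tri_cond I1 I2 I3 r1 r2 r3 =
     r1 * r2 * tri_num I1 I2 I3 r1 r2 r3 / (sqrt (tri_area2 I1 I2 I3 r1 r2 r3) * tri_len2 I3 r1 r2)"

section \<open>Algebraic identities between lengths, scalar products, area and weights\<close>

lemma tri_len2_commute: "tri_len2 I r s = tri_len2 I s r"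
  by (simp add: tri_len2_def algebra_simps)

lemma tri_area2_rotate: "tri_area2 I2 I3 I1 r2 r3 r1 = tri_area2 I1 I2 I3 r1 r2 r3"
  by (simp add: tri_area2_def algebra_simps)

lemma tri_area2_swap: "tri_area2 I2 I1 I3 r2 r1 r3 = tri_area2 I1 I2 I3 r1 r2 r3"
  by (simp add: tri_area2_def algebra_simps)

lemma tri_cond_swap: "tri_cond I2 I1 I3 r2 r1 r3 = tri_cond I1 I2 I3 r1 r2 r3"
proof -
  have "tri_num I2 I1 I3 r2 r1 r3 = tri_num I1 I2 I3 r1 r2 r3"
    by (simp add: tri_num_def algebra_simps)
  then show ?thesis
    by (simp add: tri_cond_def tri_area2_swap tri_len2_commute[of I3 r2] mult.commute[of r2])
qed

lemma tri_area2_eq: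
  "tri_len2 I2 r3 r1 * tri_len2 I3 r1 r2 - (tri_dot I1 I2 I3 r1 r2 r3)\<^sup>2 = tri_area2 I1 I2 I3 r1 r2 r3"
  unfolding tri_len2_def tri_dot_def tri_area2_def by algebra

lemma tri_len2_eq_dot:
  "tri_len2 I3 r1 r2 = tri_dot I1 I2 I3 r1 r2 r3 + tri_dot I2 I3 I1 r2 r3 r1"
  unfolding tri_len2_def tri_dot_def by algebra

text \<open>The bracket is the determinant of the symmetric matrix with diagonal 1 and off-diagonal
  entries \<open>- I1\<close>, \<open>- I2\<close>, \<open>- I3\<close>. The identity trades the
  numerator of the weight for the area in its denominator.\<close>

lemma tri_num_square:
  "(tri_num I1 I2 I3 r1 r2 r3)\<^sup>2 = (1 - I3\<^sup>2) * tri_area2 I1 I2 I3 r1 r2 r3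
     - (1 - I1\<^sup>2 - I2\<^sup>2 - I3\<^sup>2 - 2 * I1 * I2 * I3) * r3\<^sup>2 * tri_len2 I3 r1 r2"
  unfolding tri_num_def tri_area2_def tri_len2_def by algebra

text \<open>With \<open>x1\<close>, \<open>x2\<close>, \<open>x3\<close> the velocities of the
  logarithmic radii, \<open>p'\<close> is the derivative of \<open>p\<close>, while
  \<open>L2'\<close> and \<open>L3'\<close> are half the derivatives of the squared lengths. Only
  differences of velocities survive, since scaling preserves angles.\<close>

lemma tri_angle_deriv_identity:
  fixes r1 r2 r3 x1 x2 x3 I1 I2 I3 :: real
  defines "p \<equiv> tri_dot I1 I2 I3 r1 r2 r3"
    and "p' \<equiv> 2 * r1\<^sup>2 * x1 + r1 * r2 * I3 * (x1 + x2) + r1 * r3 * I2 * (x1 + x3) - r2 * r3 * I1 * (x2 + x3)"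
    and "L2 \<equiv> tri_len2 I2 r3 r1"
    and "L2' \<equiv> r3\<^sup>2 * x3 + r1\<^sup>2 * x1 + r3 * r1 * I2 * (x1 + x3)"
    and "L3 \<equiv> tri_len2 I3 r1 r2"
    and "L3' \<equiv> r1\<^sup>2 * x1 + r2\<^sup>2 * x2 + r1 * r2 * I3 * (x1 + x2)"
  shows "p * (L2' * L3 + L3' * L2) - p' * L2 * L3 =
    r1 * r2 * tri_num I1 I2 I3 r1 r2 r3 * L2 * (x2 - x1) + r1 * r3 * tri_num I1 I3 I2 r1 r3 r2 * L3 * (x3 - x1)"
  unfolding assms tri_dot_def tri_len2_def tri_num_def by algebra

locale circle_triple =
  fixes I1 I2 I3 :: real
  assumes I_gt: "-1 < I1" "-1 < I2" "-1 < I3"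
    and I_le: "I1 \<le> 1" "I2 \<le> 1" "I3 \<le> 1"
    and C1: "0 \<le> I1 + I2 * I3" "0 \<le> I2 + I3 * I1" "0 \<le> I3 + I1 * I2"
begin

lemma rotate: "circle_triple I2 I3 I1"
  using I_gt I_le C1 by unfold_locales auto

lemma swap: "circle_triple I1 I3 I2"
  using I_gt I_le C1 by unfold_locales (auto simp: mult.commute)

lemma one_minus_sq_nonneg: "0 \<le> 1 - I1\<^sup>2" "0 \<le> 1 - I2\<^sup>2" "0 \<le> 1 - I3\<^sup>2"
  using I_gt I_le by (auto simp: abs_square_le_1)

lemma tri_len2_pos:
  assumes "0 < r" "0 < s"
  shows "0 < tri_len2 I3 r s"
proof -
  have "tri_len2 I3 r s = (r - s)\<^sup>2 + 2 * r * s * (1 + I3)"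
    unfolding tri_len2_def by algebra
  moreover have "0 < 2 * r * s * (1 + I3)"
    using assms I_gt by simp
  ultimately show ?thesis
    by (simp add: add_nonneg_pos)
qed

text \<open>This is where (C1) yields nondegenerate triangles: no summand is negative, and if all
  three \<open>1 - I^2\<close> vanish, then \<open>I > -1\<close> forces three tangent circles, for
  which the mixed term is positive.\<close>

lemma tri_area2_pos:
  assumes "0 < r1" "0 < r2" "0 < r3"
  shows "0 < tri_area2 I1 I2 I3 r1 r2 r3"
proof -
  have nonneg: "0 \<le> r1\<^sup>2 * r2\<^sup>2 * (1 - I3\<^sup>2)" "0 \<le> r2\<^sup>2 * r3\<^sup>2 * (1 - I1\<^sup>2)"
    "0 \<le> r3\<^sup>2 * r1\<^sup>2 * (1 - I2\<^sup>2)"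
    using one_minus_sq_nonneg by simp_all
  have "0 \<le> r1 * (I1 + I2 * I3)" "0 \<le> r2 * (I2 + I3 * I1)" "0 \<le> r3 * (I3 + I1 * I2)"
    using C1 assms by simp_all
  then have nonneg': "0 \<le> 2 * r1 * r2 * r3 * (r1 * (I1 + I2 * I3) + r2 * (I2 + I3 * I1) + r3 * (I3 + I1 * I2))"
    using assms by simp
  show ?thesis
  proof (cases "I1\<^sup>2 = 1 \<and> I2\<^sup>2 = 1 \<and> I3\<^sup>2 = 1")
    case True
    then have "I1 = 1" "I2 = 1" "I3 = 1"
      using I_gt by (auto simp: power2_eq_1_iff)
    then show ?thesis
      using assms by (simp add: tri_area2_def add_pos_pos)
  next
    case False
    then have "0 < 1 - I1\<^sup>2 \<or> 0 < 1 - I2\<^sup>2 \<or> 0 < 1 - I3\<^sup>2"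
      using one_minus_sq_nonneg by linarith
    then have "0 < r1\<^sup>2 * r2\<^sup>2 * (1 - I3\<^sup>2) \<or> 0 < r2\<^sup>2 * r3\<^sup>2 * (1 - I1\<^sup>2)
       \<or> 0 < r3\<^sup>2 * r1\<^sup>2 * (1 - I2\<^sup>2)"
      using assms by auto
    then show ?thesis
      using nonneg nonneg' unfolding tri_area2_def by linarith
  qed
qed

lemma tri_dot_abs_less:
  assumes "0 < r1" "0 < r2" "0 < r3"
  shows "\<bar>tri_dot I1 I2 I3 r1 r2 r3 / (sqrt (tri_len2 I2 r3 r1) * sqrt (tri_len2 I3 r1 r2))\<bar> < 1"
proof -
  interpret R: circle_triple I3 I1 I2
    by (rule circle_triple.rotate[OF rotate])
  have L: "0 < tri_len2 I2 r3 r1" "0 < tri_len2 I3 r1 r2"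
    using R.tri_len2_pos tri_len2_pos assms by auto
  have "(tri_dot I1 I2 I3 r1 r2 r3)\<^sup>2 < tri_len2 I2 r3 r1 * tri_len2 I3 r1 r2"
    using tri_area2_eq[of I2 r3 r1 I3 r2 I1] tri_area2_pos[OF assms] by linarith
  then have "\<bar>tri_dot I1 I2 I3 r1 r2 r3\<bar> < sqrt (tri_len2 I2 r3 r1 * tri_len2 I3 r1 r2)"
    by (metis real_sqrt_abs real_sqrt_less_iff)
  then show ?thesis
    using L by (simp add: real_sqrt_mult abs_mult)
qed

lemma tri_dot_bounds:
  assumes "0 < r1" "0 < r2" "0 < r3"
  shows "- 1 < tri_dot I1 I2 I3 r1 r2 r3 / (sqrt (tri_len2 I2 r3 r1) * sqrt (tri_len2 I3 r1 r2))"
    and "tri_dot I1 I2 I3 r1 r2 r3 / (sqrt (tri_len2 I2 r3 r1) * sqrt (tri_len2 I3 r1 r2)) < 1"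
  using tri_dot_abs_less[OF assms] unfolding abs_less_iff by linarith+

lemma cos_tri_angle:
  assumes "0 < r1" "0 < r2" "0 < r3"
  shows "cos (tri_angle I1 I2 I3 r1 r2 r3) =
    tri_dot I1 I2 I3 r1 r2 r3 / (sqrt (tri_len2 I2 r3 r1) * sqrt (tri_len2 I3 r1 r2))"
  unfolding tri_angle_def using tri_dot_bounds[OF assms] by (intro cos_arccos) auto

lemma sin_tri_angle:
  assumes "0 < r1" "0 < r2" "0 < r3"
  shows "sin (tri_angle I1 I2 I3 r1 r2 r3) =
    sqrt (tri_area2 I1 I2 I3 r1 r2 r3) / (sqrt (tri_len2 I2 r3 r1) * sqrt (tri_len2 I3 r1 r2))"
proof -
  interpret R: circle_triple I3 I1 I2
    by (rule circle_triple.rotate[OF rotate])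
  have L: "0 < tri_len2 I2 r3 r1" "0 < tri_len2 I3 r1 r2"
    using R.tri_len2_pos tri_len2_pos assms by auto
  let ?c = "tri_dot I1 I2 I3 r1 r2 r3 / (sqrt (tri_len2 I2 r3 r1) * sqrt (tri_len2 I3 r1 r2))"
  have "sin (tri_angle I1 I2 I3 r1 r2 r3) = sqrt (1 - ?c\<^sup>2)"
    unfolding tri_angle_def using tri_dot_bounds[OF assms] by (intro sin_arccos) auto
  also have "1 - ?c\<^sup>2 = tri_area2 I1 I2 I3 r1 r2 r3 / (tri_len2 I2 r3 r1 * tri_len2 I3 r1 r2)"
    using L tri_area2_eq[of I2 r3 r1 I3 r2 I1, symmetric]
    by (simp add: power_divide power_mult_distrib diff_divide_distrib)
  finally show ?thesis
    by (simp add: real_sqrt_divide real_sqrt_mult)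
qed

lemma tri_angle_bounds:
  assumes "0 < r1" "0 < r2" "0 < r3"
  shows "0 < tri_angle I1 I2 I3 r1 r2 r3" "tri_angle I1 I2 I3 r1 r2 r3 < pi"
  unfolding tri_angle_def
  using arccos_lt_bounded[of "tri_dot I1 I2 I3 r1 r2 r3 / (sqrt (tri_len2 I2 r3 r1) * sqrt (tri_len2 I3 r1 r2))"]
    tri_dot_bounds[OF assms] by auto

text \<open>The factorization \<open>p1 * p2 - W = - p3 * L3\<close> gives
  \<open>cos (a1 + a2) = cos (pi - a3)\<close>; the positive sine then places \<open>a1 + a2\<close>
  below \<open>pi\<close>, where the cosine is injective.\<close>

lemma tri_angle_sum:
  assumes "0 < r1" "0 < r2" "0 < r3"
  shows "tri_angle I1 I2 I3 r1 r2 r3 + tri_angle I2 I3 I1 r2 r3 r1 + tri_angle I3 I1 I2 r3 r1 r2 = pi"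
proof -
  interpret R2: circle_triple I2 I3 I1 by (rule rotate)
  interpret R3: circle_triple I3 I1 I2 by (rule R2.rotate)
  let ?a1 = "tri_angle I1 I2 I3 r1 r2 r3" and ?a2 = "tri_angle I2 I3 I1 r2 r3 r1"
    and ?a3 = "tri_angle I3 I1 I2 r3 r1 r2"
  define p1 p2 p3 where "p1 = tri_dot I1 I2 I3 r1 r2 r3" and "p2 = tri_dot I2 I3 I1 r2 r3 r1"
    and "p3 = tri_dot I3 I1 I2 r3 r1 r2"
  define L1 L2 L3 where "L1 = tri_len2 I1 r2 r3" and "L2 = tri_len2 I2 r3 r1"
    and "L3 = tri_len2 I3 r1 r2"
  define W where "W = tri_area2 I1 I2 I3 r1 r2 r3"
  note defs = p1_def p2_def p3_def L1_def L2_def L3_def W_def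
  have L: "0 < L1" "0 < L2" "0 < L3"
    unfolding defs using tri_len2_pos R2.tri_len2_pos R3.tri_len2_pos assms by auto
  have W: "0 < W"
    unfolding W_def by (rule tri_area2_pos[OF assms])
  have Lp: "L1 = p2 + p3" "L2 = p3 + p1" "L3 = p1 + p2"
    unfolding defs by (rule tri_len2_eq_dot)+
  have "W = L2 * L3 - p1\<^sup>2"
    unfolding defs by (rule tri_area2_eq[symmetric])
  then have key: "p1 * p2 - W = - p3 * L3"
    unfolding Lp by (simp add: algebra_simps power2_eq_square)
  have W2: "tri_area2 I2 I3 I1 r2 r3 r1 = W" "tri_area2 I3 I1 I2 r3 r1 r2 = W"
    unfolding W_def using tri_area2_rotate by metis+
  have c: "cos ?a1 = p1 / (sqrt L2 * sqrt L3)" "cos ?a2 = p2 / (sqrt L3 * sqrt L1)"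
      "cos ?a3 = p3 / (sqrt L1 * sqrt L2)"
    unfolding defs using cos_tri_angle R2.cos_tri_angle R3.cos_tri_angle assms by auto
  have s: "sin ?a1 = sqrt W / (sqrt L2 * sqrt L3)" "sin ?a2 = sqrt W / (sqrt L3 * sqrt L1)"
    using sin_tri_angle[of r1 r2 r3] R2.sin_tri_angle[of r2 r3 r1] assms W2
    unfolding defs by auto
  have sq: "sqrt L3 * sqrt L3 = L3" "sqrt W * sqrt W = W" using L W by auto
  have ne: "sqrt L1 \<noteq> 0" "sqrt L2 \<noteq> 0" "sqrt L3 \<noteq> 0" using L by auto
  have den: "sqrt L2 * sqrt L3 * (sqrt L3 * sqrt L1) = L3 * (sqrt L1 * sqrt L2)"
    unfolding mult.assoc[of "sqrt L2"] mult.assoc[of "sqrt L3", symmetric] sq by simp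
  have "cos (?a1 + ?a2) = (p1 * p2 - sqrt W * sqrt W) / (sqrt L2 * sqrt L3 * (sqrt L3 * sqrt L1))"
    unfolding cos_add c s by (simp add: diff_divide_distrib)
  also have "\<dots> = (L3 * - p3) / (L3 * (sqrt L1 * sqrt L2))"
    unfolding den sq key by (simp add: mult.commute)
  also have "\<dots> = - p3 / (sqrt L1 * sqrt L2)"
    using L by (intro mult_divide_mult_cancel_left) simp
  finally have cos_eq: "cos (?a1 + ?a2) = cos (pi - ?a3)"
    by (simp add: c)
  have "sin (?a1 + ?a2) = sqrt W * (p1 + p2) / (sqrt L2 * sqrt L3 * (sqrt L3 * sqrt L1))"
    unfolding sin_add c s by (simp add: add_divide_distrib algebra_simps)
  also have "\<dots> > 0"
    using L W unfolding Lp by simp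
  finally have sin_pos: "0 < sin (?a1 + ?a2)" .
  have b: "0 < ?a1" "?a1 < pi" "0 < ?a2" "?a2 < pi" "0 < ?a3" "?a3 < pi"
    using tri_angle_bounds R2.tri_angle_bounds R3.tri_angle_bounds assms by auto
  have "?a1 + ?a2 < pi"
  proof (rule ccontr)
    assume "\<not> ?a1 + ?a2 < pi"
    then have "sin (?a1 + ?a2) \<le> 0"
      using b sin_le_zero[of "?a1 + ?a2"] sin_pi by (cases "?a1 + ?a2 = pi") auto
    then show False using sin_pos by simp
  qed
  then have "arccos (cos (?a1 + ?a2)) = ?a1 + ?a2" "arccos (cos (pi - ?a3)) = pi - ?a3"
    using b by (intro arccos_cos; linarith)+
  then show ?thesis
    unfolding cos_eq by linarith
qed

section \<open>Bounds on the edge weights\<close>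

lemma tri_num_nonneg:
  assumes "0 < r1" "0 < r2" "0 < r3"
  shows "0 \<le> tri_num I1 I2 I3 r1 r2 r3"
proof -
  have "0 \<le> r1 * r2 * (1 - I3\<^sup>2)" "0 \<le> r1 * r3 * (I1 + I2 * I3)" "0 \<le> r2 * r3 * (I2 + I3 * I1)"
    using assms C1 one_minus_sq_nonneg by simp_all
  then show ?thesis unfolding tri_num_def by linarith
qed

lemma tri_cond_nonneg:
  assumes "0 < r1" "0 < r2" "0 < r3"
  shows "0 \<le> tri_cond I1 I2 I3 r1 r2 r3"
  unfolding tri_cond_def
  using assms tri_num_nonneg tri_area2_pos tri_len2_pos by (simp add: less_imp_le)

text \<open>Put \<open>q = r1 * r2 / L\<close> and \<open>a = I3 + I1 * I2\<close>. The numerator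
  satisfies \<open>X^2 \<le> W + 2 * a * r3^2 * L\<close>, while the area satisfies
  \<open>W \<ge> 2 * a * r1 * r2 * r3^2\<close>; the same \<open>a\<close> occurs in both, so the
  squared weight is at most \<open>q * (q + 1)\<close>. Finally \<open>q\<close> is bounded for all
  radii because \<open>L \<ge> 2 * r1 * r2 * (1 + I3)\<close>.\<close>

lemma tri_cond_square_le:
  assumes "0 < r1" "0 < r2" "0 < r3"
  shows "(tri_cond I1 I2 I3 r1 r2 r3)\<^sup>2 \<le> (1 / (2 * (1 + I3)))\<^sup>2 + 1 / (2 * (1 + I3))"
proof -
  define L where "L = tri_len2 I3 r1 r2"
  define W where "W = tri_area2 I1 I2 I3 r1 r2 r3"
  define X where "X = tri_num I1 I2 I3 r1 r2 r3"
  define a where "a = I3 + I1 * I2"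
  define q where "q = r1 * r2 / L"
  have L: "0 < L" unfolding L_def by (rule tri_len2_pos) (use assms in auto)
  have W: "0 < W" unfolding W_def by (rule tri_area2_pos[OF assms])
  have a: "0 \<le> a" "a \<le> 2"
  proof -
    have "\<bar>I1 * I2\<bar> \<le> 1 * 1"
      unfolding abs_mult using I_gt I_le by (intro mult_mono) auto
    then show "a \<le> 2" unfolding a_def using I_le by linarith
    show "0 \<le> a" unfolding a_def using C1 by simp
  qed
  have "L = (r1 - r2)\<^sup>2 + 2 * (r1 * r2) * (1 + I3)"
    unfolding L_def tri_len2_def by algebra
  then have "2 * (r1 * r2) * (1 + I3) \<le> L" by simp
  then have q: "q \<le> 1 / (2 * (1 + I3))"
    unfolding q_def using L I_gt by (simp add: field_simps)
  have q0: "0 < q" unfolding q_def using L assms by simp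
  have D: "- (1 - I1\<^sup>2 - I2\<^sup>2 - I3\<^sup>2 - 2 * I1 * I2 * I3) = a\<^sup>2 - (1 - I1\<^sup>2) * (1 - I2\<^sup>2)"
    unfolding a_def by algebra
  have Dle: "- (1 - I1\<^sup>2 - I2\<^sup>2 - I3\<^sup>2 - 2 * I1 * I2 * I3) \<le> 2 * a"
  proof -
    have "a\<^sup>2 \<le> 2 * a" using a by (simp add: power2_eq_square mult_right_mono)
    moreover have "0 \<le> (1 - I1\<^sup>2) * (1 - I2\<^sup>2)" using one_minus_sq_nonneg by simp
    ultimately show ?thesis unfolding D by linarith
  qed
  have Wge: "r1 * r2 * r3\<^sup>2 * (2 * a) \<le> W"
  proof -
    have "W - r1 * r2 * r3\<^sup>2 * (2 * a) = r1\<^sup>2 * r2\<^sup>2 * (1 - I3\<^sup>2) + r2\<^sup>2 * r3\<^sup>2 * (1 - I1\<^sup>2) + r3\<^sup>2 * r1\<^sup>2 * (1 - I2\<^sup>2)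
      + 2 * r1 * r2 * r3 * (r1 * (I1 + I2 * I3) + r2 * (I2 + I3 * I1))"
      unfolding W_def tri_area2_def a_def by algebra
    moreover have "0 \<le> r1\<^sup>2 * r2\<^sup>2 * (1 - I3\<^sup>2)" "0 \<le> r2\<^sup>2 * r3\<^sup>2 * (1 - I1\<^sup>2)"
      "0 \<le> r3\<^sup>2 * r1\<^sup>2 * (1 - I2\<^sup>2)"
      using one_minus_sq_nonneg by simp_all
    moreover have "0 \<le> r1 * (I1 + I2 * I3)" "0 \<le> r2 * (I2 + I3 * I1)"
      using C1 assms by simp_all
    then have "0 \<le> 2 * r1 * r2 * r3 * (r1 * (I1 + I2 * I3) + r2 * (I2 + I3 * I1))"
      using assms by simp
    ultimately show ?thesis by linarith
  qed
  have "X\<^sup>2 = (1 - I3\<^sup>2) * W + (- (1 - I1\<^sup>2 - I2\<^sup>2 - I3\<^sup>2 - 2 * I1 * I2 * I3)) * (r3\<^sup>2 * L)"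
    unfolding X_def W_def L_def tri_num_square by algebra
  also have "\<dots> \<le> 1 * W + 2 * a * (r3\<^sup>2 * L)"
    using Dle W L by (intro add_mono mult_right_mono) auto
  finally have X2: "X\<^sup>2 \<le> W + 2 * a * (r3\<^sup>2 * L)" by simp
  have "(r1 * r2) * X\<^sup>2 \<le> (r1 * r2) * (W + 2 * a * (r3\<^sup>2 * L))"
    using X2 assms by (intro mult_left_mono) auto
  also have "\<dots> = (r1 * r2) * W + (r1 * r2 * r3\<^sup>2 * (2 * a)) * L"
    by (simp add: algebra_simps)
  also have "\<dots> \<le> (r1 * r2) * W + W * L"
    using Wge L by (intro add_left_mono mult_right_mono) auto
  finally have "(r1 * r2) * X\<^sup>2 \<le> W * (r1 * r2 + L)"
    by (simp add: algebra_simps)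
  then have rX: "(r1 * r2) * X\<^sup>2 / (W * L) \<le> q + 1"
    using W L unfolding q_def by (simp add: field_simps)
  have "(tri_cond I1 I2 I3 r1 r2 r3)\<^sup>2 = (r1 * r2 * X)\<^sup>2 / ((sqrt W)\<^sup>2 * L\<^sup>2)"
    unfolding tri_cond_def X_def[symmetric] W_def[symmetric] L_def[symmetric]
    by (simp add: power_divide power_mult_distrib)
  also have "\<dots> = q * ((r1 * r2) * X\<^sup>2 / (W * L))"
    using W L unfolding q_def by (simp add: power2_eq_square ac_simps)
  also have "\<dots> \<le> q * (q + 1)"
    using rX q0 by (intro mult_left_mono) auto
  also have "\<dots> = q\<^sup>2 + q" by (simp add: power2_eq_square algebra_simps)
  also have "\<dots> \<le> (1 / (2 * (1 + I3)))\<^sup>2 + 1 / (2 * (1 + I3))"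
    using q q0 by (intro add_mono power_mono) auto
  finally show ?thesis .
qed

lemma tri_cond_upper: "\<exists>M\<ge>0. \<forall>r1>0. \<forall>r2>0. \<forall>r3>0. tri_cond I1 I2 I3 r1 r2 r3 \<le> M"
proof (intro exI conjI allI impI)
  let ?B = "(1 / (2 * (1 + I3)))\<^sup>2 + 1 / (2 * (1 + I3))"
  show "0 \<le> sqrt ?B" using I_gt by simp
  fix r1 r2 r3 :: real assume "0 < r1" "0 < r2" "0 < r3"
  then show "tri_cond I1 I2 I3 r1 r2 r3 \<le> sqrt ?B"
    using tri_cond_square_le real_le_rsqrt by blast
qed

lemma tri_len2_le:
  assumes "0 < r" "0 < s" "r \<le> M" "s \<le> M"
  shows "tri_len2 I3 r s \<le> 4 * M\<^sup>2"
proof -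
  have "tri_len2 I3 r s \<le> r\<^sup>2 + s\<^sup>2 + 2 * r * s * 1"
    unfolding tri_len2_def using assms I_le by (intro add_left_mono mult_left_mono) auto
  also have "\<dots> = (r + s)\<^sup>2" by (simp add: power2_sum)
  also have "\<dots> \<le> (2 * M)\<^sup>2" using assms by (intro power_mono) auto
  finally show ?thesis by (simp add: power_mult_distrib)
qed

text \<open>The product is \<open>tri_num\<close> at unit radii; the factored form exposes when it
  can vanish.\<close>

lemma cond_const_nonneg: "0 \<le> (1 + I3) * (1 + I1 + I2 - I3)"
proof -
  have "(1 + I3) * (1 + I1 + I2 - I3) = (1 - I3\<^sup>2) + (I1 + I2 * I3) + (I2 + I3 * I1)"
    by (simp add: algebra_simps power2_eq_square)
  then show ?thesis using C1 one_minus_sq_nonneg by linarith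
qed

text \<open>The numerator of the weight is at least \<open>m^4\<close> times its unit-radius
  constant, and both \<open>sqrt W\<close> and \<open>L\<close> are at most
  \<open>4 * M^2\<close>.\<close>

lemma tri_cond_lower:
  assumes "0 < m" "m \<le> r1" "m \<le> r2" "m \<le> r3" "r1 \<le> M" "r2 \<le> M" "r3 \<le> M"
  shows "(m\<^sup>2 / (4 * M\<^sup>2))\<^sup>2 * ((1 + I3) * (1 + I1 + I2 - I3)) \<le> tri_cond I1 I2 I3 r1 r2 r3"
proof -
  interpret R3: circle_triple I3 I1 I2
    by (rule circle_triple.rotate[OF rotate])
  define L where "L = tri_len2 I3 r1 r2"
  define W where "W = tri_area2 I1 I2 I3 r1 r2 r3"
  define X where "X = tri_num I1 I2 I3 r1 r2 r3"
  have r: "0 < r1" "0 < r2" "0 < r3" "0 < M" using assms by auto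
  have L: "0 < L" "L \<le> 4 * M\<^sup>2"
    unfolding L_def using tri_len2_pos tri_len2_le assms r by auto
  have L2: "tri_len2 I2 r3 r1 \<le> 4 * M\<^sup>2" "0 < tri_len2 I2 r3 r1"
    using R3.tri_len2_le R3.tri_len2_pos assms r by auto
  have W: "0 < W" unfolding W_def by (rule tri_area2_pos) (use r in auto)
  have "W \<le> tri_len2 I2 r3 r1 * L"
    unfolding W_def L_def using tri_area2_eq[of I2 r3 r1 I3 r2 I1]
      zero_le_power2[of "tri_dot I1 I2 I3 r1 r2 r3"] by linarith
  also have "\<dots> \<le> (4 * M\<^sup>2) * (4 * M\<^sup>2)" using L L2 by (intro mult_mono) auto
  finally have sW: "sqrt W \<le> 4 * M\<^sup>2"
    by (intro real_le_lsqrt) (simp_all add: power2_eq_square)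
  have rr: "m\<^sup>2 \<le> r1 * r2" "m\<^sup>2 \<le> r1 * r3" "m\<^sup>2 \<le> r2 * r3"
    unfolding power2_eq_square using assms r by (auto intro!: mult_mono)
  have "m\<^sup>2 * ((1 + I3) * (1 + I1 + I2 - I3))
      = m\<^sup>2 * (1 - I3\<^sup>2) + m\<^sup>2 * (I1 + I2 * I3) + m\<^sup>2 * (I2 + I3 * I1)"
    by (simp add: algebra_simps power2_eq_square)
  also have "\<dots> \<le> X"
    unfolding X_def tri_num_def using rr C1 one_minus_sq_nonneg
    by (intro add_mono mult_right_mono) auto
  finally have X: "m\<^sup>2 * ((1 + I3) * (1 + I1 + I2 - I3)) \<le> X" .
  note e = cond_const_nonneg
  have "(m\<^sup>2 / (4 * M\<^sup>2))\<^sup>2 * ((1 + I3) * (1 + I1 + I2 - I3))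
      = m\<^sup>2 * (m\<^sup>2 * ((1 + I3) * (1 + I1 + I2 - I3))) / ((4 * M\<^sup>2) * (4 * M\<^sup>2))"
    by (simp add: power2_eq_square)
  also have "\<dots> \<le> (r1 * r2) * X / (sqrt W * L)"
  proof (rule frac_le)
    have "0 \<le> X" using X e by (meson mult_nonneg_nonneg order_trans zero_le_power2)
    then show "0 \<le> r1 * r2 * X" using r by simp
    show "m\<^sup>2 * (m\<^sup>2 * ((1 + I3) * (1 + I1 + I2 - I3))) \<le> r1 * r2 * X"
      using rr X e r by (intro mult_mono) auto
    show "0 < sqrt W * L" using W L by simp
    show "sqrt W * L \<le> 4 * M\<^sup>2 * (4 * M\<^sup>2)"
      using sW L W by (intro mult_mono) auto
  qed
  finally show ?thesis
    unfolding tri_cond_def X_def W_def L_def .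
qed

end

section \<open>Derivatives along lines in logarithmic radii\<close>

lemma tri_len2_exp_deriv:
  fixes a b x y I s :: real
  defines "r \<equiv> exp (a + s * x)" and "q \<equiv> exp (b + s * y)"
  shows "((\<lambda>s. tri_len2 I (exp (a + s * x)) (exp (b + s * y))) has_real_derivative
     2 * (r\<^sup>2 * x + q\<^sup>2 * y + r * q * I * (x + y))) (at s)"
  unfolding tri_len2_def assms
  by (auto intro!: derivative_eq_intros simp: algebra_simps power2_eq_square)

lemma tri_dot_exp_deriv:
  fixes a1 a2 a3 x1 x2 x3 s :: real
  defines "r1 \<equiv> exp (a1 + s * x1)" and "r2 \<equiv> exp (a2 + s * x2)" and "r3 \<equiv> exp (a3 + s * x3)"
  shows "((\<lambda>s. tri_dot I1 I2 I3 (exp (a1 + s * x1)) (exp (a2 + s * x2)) (exp (a3 + s * x3))) has_real_derivative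
     2 * r1\<^sup>2 * x1 + r1 * r2 * I3 * (x1 + x2) + r1 * r3 * I2 * (x1 + x3) - r2 * r3 * I1 * (x2 + x3)) (at s)"
  unfolding tri_dot_def assms
  by (auto intro!: derivative_eq_intros simp: algebra_simps power2_eq_square)

text \<open>\<open>W\<close> is the Gram determinant, so the square root in the derivative of
  \<open>arccos\<close> becomes \<open>sqrt W\<close> divided by the product of the two lengths.
  Halved derivatives \<open>L'\<close> and \<open>M'\<close> absorb the factor from differentiating
  the roots.\<close>

lemma arccos_quotient_deriv:
  fixes p L M :: "real \<Rightarrow> real"
  assumes p: "(p has_real_derivative p') (at s)"
    and L: "(L has_real_derivative 2 * L') (at s)" and M: "(M has_real_derivative 2 * M') (at s)"
    and pos: "0 < L s" "0 < M s" and W: "0 < W" "W = L s * M s - (p s)\<^sup>2"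
  shows "((\<lambda>s. arccos (p s / (sqrt (L s) * sqrt (M s)))) has_real_derivative
     (p s * (L' * M s + M' * L s) - p' * L s * M s) / (sqrt W * (L s * M s))) (at s)"
proof -
  define c where "c = p s / (sqrt (L s) * sqrt (M s))"
  define S where "S = sqrt (L s) * sqrt (M s)"
  have S: "0 < S" "S\<^sup>2 = L s * M s"
    unfolding S_def using pos by (auto simp: power_mult_distrib)
  have "1 - c\<^sup>2 = W / S\<^sup>2"
    unfolding c_def S_def[symmetric] W(2) using pos S by (simp add: power_divide diff_divide_distrib)
  moreover have "sqrt (W / S\<^sup>2) = sqrt W / S" "0 < W / S\<^sup>2"
    using S(1) W(1) by (simp_all add: real_sqrt_divide)
  ultimately have c1: "sqrt (1 - c\<^sup>2) = sqrt W / S" "c\<^sup>2 < 1"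
    by simp_all
  then have c2: "- 1 < c" "c < 1"
    using abs_square_less_1[of c] by auto
  have dS: "((\<lambda>s. sqrt (L s) * sqrt (M s)) has_real_derivative
      sqrt (L s) * (M' / sqrt (M s)) + (L' / sqrt (L s)) * sqrt (M s)) (at s)"
    using pos by (auto intro!: derivative_eq_intros L M simp: field_simps)
  have "sqrt (L s) * (M' / sqrt (M s)) + (L' / sqrt (L s)) * sqrt (M s) = (L' * M s + M' * L s) / S"
  proof -
    have "sqrt (L s) * sqrt (L s) = L s" "sqrt (M s) * sqrt (M s) = M s" using pos by auto
    then show ?thesis unfolding S_def using pos by (simp add: field_simps)
  qed
  with dS have dS': "((\<lambda>s. sqrt (L s) * sqrt (M s)) has_real_derivative (L' * M s + M' * L s) / S) (at s)"
    by simp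
  have dc: "((\<lambda>s. p s / (sqrt (L s) * sqrt (M s))) has_real_derivative
      (p' * S - p s * ((L' * M s + M' * L s) / S)) / (S * S)) (at s)"
    using DERIV_divide[OF p dS'] pos unfolding S_def by auto
  have "((\<lambda>s. arccos (p s / (sqrt (L s) * sqrt (M s)))) has_real_derivative
      inverse (- sqrt (1 - c\<^sup>2)) * ((p' * S - p s * ((L' * M s + M' * L s) / S)) / (S * S))) (at s)"
    using DERIV_chain2[OF _ dc, of arccos] DERIV_arccos[OF c2] unfolding c_def by blast
  moreover have "inverse (- sqrt (1 - c\<^sup>2)) * ((p' * S - p s * ((L' * M s + M' * L s) / S)) / (S * S))
     = (p s * (L' * M s + M' * L s) - p' * S\<^sup>2) / (sqrt W * S\<^sup>2)"
    unfolding c1 using S(1) W(1) by (simp add: field_simps power2_eq_square)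
  ultimately show ?thesis
    unfolding S(2) by (simp add: mult.assoc)
qed

text \<open>Two positive weights suffice because the three differences add up to zero: the square of
  the third is at most twice the sum of the other two squares, whence the constant
  \<open>e / 3\<close>.\<close>

lemma weighted_differences_lower:
  fixes e1 e2 e3 :: real
  assumes "0 < e1" "0 < e2" "0 \<le> e3"
  shows "\<exists>\<delta>>0. \<forall>x1 x2 x3. \<delta> * ((x1 - x2)\<^sup>2 + (x2 - x3)\<^sup>2 + (x3 - x1)\<^sup>2)
           \<le> e3 * (x1 - x2)\<^sup>2 + e1 * (x2 - x3)\<^sup>2 + e2 * (x3 - x1)\<^sup>2"
proof (intro exI conjI allI)
  define e where "e = min e1 e2"
  have e: "0 < e" "e \<le> e1" "e \<le> e2" unfolding e_def using assms by auto
  show "0 < e / 3" using e by simp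
  fix x1 x2 x3 :: real
  have "(x1 - x2)\<^sup>2 = ((x2 - x3) + (x3 - x1))\<^sup>2" by (simp add: power2_eq_square algebra_simps)
  also have "\<dots> \<le> 2 * (x2 - x3)\<^sup>2 + 2 * (x3 - x1)\<^sup>2"
    using zero_le_power2[of "(x2 - x3) - (x3 - x1)"]
    unfolding power2_sum[of "x2 - x3" "x3 - x1"] power2_diff[of "x2 - x3" "x3 - x1"] by linarith
  finally have "(x1 - x2)\<^sup>2 + (x2 - x3)\<^sup>2 + (x3 - x1)\<^sup>2 \<le> 3 * ((x2 - x3)\<^sup>2 + (x3 - x1)\<^sup>2)" by simp
  then have "e / 3 * ((x1 - x2)\<^sup>2 + (x2 - x3)\<^sup>2 + (x3 - x1)\<^sup>2) \<le> e / 3 * (3 * ((x2 - x3)\<^sup>2 + (x3 - x1)\<^sup>2))"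
    using e by (intro mult_left_mono) auto
  also have "\<dots> = 0 * (x1 - x2)\<^sup>2 + e * (x2 - x3)\<^sup>2 + e * (x3 - x1)\<^sup>2" by (simp add: algebra_simps)
  also have "\<dots> \<le> e3 * (x1 - x2)\<^sup>2 + e1 * (x2 - x3)\<^sup>2 + e2 * (x3 - x1)\<^sup>2"
    using e assms by (intro add_mono mult_right_mono) auto
  finally show "e / 3 * ((x1 - x2)\<^sup>2 + (x2 - x3)\<^sup>2 + (x3 - x1)\<^sup>2)
     \<le> e3 * (x1 - x2)\<^sup>2 + e1 * (x2 - x3)\<^sup>2 + e2 * (x3 - x1)\<^sup>2" .
qed

context circle_triple
begin

lemma tri_angle_deriv:
  fixes a1 a2 a3 x1 x2 x3 s :: real
  defines "r1 \<equiv> exp (a1 + s * x1)" and "r2 \<equiv> exp (a2 + s * x2)" and "r3 \<equiv> exp (a3 + s * x3)"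
  shows "((\<lambda>s. tri_angle I1 I2 I3 (exp (a1 + s * x1)) (exp (a2 + s * x2)) (exp (a3 + s * x3))) has_real_derivative
     tri_cond I1 I2 I3 r1 r2 r3 * (x2 - x1) + tri_cond I1 I3 I2 r1 r3 r2 * (x3 - x1)) (at s)"
proof -
  interpret R3: circle_triple I3 I1 I2
    by (rule circle_triple.rotate[OF rotate])
  have r: "0 < r1" "0 < r2" "0 < r3" unfolding assms by auto
  define L2 L3 W where "L2 = tri_len2 I2 r3 r1" and "L3 = tri_len2 I3 r1 r2"
    and "W = tri_area2 I1 I2 I3 r1 r2 r3"
  have L: "0 < L2" "0 < L3"
    unfolding L2_def L3_def using R3.tri_len2_pos tri_len2_pos r by auto
  have W: "0 < W" unfolding W_def by (rule tri_area2_pos[OF r])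
  have W': "tri_area2 I1 I3 I2 r1 r3 r2 = W"
    unfolding W_def by (simp add: tri_area2_def algebra_simps)
  have *: "((\<lambda>s. tri_angle I1 I2 I3 (exp (a1 + s * x1)) (exp (a2 + s * x2)) (exp (a3 + s * x3))) has_real_derivative
     (tri_dot I1 I2 I3 r1 r2 r3 * ((r3\<^sup>2 * x3 + r1\<^sup>2 * x1 + r3 * r1 * I2 * (x3 + x1)) * L3
          + (r1\<^sup>2 * x1 + r2\<^sup>2 * x2 + r1 * r2 * I3 * (x1 + x2)) * L2)
        - (2 * r1\<^sup>2 * x1 + r1 * r2 * I3 * (x1 + x2) + r1 * r3 * I2 * (x1 + x3) - r2 * r3 * I1 * (x2 + x3)) * L2 * L3)
      / (sqrt W * (L2 * L3))) (at s)"
    unfolding tri_angle_def L2_def L3_def assms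
    by (intro arccos_quotient_deriv tri_dot_exp_deriv tri_len2_exp_deriv)
      (use L W tri_area2_eq[of I2 r3 r1 I3 r2 I1] in \<open>simp_all add: assms L2_def L3_def W_def\<close>)
  have "(r1 * r2 * tri_num I1 I2 I3 r1 r2 r3 * L2 * (x2 - x1) + r1 * r3 * tri_num I1 I3 I2 r1 r3 r2 * L3 * (x3 - x1))
      / (sqrt W * (L2 * L3))
     = tri_cond I1 I2 I3 r1 r2 r3 * (x2 - x1) + tri_cond I1 I3 I2 r1 r3 r2 * (x3 - x1)"
    unfolding tri_cond_def W' W_def[symmetric] L3_def[symmetric] tri_len2_commute[of I2 r1 r3] L2_def[symmetric]
    using L W by (simp add: add_divide_distrib)
  moreover have "tri_dot I1 I2 I3 r1 r2 r3 * ((r3\<^sup>2 * x3 + r1\<^sup>2 * x1 + r3 * r1 * I2 * (x3 + x1)) * L3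
          + (r1\<^sup>2 * x1 + r2\<^sup>2 * x2 + r1 * r2 * I3 * (x1 + x2)) * L2)
        - (2 * r1\<^sup>2 * x1 + r1 * r2 * I3 * (x1 + x2) + r1 * r3 * I2 * (x1 + x3) - r2 * r3 * I1 * (x2 + x3)) * L2 * L3
      = r1 * r2 * tri_num I1 I2 I3 r1 r2 r3 * L2 * (x2 - x1) + r1 * r3 * tri_num I1 I3 I2 r1 r3 r2 * L3 * (x3 - x1)"
    unfolding L2_def L3_def tri_angle_deriv_identity[symmetric] by (simp add: add.commute)
  ultimately show ?thesis using * by simp
qed

text \<open>Mean value theorem on the segment between the two points. As the weights are bounded for
  all radii, the constant does not depend on the position; each velocity difference costs
  \<open>2 * d\<close>.\<close>

lemma tri_angle_lipschitz:
  "\<exists>K\<ge>0. \<forall>a1 a2 a3 b1 b2 b3 d. \<bar>a1 - b1\<bar> \<le> d \<longrightarrow> \<bar>a2 - b2\<bar> \<le> d \<longrightarrow> \<bar>a3 - b3\<bar> \<le> d \<longrightarrow>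
     \<bar>tri_angle I1 I2 I3 (exp a1) (exp a2) (exp a3) - tri_angle I1 I2 I3 (exp b1) (exp b2) (exp b3)\<bar> \<le> K * d"
proof -
  interpret S: circle_triple I1 I3 I2 by (rule swap)
  obtain M where M: "M \<ge> 0" "\<And>r1 r2 r3. 0 < r1 \<Longrightarrow> 0 < r2 \<Longrightarrow> 0 < r3 \<Longrightarrow> tri_cond I1 I2 I3 r1 r2 r3 \<le> M"
    using tri_cond_upper by blast
  obtain N where N: "N \<ge> 0" "\<And>r1 r2 r3. 0 < r1 \<Longrightarrow> 0 < r2 \<Longrightarrow> 0 < r3 \<Longrightarrow> tri_cond I1 I3 I2 r1 r2 r3 \<le> N"
    using S.tri_cond_upper by blast
  show ?thesis
  proof (intro exI[of _ "2 * M + 2 * N"] conjI allI impI)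
    show "0 \<le> 2 * M + 2 * N" using M N by simp
    fix a1 a2 a3 b1 b2 b3 d :: real
    assume d: "\<bar>a1 - b1\<bar> \<le> d" "\<bar>a2 - b2\<bar> \<le> d" "\<bar>a3 - b3\<bar> \<le> d"
    define x1 x2 x3 where "x1 = a1 - b1" and "x2 = a2 - b2" and "x3 = a3 - b3"
    define g where "g s = tri_angle I1 I2 I3 (exp (b1 + s * x1)) (exp (b2 + s * x2)) (exp (b3 + s * x3))" for s
    define h where "h s = tri_cond I1 I2 I3 (exp (b1 + s * x1)) (exp (b2 + s * x2)) (exp (b3 + s * x3)) * (x2 - x1)
        + tri_cond I1 I3 I2 (exp (b1 + s * x1)) (exp (b3 + s * x3)) (exp (b2 + s * x2)) * (x3 - x1)" for s
    have "(g has_real_derivative h s) (at s)" for s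
      unfolding g_def h_def by (rule tri_angle_deriv)
    then obtain z where z: "g 1 - g 0 = (1 - 0) * h z"
      using MVT2[OF zero_less_one, of g h] by auto
    have "\<bar>g 1 - g 0\<bar> \<le> M * (2 * d) + N * (2 * d)"
      unfolding z h_def mult_1 diff_zero
    proof (rule order_trans[OF abs_triangle_ineq add_mono])
      show "\<bar>tri_cond I1 I2 I3 (exp (b1 + z * x1)) (exp (b2 + z * x2)) (exp (b3 + z * x3)) * (x2 - x1)\<bar> \<le> M * (2 * d)"
        unfolding abs_mult using M d by (intro mult_mono) (auto simp: x1_def x2_def tri_cond_nonneg)
      show "\<bar>tri_cond I1 I3 I2 (exp (b1 + z * x1)) (exp (b3 + z * x3)) (exp (b2 + z * x2)) * (x3 - x1)\<bar> \<le> N * (2 * d)"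
        unfolding abs_mult using N d by (intro mult_mono) (auto simp: x1_def x3_def S.tri_cond_nonneg)
    qed
    then show "\<bar>tri_angle I1 I2 I3 (exp a1) (exp a2) (exp a3) - tri_angle I1 I2 I3 (exp b1) (exp b2) (exp b3)\<bar> \<le> (2 * M + 2 * N) * d"
      by (simp add: g_def x1_def x2_def x3_def algebra_simps)
  qed
qed

text \<open>Any two of the factors \<open>1 + I1 + I2 - I3\<close>, \<open>1 + I2 + I3 - I1\<close>,
  \<open>1 + I3 + I1 - I2\<close> add up to some \<open>2 * (1 + I)\<close>, which is positive, so
  at most one of them vanishes. The three cases differ only by a rotation of the triangle.\<close>

lemma cond_const_lower:
  "\<exists>\<delta>>0. \<forall>x1 x2 x3. \<delta> * ((x1 - x2)\<^sup>2 + (x2 - x3)\<^sup>2 + (x3 - x1)\<^sup>2)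
     \<le> (1 + I3) * (1 + I1 + I2 - I3) * (x1 - x2)\<^sup>2 + (1 + I1) * (1 + I2 + I3 - I1) * (x2 - x3)\<^sup>2
       + (1 + I2) * (1 + I3 + I1 - I2) * (x3 - x1)\<^sup>2"
proof -
  interpret R2: circle_triple I2 I3 I1 by (rule rotate)
  interpret R3: circle_triple I3 I1 I2 by (rule R2.rotate)
  let ?e3 = "(1 + I3) * (1 + I1 + I2 - I3)" and ?e1 = "(1 + I1) * (1 + I2 + I3 - I1)"
    and ?e2 = "(1 + I2) * (1 + I3 + I1 - I2)"
  have e: "0 \<le> ?e1" "0 \<le> ?e2" "0 \<le> ?e3"
    using cond_const_nonneg R2.cond_const_nonneg R3.cond_const_nonneg by auto
  then have e': "0 \<le> 1 + I1 + I2 - I3" "0 \<le> 1 + I2 + I3 - I1" "0 \<le> 1 + I3 + I1 - I2"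
    using I_gt by (auto simp: zero_le_mult_iff)
  consider "0 < 1 + I2 + I3 - I1" "0 < 1 + I3 + I1 - I2" | "0 < 1 + I3 + I1 - I2" "0 < 1 + I1 + I2 - I3"
    | "0 < 1 + I1 + I2 - I3" "0 < 1 + I2 + I3 - I1"
    using e' I_gt by linarith
  then show ?thesis
  proof cases
    case 1
    then show ?thesis using weighted_differences_lower[of ?e1 ?e2 ?e3] e I_gt by simp
  next
    case 2
    then obtain \<delta> where d: "\<delta> > 0" "\<And>x1 x2 x3. \<delta> * ((x1 - x2)\<^sup>2 + (x2 - x3)\<^sup>2 + (x3 - x1)\<^sup>2)
           \<le> ?e1 * (x1 - x2)\<^sup>2 + ?e2 * (x2 - x3)\<^sup>2 + ?e3 * (x3 - x1)\<^sup>2"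
      using weighted_differences_lower[of ?e2 ?e3 ?e1] e I_gt by auto
    show ?thesis
    proof (intro exI[of _ \<delta>] conjI allI)
      show "\<delta> * ((x1 - x2)\<^sup>2 + (x2 - x3)\<^sup>2 + (x3 - x1)\<^sup>2) \<le> ?e3 * (x1 - x2)\<^sup>2 + ?e1 * (x2 - x3)\<^sup>2 + ?e2 * (x3 - x1)\<^sup>2" for x1 x2 x3
        using d(2)[of x2 x3 x1] by (simp add: algebra_simps)
    qed (fact d)
  next
    case 3
    then obtain \<delta> where d: "\<delta> > 0" "\<And>x1 x2 x3. \<delta> * ((x1 - x2)\<^sup>2 + (x2 - x3)\<^sup>2 + (x3 - x1)\<^sup>2)
           \<le> ?e2 * (x1 - x2)\<^sup>2 + ?e3 * (x2 - x3)\<^sup>2 + ?e1 * (x3 - x1)\<^sup>2"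
      using weighted_differences_lower[of ?e3 ?e1 ?e2] e I_gt by auto
    show ?thesis
    proof (intro exI[of _ \<delta>] conjI allI)
      show "\<delta> * ((x1 - x2)\<^sup>2 + (x2 - x3)\<^sup>2 + (x3 - x1)\<^sup>2) \<le> ?e3 * (x1 - x2)\<^sup>2 + ?e1 * (x2 - x3)\<^sup>2 + ?e2 * (x3 - x1)\<^sup>2" for x1 x2 x3
        using d(2)[of x3 x1 x2] by (simp add: algebra_simps)
    qed (fact d)
  qed
qed

text \<open>The Jacobian of the three angles in the logarithmic radii is minus a weighted graph Laplacian.\<close>

lemma tri_angle_monotone:
  fixes R :: real
  shows "\<exists>\<delta>>0. \<forall>a1 a2 a3 b1 b2 b3. \<bar>a1\<bar> \<le> R \<longrightarrow> \<bar>a2\<bar> \<le> R \<longrightarrow> \<bar>a3\<bar> \<le> R \<longrightarrow>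
      \<bar>b1\<bar> \<le> R \<longrightarrow> \<bar>b2\<bar> \<le> R \<longrightarrow> \<bar>b3\<bar> \<le> R \<longrightarrow>
     (tri_angle I1 I2 I3 (exp a1) (exp a2) (exp a3) - tri_angle I1 I2 I3 (exp b1) (exp b2) (exp b3)) * (a1 - b1)
   + (tri_angle I2 I3 I1 (exp a2) (exp a3) (exp a1) - tri_angle I2 I3 I1 (exp b2) (exp b3) (exp b1)) * (a2 - b2)
   + (tri_angle I3 I1 I2 (exp a3) (exp a1) (exp a2) - tri_angle I3 I1 I2 (exp b3) (exp b1) (exp b2)) * (a3 - b3)
   \<le> - \<delta> * (((a1 - b1) - (a2 - b2))\<^sup>2 + ((a2 - b2) - (a3 - b3))\<^sup>2 + ((a3 - b3) - (a1 - b1))\<^sup>2)"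
proof -
  interpret R2: circle_triple I2 I3 I1 by (rule rotate)
  interpret R3: circle_triple I3 I1 I2 by (rule R2.rotate)
  obtain e where e: "0 < e" "\<And>x1 x2 x3. e * ((x1 - x2)\<^sup>2 + (x2 - x3)\<^sup>2 + (x3 - x1)\<^sup>2)
     \<le> (1 + I3) * (1 + I1 + I2 - I3) * (x1 - x2)\<^sup>2 + (1 + I1) * (1 + I2 + I3 - I1) * (x2 - x3)\<^sup>2
       + (1 + I2) * (1 + I3 + I1 - I2) * (x3 - x1)\<^sup>2"
    using cond_const_lower by blast
  define k where "k = ((exp (- R))\<^sup>2 / (4 * (exp R)\<^sup>2))\<^sup>2"
  have k: "0 < k" unfolding k_def by simp
  show ?thesis
  proof (intro exI[of _ "k * e"] conjI allI impI)
    show "0 < k * e" using k e by simp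
    fix a1 a2 a3 b1 b2 b3 :: real
    assume box: "\<bar>a1\<bar> \<le> R" "\<bar>a2\<bar> \<le> R" "\<bar>a3\<bar> \<le> R" "\<bar>b1\<bar> \<le> R" "\<bar>b2\<bar> \<le> R" "\<bar>b3\<bar> \<le> R"
    define x1 x2 x3 where "x1 = a1 - b1" and "x2 = a2 - b2" and "x3 = a3 - b3"
    define r1 r2 r3 where "r1 s = exp (b1 + s * x1)" and "r2 s = exp (b2 + s * x2)"
      and "r3 s = exp (b3 + s * x3)" for s
    \<comment> \<open>The angles along the segment, paired with the fixed increment. By the symmetry
      of the weights the derivative is minus a weighted sum of squared differences, and the mean
      value theorem turns it into monotonicity.\<close>
    define g where "g s = tri_angle I1 I2 I3 (r1 s) (r2 s) (r3 s) * x1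
      + tri_angle I2 I3 I1 (r2 s) (r3 s) (r1 s) * x2 + tri_angle I3 I1 I2 (r3 s) (r1 s) (r2 s) * x3" for s
    define c12 c23 c31 where "c12 s = tri_cond I1 I2 I3 (r1 s) (r2 s) (r3 s)"
      and "c23 s = tri_cond I2 I3 I1 (r2 s) (r3 s) (r1 s)"
      and "c31 s = tri_cond I3 I1 I2 (r3 s) (r1 s) (r2 s)" for s
    have dg: "(g has_real_derivative
        - (c12 s * (x1 - x2)\<^sup>2 + c23 s * (x2 - x3)\<^sup>2 + c31 s * (x3 - x1)\<^sup>2)) (at s)" for s
    proof -
      have "(g has_real_derivative
        (tri_cond I1 I2 I3 (r1 s) (r2 s) (r3 s) * (x2 - x1) + tri_cond I1 I3 I2 (r1 s) (r3 s) (r2 s) * (x3 - x1)) * x1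
        + (tri_cond I2 I3 I1 (r2 s) (r3 s) (r1 s) * (x3 - x2) + tri_cond I2 I1 I3 (r2 s) (r1 s) (r3 s) * (x1 - x2)) * x2
        + (tri_cond I3 I1 I2 (r3 s) (r1 s) (r2 s) * (x1 - x3) + tri_cond I3 I2 I1 (r3 s) (r2 s) (r1 s) * (x2 - x3)) * x3) (at s)"
        unfolding g_def r1_def r2_def r3_def
        by (intro DERIV_add DERIV_cmult_right tri_angle_deriv R2.tri_angle_deriv R3.tri_angle_deriv)
      then show ?thesis
        unfolding tri_cond_swap[of I2 I1] tri_cond_swap[of I3 I2] tri_cond_swap[of I1 I3]
          c12_def[symmetric] c23_def[symmetric] c31_def[symmetric]
        by (rule DERIV_cong) (simp add: power2_eq_square algebra_simps)
    qed
    obtain z where z: "0 < z" "z < 1"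
      "g 1 - g 0 = (1 - 0) * (- (c12 z * (x1 - x2)\<^sup>2 + c23 z * (x2 - x3)\<^sup>2 + c31 z * (x3 - x1)\<^sup>2))"
      using MVT2[OF zero_less_one, of g "\<lambda>s. - (c12 s * (x1 - x2)\<^sup>2 + c23 s * (x2 - x3)\<^sup>2 + c31 s * (x3 - x1)\<^sup>2)"]
        dg by auto
    have bd: "\<bar>b + z * (a - b)\<bar> \<le> R" if "\<bar>a\<bar> \<le> R" "\<bar>b\<bar> \<le> R" for a b
    proof -
      have "b + z * (a - b) = (1 - z) * b + z * a" by (simp add: algebra_simps)
      also have "\<bar>\<dots>\<bar> \<le> (1 - z) * \<bar>b\<bar> + z * \<bar>a\<bar>"
        using z abs_triangle_ineq[of "(1 - z) * b" "z * a"] by (simp add: abs_mult)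
      also have "\<dots> \<le> (1 - z) * R + z * R"
        using z that by (intro add_mono mult_left_mono) auto
      finally show ?thesis by (simp add: algebra_simps)
    qed
    have r: "exp (- R) \<le> r1 z" "exp (- R) \<le> r2 z" "exp (- R) \<le> r3 z"
       "r1 z \<le> exp R" "r2 z \<le> exp R" "r3 z \<le> exp R"
      using bd[OF box(1,4)] bd[OF box(2,5)] bd[OF box(3,6)]
      unfolding r1_def r2_def r3_def x1_def x2_def x3_def by (auto simp: abs_le_iff)
    have c: "k * ((1 + I3) * (1 + I1 + I2 - I3)) \<le> c12 z" "k * ((1 + I1) * (1 + I2 + I3 - I1)) \<le> c23 z"
        "k * ((1 + I2) * (1 + I3 + I1 - I2)) \<le> c31 z"
      unfolding k_def c12_def c23_def c31_def
      by (rule tri_cond_lower R2.tri_cond_lower R3.tri_cond_lower; use r in simp)+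
    have "k * e * ((x1 - x2)\<^sup>2 + (x2 - x3)\<^sup>2 + (x3 - x1)\<^sup>2)
      = k * (e * ((x1 - x2)\<^sup>2 + (x2 - x3)\<^sup>2 + (x3 - x1)\<^sup>2))" by simp
    also have "\<dots> \<le> k * ((1 + I3) * (1 + I1 + I2 - I3) * (x1 - x2)\<^sup>2
       + (1 + I1) * (1 + I2 + I3 - I1) * (x2 - x3)\<^sup>2 + (1 + I2) * (1 + I3 + I1 - I2) * (x3 - x1)\<^sup>2)"
      using e(2) k by (intro mult_left_mono) auto
    also have "\<dots> = k * ((1 + I3) * (1 + I1 + I2 - I3)) * (x1 - x2)\<^sup>2
       + k * ((1 + I1) * (1 + I2 + I3 - I1)) * (x2 - x3)\<^sup>2 + k * ((1 + I2) * (1 + I3 + I1 - I2)) * (x3 - x1)\<^sup>2"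
      by (simp add: distrib_left mult.assoc)
    also have "\<dots> \<le> c12 z * (x1 - x2)\<^sup>2 + c23 z * (x2 - x3)\<^sup>2 + c31 z * (x3 - x1)\<^sup>2"
      using c by (intro add_mono mult_right_mono) auto
    finally have "g 1 - g 0 \<le> - (k * e) * ((x1 - x2)\<^sup>2 + (x2 - x3)\<^sup>2 + (x3 - x1)\<^sup>2)"
      unfolding z by simp
    moreover have "g 1 - g 0 =
       (tri_angle I1 I2 I3 (exp a1) (exp a2) (exp a3) - tri_angle I1 I2 I3 (exp b1) (exp b2) (exp b3)) * x1
     + (tri_angle I2 I3 I1 (exp a2) (exp a3) (exp a1) - tri_angle I2 I3 I1 (exp b2) (exp b3) (exp b1)) * x2
     + (tri_angle I3 I1 I2 (exp a3) (exp a1) (exp a2) - tri_angle I3 I1 I2 (exp b3) (exp b1) (exp b2)) * x3"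
      unfolding g_def r1_def r2_def r3_def by (simp add: x1_def x2_def x3_def algebra_simps)
    ultimately show "(tri_angle I1 I2 I3 (exp a1) (exp a2) (exp a3) - tri_angle I1 I2 I3 (exp b1) (exp b2) (exp b3)) * (a1 - b1)
   + (tri_angle I2 I3 I1 (exp a2) (exp a3) (exp a1) - tri_angle I2 I3 I1 (exp b2) (exp b3) (exp b1)) * (a2 - b2)
   + (tri_angle I3 I1 I2 (exp a3) (exp a1) (exp a2) - tri_angle I3 I1 I2 (exp b3) (exp b1) (exp b2)) * (a3 - b3)
   \<le> - (k * e) * (((a1 - b1) - (a2 - b2))\<^sup>2 + ((a2 - b2) - (a3 - b3))\<^sup>2 + ((a3 - b3) - (a1 - b1))\<^sup>2)"
      unfolding x1_def x2_def x3_def by linarith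
  qed
qed

section \<open>Limits of the angles for very small and very large circles\<close>

lemma tri_angle_in_arccos_range:
  "tri_dot I1 I2 I3 (exp a1) (exp a2) (exp a3) /
     (sqrt (tri_len2 I2 (exp a3) (exp a1)) * sqrt (tri_len2 I3 (exp a1) (exp a2))) \<in> {-1..1}"
  using tri_dot_bounds[of "exp a1" "exp a2" "exp a3"] by auto

text \<open>Here \<open>x = r1 / r2\<close> and \<open>y = r1 / r3\<close>. In these ratios the
  cosine extends continuously to \<open>x = y = 0\<close>, and the ratio of \<open>r2\<close> to
  \<open>r3\<close>, over which there is no control, has disappeared.\<close>

lemma small_circle_cos:
  fixes a1 a2 a3 :: real
  defines "x \<equiv> exp (- (a2 - a1))" and "y \<equiv> exp (- (a3 - a1))"
  shows "tri_dot I1 I2 I3 (exp a1) (exp a2) (exp a3) /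
     (sqrt (tri_len2 I2 (exp a3) (exp a1)) * sqrt (tri_len2 I3 (exp a1) (exp a2)))
   = (x * y + y * I3 + x * I2 - I1) / (sqrt (tri_len2 I2 1 y) * sqrt (tri_len2 I3 x 1))"
proof -
  define r2 r3 where "r2 = exp a2" and "r3 = exp a3"
  have r: "0 < r2" "0 < r3" by (auto simp: r2_def r3_def)
  have e: "exp a1 = r2 * x" "exp a1 = r3 * y" "exp a2 = r2" "exp a3 = r3"
    unfolding x_def y_def r2_def r3_def by (simp_all flip: exp_add)
  have xy: "r2 * x = r3 * y" using e by simp
  have "tri_dot I1 I2 I3 (exp a1) r2 r3 = (r2 * r3) * (x * y + y * I3 + x * I2 - I1)"
    unfolding tri_dot_def using e(1,2) by algebra
  moreover have "sqrt (tri_len2 I2 r3 (exp a1)) = r3 * sqrt (tri_len2 I2 1 y)"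
  proof -
    have "tri_len2 I2 r3 (exp a1) = r3\<^sup>2 * tri_len2 I2 1 y"
      unfolding e(2) tri_len2_def by (simp add: algebra_simps power2_eq_square)
    then show ?thesis using r by (simp add: real_sqrt_mult)
  qed
  moreover have "sqrt (tri_len2 I3 (exp a1) r2) = r2 * sqrt (tri_len2 I3 x 1)"
  proof -
    have "tri_len2 I3 (exp a1) r2 = r2\<^sup>2 * tri_len2 I3 x 1"
      unfolding e(1) tri_len2_def by (simp add: algebra_simps power2_eq_square)
    then show ?thesis using r by (simp add: real_sqrt_mult)
  qed
  moreover have "(r2 * r3) * (x * y + y * I3 + x * I2 - I1) / (r3 * sqrt (tri_len2 I2 1 y) * (r2 * sqrt (tri_len2 I3 x 1)))
     = ((r2 * r3) * (x * y + y * I3 + x * I2 - I1)) / ((r2 * r3) * (sqrt (tri_len2 I2 1 y) * sqrt (tri_len2 I3 x 1)))"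
    by (simp add: ac_simps)
  ultimately show ?thesis
    unfolding e(3,4) using r by (simp only: mult_divide_mult_cancel_left) simp
qed

lemma large_circle_cos:
  fixes a1 a2 a3 :: real
  defines "x \<equiv> exp (- (a1 - a2))" and "y \<equiv> exp (- (a1 - a3))"
  shows "tri_dot I1 I2 I3 (exp a1) (exp a2) (exp a3) /
     (sqrt (tri_len2 I2 (exp a3) (exp a1)) * sqrt (tri_len2 I3 (exp a1) (exp a2)))
   = (1 + x * I3 + y * I2 - x * y * I1) / (sqrt (tri_len2 I2 y 1) * sqrt (tri_len2 I3 1 x))"
proof -
  define r1 where "r1 = exp a1"
  have r: "0 < r1" by (auto simp: r1_def)
  have e: "exp a1 = r1" "exp a2 = r1 * x" "exp a3 = r1 * y"
    unfolding x_def y_def r1_def by (simp_all flip: exp_add)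
  have "tri_dot I1 I2 I3 r1 (r1 * x) (r1 * y) = r1\<^sup>2 * (1 + x * I3 + y * I2 - x * y * I1)"
    unfolding tri_dot_def power2_eq_square by (simp add: algebra_simps)
  moreover have "sqrt (tri_len2 I2 (r1 * y) r1) = r1 * sqrt (tri_len2 I2 y 1)"
  proof -
    have "tri_len2 I2 (r1 * y) r1 = r1\<^sup>2 * tri_len2 I2 y 1"
      unfolding tri_len2_def by (simp add: algebra_simps power2_eq_square)
    then show ?thesis using r by (simp add: real_sqrt_mult)
  qed
  moreover have "sqrt (tri_len2 I3 r1 (r1 * x)) = r1 * sqrt (tri_len2 I3 1 x)"
  proof -
    have "tri_len2 I3 r1 (r1 * x) = r1\<^sup>2 * tri_len2 I3 1 x"
      unfolding tri_len2_def by (simp add: algebra_simps power2_eq_square)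
    then show ?thesis using r by (simp add: real_sqrt_mult)
  qed
  moreover have "r1\<^sup>2 * (1 + x * I3 + y * I2 - x * y * I1) / (r1 * sqrt (tri_len2 I2 y 1) * (r1 * sqrt (tri_len2 I3 1 x)))
     = (r1\<^sup>2 * (1 + x * I3 + y * I2 - x * y * I1)) / (r1\<^sup>2 * (sqrt (tri_len2 I2 y 1) * sqrt (tri_len2 I3 1 x)))"
    by (simp add: ac_simps power2_eq_square)
  ultimately show ?thesis
    unfolding e using r by (simp only: mult_divide_mult_cancel_left) simp
qed

lemma tendsto_exp_minus_fst: "((\<lambda>p::real \<times> real. exp (- fst p)) \<longlongrightarrow> 0) (at_top \<times>\<^sub>F at_top)"
  and tendsto_exp_minus_snd: "((\<lambda>p::real \<times> real. exp (- snd p)) \<longlongrightarrow> 0) (at_top \<times>\<^sub>F at_top)"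
proof -
  have "((\<lambda>x::real. exp (- x)) \<longlongrightarrow> 0) at_top"
    by (rule filterlim_compose[OF exp_at_bot filterlim_uminus_at_bot_at_top])
  then show "((\<lambda>p::real \<times> real. exp (- fst p)) \<longlongrightarrow> 0) (at_top \<times>\<^sub>F at_top)"
    and "((\<lambda>p::real \<times> real. exp (- snd p)) \<longlongrightarrow> 0) (at_top \<times>\<^sub>F at_top)"
    by (auto intro: filterlim_compose filterlim_fst filterlim_snd)
qed

text \<open>The product filter lets both gaps grow independently and still yields one threshold. The
  limit may be an endpoint of \<open>{-1..1}\<close>, so continuity of \<open>arccos\<close> on the
  closed interval is used, and all values have to lie in it.\<close>

lemma arccos_limit:
  fixes f :: "real \<Rightarrow> real \<Rightarrow> real"
  assumes lim: "((\<lambda>p. f (fst p) (snd p)) \<longlongrightarrow> l) (at_top \<times>\<^sub>F at_top)"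
    and range: "\<And>g h. f g h \<in> {-1..1}" and "0 < \<epsilon>"
  shows "\<exists>G. \<forall>g\<ge>G. \<forall>h\<ge>G. \<bar>arccos (f g h) - arccos l\<bar> < \<epsilon>"
proof -
  have nontriv: "(at_top :: real filter) \<times>\<^sub>F (at_top :: real filter) \<noteq> bot"
    by (simp add: prod_filter_eq_bot)
  have "l \<in> {-1..1}"
    by (rule Lim_in_closed_set[OF _ _ nontriv lim]) (use range in auto)
  then have "((\<lambda>p. arccos (f (fst p) (snd p))) \<longlongrightarrow> arccos l) (at_top \<times>\<^sub>F at_top)"
    by (intro continuous_on_tendsto_compose[OF continuous_on_arccos' lim] always_eventually allI range)
  then have "\<forall>\<^sub>F p in at_top \<times>\<^sub>F at_top. dist (arccos (f (fst p) (snd p))) (arccos l) < \<epsilon>"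
    using \<open>0 < \<epsilon>\<close> by (rule tendstoD)
  then obtain Q where Q: "eventually Q at_top"
      "\<And>g h. Q g \<Longrightarrow> Q h \<Longrightarrow> dist (arccos (f g h)) (arccos l) < \<epsilon>"
    unfolding eventually_prod_same by auto
  then obtain G where "\<And>g. g \<ge> G \<Longrightarrow> Q g"
    by (auto simp: eventually_at_top_linorder)
  then show ?thesis
    using Q(2) unfolding dist_real_def by blast
qed

text \<open>In the limit the center of circle 1 becomes a common point of circles 2 and 3; their
  radii meet there at an angle with cosine \<open>- I1\<close>.\<close>

lemma tri_angle_small_circle:
  assumes "0 < \<epsilon>"
  shows "\<exists>G. \<forall>a1 a2 a3. a2 - a1 \<ge> G \<longrightarrow> a3 - a1 \<ge> G \<longrightarrow>
    \<bar>tri_angle I1 I2 I3 (exp a1) (exp a2) (exp a3) - arccos (- I1)\<bar> < \<epsilon>"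
proof -
  define f where "f g h = (exp (- g) * exp (- h) + exp (- h) * I3 + exp (- g) * I2 - I1)
     / (sqrt (tri_len2 I2 1 (exp (- h))) * sqrt (tri_len2 I3 (exp (- g)) 1))" for g h
  have f: "f (a2 - a1) (a3 - a1) = tri_dot I1 I2 I3 (exp a1) (exp a2) (exp a3) /
     (sqrt (tri_len2 I2 (exp a3) (exp a1)) * sqrt (tri_len2 I3 (exp a1) (exp a2)))" for a1 a2 a3
    unfolding f_def small_circle_cos ..
  have "((\<lambda>p. f (fst p) (snd p)) \<longlongrightarrow> (0 * 0 + 0 * I3 + 0 * I2 - I1)
     / (sqrt (1\<^sup>2 + 0\<^sup>2 + 2 * 1 * 0 * I2) * sqrt (0\<^sup>2 + 1\<^sup>2 + 2 * 0 * 1 * I3))) (at_top \<times>\<^sub>F at_top)"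
    unfolding f_def tri_len2_def
    by (intro tendsto_intros tendsto_exp_minus_fst tendsto_exp_minus_snd) simp
  then have lim: "((\<lambda>p. f (fst p) (snd p)) \<longlongrightarrow> - I1) (at_top \<times>\<^sub>F at_top)" by simp
  have "f g h \<in> {-1..1}" for g h
    using tri_angle_in_arccos_range[of 0 g h] f[of g 0 h] by simp
  from arccos_limit[OF lim this assms] show ?thesis
    unfolding tri_angle_def f[symmetric] by blast
qed

lemma tri_angle_large_circle:
  assumes "0 < \<epsilon>"
  shows "\<exists>G. \<forall>a1 a2 a3. a1 - a2 \<ge> G \<longrightarrow> a1 - a3 \<ge> G \<longrightarrow>
    tri_angle I1 I2 I3 (exp a1) (exp a2) (exp a3) < \<epsilon>"
proof -
  define f where "f g h = (1 + exp (- g) * I3 + exp (- h) * I2 - exp (- g) * exp (- h) * I1)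
     / (sqrt (tri_len2 I2 (exp (- h)) 1) * sqrt (tri_len2 I3 1 (exp (- g))))" for g h
  have f: "f (a1 - a2) (a1 - a3) = tri_dot I1 I2 I3 (exp a1) (exp a2) (exp a3) /
     (sqrt (tri_len2 I2 (exp a3) (exp a1)) * sqrt (tri_len2 I3 (exp a1) (exp a2)))" for a1 a2 a3
    unfolding f_def large_circle_cos ..
  have "((\<lambda>p. f (fst p) (snd p)) \<longlongrightarrow> (1 + 0 * I3 + 0 * I2 - 0 * 0 * I1)
     / (sqrt (0\<^sup>2 + 1\<^sup>2 + 2 * 0 * 1 * I2) * sqrt (1\<^sup>2 + 0\<^sup>2 + 2 * 1 * 0 * I3))) (at_top \<times>\<^sub>F at_top)"
    unfolding f_def tri_len2_def
    by (intro tendsto_intros tendsto_exp_minus_fst tendsto_exp_minus_snd) simp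
  then have lim: "((\<lambda>p. f (fst p) (snd p)) \<longlongrightarrow> 1) (at_top \<times>\<^sub>F at_top)" by simp
  have "f g h \<in> {-1..1}" for g h
    using tri_angle_in_arccos_range[of 0 "- g" "- h"] f[of 0 "- g" "- h"] by simp
  from arccos_limit[OF lim this assms] show ?thesis
    unfolding tri_angle_def f[symmetric] by (auto simp: abs_less_iff)
qed

text \<open>The two weights at a vertex cannot both vanish, so changing one radius alone moves its
  angle at a nonzero rate.\<close>

lemma tri_cond_sum_pos:
  assumes "0 < r1" "0 < r2" "0 < r3"
  shows "0 < tri_cond I1 I2 I3 r1 r2 r3 + tri_cond I1 I3 I2 r1 r3 r2"
proof -
  interpret S: circle_triple I1 I3 I2 by (rule swap)
  define m M where "m = min r1 (min r2 r3)" and "M = max r1 (max r2 r3)"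
  define k where "k = (m\<^sup>2 / (4 * M\<^sup>2))\<^sup>2"
  have m: "0 < m" "m \<le> r1" "m \<le> r2" "m \<le> r3" "r1 \<le> M" "r2 \<le> M" "r3 \<le> M" "0 < M"
    unfolding m_def M_def using assms by auto
  have k: "0 < k" unfolding k_def using m by simp
  have "k * ((1 + I3) * (1 + I1 + I2 - I3)) \<le> tri_cond I1 I2 I3 r1 r2 r3"
    "k * ((1 + I2) * (1 + I1 + I3 - I2)) \<le> tri_cond I1 I3 I2 r1 r3 r2"
    unfolding k_def using m by (auto intro!: tri_cond_lower S.tri_cond_lower)
  moreover have "0 < (1 + I3) * (1 + I1 + I2 - I3) + (1 + I2) * (1 + I1 + I3 - I2)"
  proof -
    have "0 \<le> 1 + I1 + I2 - I3" "0 \<le> 1 + I1 + I3 - I2"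
      using cond_const_nonneg S.cond_const_nonneg I_gt by (auto simp: zero_le_mult_iff)
    then have "0 < 1 + I1 + I2 - I3 \<or> 0 < 1 + I1 + I3 - I2" using I_gt by linarith
    then show ?thesis
      using cond_const_nonneg S.cond_const_nonneg I_gt
      by (auto intro: add_pos_nonneg add_nonneg_pos)
  qed
  then have "0 < k * ((1 + I3) * (1 + I1 + I2 - I3) + (1 + I2) * (1 + I1 + I3 - I2))"
    using k by simp
  ultimately show ?thesis by (simp add: distrib_left)
qed

text \<open>Shrinking circle 1 alone increases its angle strictly towards
  \<open>arccos (- I1)\<close>. The limit gives only a weak inequality for \<open>g 1\<close>; the
  step from \<open>g 0\<close> to \<open>g 1\<close> makes it strict.\<close>

lemma tri_angle_less_arccos:
  "tri_angle I1 I2 I3 (exp a1) (exp a2) (exp a3) < arccos (- I1)"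
proof -
  define g where "g s = tri_angle I1 I2 I3 (exp (a1 + s * (-1))) (exp (a2 + s * 0)) (exp (a3 + s * 0))" for s
  have dg: "\<exists>y. (g has_real_derivative y) (at s) \<and> y > 0" for s
  proof (intro exI conjI)
    show "(g has_real_derivative tri_cond I1 I2 I3 (exp (a1 + s * (-1))) (exp (a2 + s * 0)) (exp (a3 + s * 0)) * (0 - (-1))
        + tri_cond I1 I3 I2 (exp (a1 + s * (-1))) (exp (a3 + s * 0)) (exp (a2 + s * 0)) * (0 - (-1))) (at s)"
      unfolding g_def by (rule tri_angle_deriv)
    show "0 < tri_cond I1 I2 I3 (exp (a1 + s * (-1))) (exp (a2 + s * 0)) (exp (a3 + s * 0)) * (0 - (-1))
        + tri_cond I1 I3 I2 (exp (a1 + s * (-1))) (exp (a3 + s * 0)) (exp (a2 + s * 0)) * (0 - (-1))"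
      using tri_cond_sum_pos[of "exp (a1 + s * (-1))" "exp (a2 + s * 0)" "exp (a3 + s * 0)"] by simp
  qed
  have mono: "g s < g t" if "s < t" for s t
    by (rule DERIV_pos_imp_increasing[OF that]) (use dg in blast)
  have "g 1 \<le> arccos (- I1)"
  proof (rule field_le_epsilon)
    fix \<epsilon> :: real assume "0 < \<epsilon>"
    then obtain G where G: "\<And>a1 a2 a3. a2 - a1 \<ge> G \<Longrightarrow> a3 - a1 \<ge> G \<Longrightarrow>
        \<bar>tri_angle I1 I2 I3 (exp a1) (exp a2) (exp a3) - arccos (- I1)\<bar> < \<epsilon>"
      using tri_angle_small_circle by metis
    define s where "s = max 2 (max (G + a1 - a2) (G + a1 - a3))"
    have "\<bar>g s - arccos (- I1)\<bar> < \<epsilon>"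
      unfolding g_def by (rule G) (auto simp: s_def)
    moreover have "g 1 < g s" by (rule mono) (simp add: s_def)
    ultimately show "g 1 \<le> arccos (- I1) + \<epsilon>" by linarith
  qed
  moreover have "g 0 < g 1" by (rule mono) simp
  ultimately show ?thesis unfolding g_def by simp
qed

end

section \<open>Combinatorics of the triangulation\<close>

lemma nxt_prv_simps [simp]:
  "nxt 0 = 1" "nxt 1 = 2" "nxt (Suc 0) = 2" "nxt 2 = 0" "prv 0 = 2" "prv 1 = 0" "prv (Suc 0) = 0" "prv 2 = 1"
  by (simp_all add: nxt_def prv_def)

lemma nxt_prv: "i \<in> {0, 1, 2} \<Longrightarrow> nxt (prv i) = i" and prv_nxt: "i \<in> {0, 1, 2} \<Longrightarrow> prv (nxt i) = i"
  by auto

lemma nxt_in_corners: "(f, i) \<in> corners F \<Longrightarrow> (f, nxt i) \<in> corners F"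
  and prv_in_corners: "(f, i) \<in> corners F \<Longrightarrow> (f, prv i) \<in> corners F"
  by (auto simp: corners_def)

lemma sum_corners:
  fixes g :: "'f \<times> nat \<Rightarrow> real"
  shows "sum g (corners F) = (\<Sum>f\<in>F. g (f, 0) + g (f, 1) + g (f, 2))"
  unfolding corners_def sum.cartesian_product' by (simp add: add.assoc)

text \<open>A zigzag ending at a terminal point straightens to a forward path: in front of a step
  taken against \<open>R\<close>, the forward path already found must begin by undoing that step,
  because successors are unique.\<close>

lemma single_valued_rtrancl_to_terminal:
  assumes sv: "single_valued R" and terminal: "x \<notin> Domain R" and y: "(y, x) \<in> (R \<union> R\<inverse>)\<^sup>*"
  shows "(y, x) \<in> R\<^sup>*"
  using y
proof (induction rule: converse_rtrancl_induct)
  case (step y z)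
  from step(1) consider "(y, z) \<in> R" | "(z, y) \<in> R" by auto
  then show ?case
  proof cases
    case 1
    then show ?thesis using step(3) by auto
  next
    case 2
    then have "z \<noteq> x" using terminal by auto
    with step(3) obtain w where "(z, w) \<in> R" "(w, x) \<in> R\<^sup>*"
      by (auto elim: converse_rtranclE)
    then show ?thesis using sv 2 by (metis single_valuedD)
  qed
qed auto

text \<open>Corners are counted and not vertices, since several corners of one triangle may lie at
  the same vertex.\<close>

definition two_in :: "('f \<times> nat \<Rightarrow> 'v) \<Rightarrow> 'v set \<Rightarrow> 'f \<Rightarrow> bool" where
  "two_in cv A f \<longleftrightarrow> cv (f, 0) \<in> A \<and> cv (f, 1) \<in> A \<or> cv (f, 1) \<in> A \<and> cv (f, 2) \<in> A \<or> cv (f, 2) \<in> A \<and> cv (f, 0) \<in> A"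

definition flat_angle :: "'f set \<Rightarrow> ('f \<times> nat \<Rightarrow> 'v) \<Rightarrow> ('f \<times> nat \<Rightarrow> 'e) \<Rightarrow> 'v \<Rightarrow> real" where
  "flat_angle F cv se v = (if v \<in> bdry_verts F cv se then pi else 2 * pi)"

locale triangulated_surface =
  fixes F :: "'f set" and cv :: "'f \<times> nat \<Rightarrow> 'v" and se :: "'f \<times> nat \<Rightarrow> 'e"
  assumes triangulation: "triangulation F cv se"
begin

abbreviation "V \<equiv> verts F cv"
abbreviation "E \<equiv> edges F se"
abbreviation "Vb \<equiv> bdry_verts F cv se"
abbreviation "Eb \<equiv> bdry_edges F se"
abbreviation "mates \<equiv> side_mates F se"

lemma finite_F [simp]: "finite F" and F_ne: "F \<noteq> {}"
  and card_mates: "s \<in> corners F \<Longrightarrow> card (mates s) \<in> {1, 2}"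
  and cv_eq_iff: "c \<in> corners F \<Longrightarrow> c' \<in> corners F \<Longrightarrow> cv c = cv c' \<longleftrightarrow> (c, c') \<in> (glue_rel F se)\<^sup>*"
  and faces_connected: "f \<in> F \<Longrightarrow> f' \<in> F \<Longrightarrow> (f, f') \<in> (face_adj F se)\<^sup>*"
  using triangulation unfolding triangulation_def by blast+

lemma finite_corners [simp]: "finite (corners F)"
  by (simp add: corners_def)

lemma finite_V [simp]: "finite V" and finite_E [simp]: "finite E"
  by (simp_all add: verts_def edges_def)

lemma V_ne: "V \<noteq> {}"
  using F_ne by (auto simp: verts_def corners_def)

lemma cv_in_V: "c \<in> corners F \<Longrightarrow> cv c \<in> V"
  by (simp add: verts_def)

lemma Vb_subset: "Vb \<subseteq> V"
  by (auto simp: bdry_verts_def)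

lemma Eb_subset: "Eb \<subseteq> E"
  by (auto simp: bdry_edges_def edges_def)

lemma in_mates: "s \<in> corners F \<Longrightarrow> s \<in> mates s"
  by (simp add: side_mates_def)

lemma glued_ends:
  assumes "(f, i) \<in> corners F" "(f', j) \<in> corners F" "(f, i) \<noteq> (f', j)" "se (f, i) = se (f', j)"
  shows "cv (f, nxt i) = cv (f', prv j)" "cv (f, prv i) = cv (f', nxt j)"
proof -
  have "((f, nxt i), (f', prv j)) \<in> glue_rel F se" "((f, prv i), (f', nxt j)) \<in> glue_rel F se"
    unfolding glue_rel_def using assms by blast+
  then show "cv (f, nxt i) = cv (f', prv j)" "cv (f, prv i) = cv (f', nxt j)"
    using assms by (auto simp: cv_eq_iff nxt_in_corners prv_in_corners)
qed

lemma edge_meets_iff: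
  assumes "(f, i) \<in> corners F"
  shows "edge_meets F cv se A (se (f, i)) \<longleftrightarrow> cv (f, nxt i) \<in> A \<or> cv (f, prv i) \<in> A"
proof
  assume "edge_meets F cv se A (se (f, i))"
  then obtain f' j where "(f', j) \<in> corners F" "se (f', j) = se (f, i)"
      "cv (f', nxt j) \<in> A \<or> cv (f', prv j) \<in> A"
    unfolding edge_meets_def by blast
  then show "cv (f, nxt i) \<in> A \<or> cv (f, prv i) \<in> A"
    using glued_ends[of f i f' j] assms by (cases "(f, i) = (f', j)") auto
qed (use assms in \<open>auto simp: edge_meets_def\<close>)

lemma bdry_edge_iff: "s \<in> corners F \<Longrightarrow> se s \<in> Eb \<longleftrightarrow> card (mates s) = 1"
proof -
  have "mates s = mates s'" if "se s = se s'" for s s'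
    using that by (auto simp: side_mates_def)
  then show "s \<in> corners F \<Longrightarrow> se s \<in> Eb \<longleftrightarrow> card (mates s) = 1"
    unfolding bdry_edges_def by (smt (verit) mem_Collect_eq)
qed

lemma bdry_edge_unique_side:
  assumes "s \<in> corners F" "s' \<in> corners F" "se s \<in> Eb" "se s' = se s"
  shows "s' = s"
proof -
  obtain x where "mates s = {x}"
    using assms bdry_edge_iff by (metis card_1_singletonE)
  moreover have "s \<in> mates s" "s' \<in> mates s" using assms by (auto simp: side_mates_def)
  ultimately show ?thesis by auto
qed

lemma unique_mate:
  assumes "s \<in> corners F" "s1 \<in> mates s" "s2 \<in> mates s" "s1 \<noteq> s" "s2 \<noteq> s"
  shows "s1 = s2"
proof (rule ccontr)
  assume "s1 \<noteq> s2"
  then have "card {s, s1, s2} = 3" using assms by auto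
  moreover have "card {s, s1, s2} \<le> card (mates s)"
    using assms in_mates by (intro card_mono) (auto simp: side_mates_def)
  ultimately show False using card_mates[OF assms(1)] by auto
qed

text \<open>The corners around a vertex are linked by \<open>turn\<close> in a fixed rotational direction; a vertex
  carries exactly one corner without successor if it lies on the boundary and none otherwise.\<close>

definition turn :: "(('f \<times> nat) \<times> ('f \<times> nat)) set" where
  "turn = {((f, nxt i), (f', prv j)) | f i f' j. (f, i) \<in> corners F \<and> (f', j) \<in> corners F \<and>
          (f, i) \<noteq> (f', j) \<and> se (f, i) = se (f', j)}"

lemma turnI:
  "(f, i) \<in> corners F \<Longrightarrow> (f', j) \<in> corners F \<Longrightarrow> (f, i) \<noteq> (f', j) \<Longrightarrow> se (f, i) = se (f', j)
    \<Longrightarrow> ((f, nxt i), (f', prv j)) \<in> turn"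
  unfolding turn_def by blast

lemma turnE:
  assumes "(c, c') \<in> turn"
  obtains f i f' j where "c = (f, nxt i)" "c' = (f', prv j)" "(f, i) \<in> corners F" "(f', j) \<in> corners F"
    "(f, i) \<noteq> (f', j)" "se (f, i) = se (f', j)"
  using assms unfolding turn_def by blast

lemma glue_rel_turn: "glue_rel F se = turn \<union> turn\<inverse>"
proof -
  have "{((f, prv i), (f', nxt j)) | f i f' j. (f, i) \<in> corners F \<and> (f', j) \<in> corners F \<and>
          (f, i) \<noteq> (f', j) \<and> se (f, i) = se (f', j)} = turn\<inverse>"
    unfolding turn_def by (auto simp: converse_unfold) metis+
  then show ?thesis unfolding glue_rel_def turn_def by simp
qed

lemma corner_index: "(f, i) \<in> corners F \<Longrightarrow> i \<in> {0, 1, 2}"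
  by (simp add: corners_def)

lemma single_valued_turn: "single_valued turn"
proof (rule single_valuedI)
  fix c c1 c2 assume "(c, c1) \<in> turn" "(c, c2) \<in> turn"
  obtain f i f1 j1 where 1: "c = (f, nxt i)" "c1 = (f1, prv j1)" "(f, i) \<in> corners F" "(f1, j1) \<in> corners F"
    "(f, i) \<noteq> (f1, j1)" "se (f, i) = se (f1, j1)"
    using \<open>(c, c1) \<in> turn\<close> by (rule turnE)
  obtain g k f2 j2 where 2: "c = (g, nxt k)" "c2 = (f2, prv j2)" "(g, k) \<in> corners F" "(f2, j2) \<in> corners F"
    "(g, k) \<noteq> (f2, j2)" "se (g, k) = se (f2, j2)"
    using \<open>(c, c2) \<in> turn\<close> by (rule turnE)
  have "prv (nxt i) = prv (nxt k)" "g = f" using 1(1) 2(1) by auto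
  then have "k = i" "g = f" using prv_nxt corner_index[OF 1(3)] corner_index[OF 2(3)] by metis+
  then have "(f1, j1) = (f2, j2)"
    using 1 2 by (intro unique_mate[of "(f, i)"]) (auto simp: side_mates_def)
  then show "c1 = c2" using 1 2 by simp
qed

lemma single_valued_turn_converse: "single_valued (turn\<inverse>)"
proof (rule single_valuedI)
  fix c c1 c2 assume "(c, c1) \<in> turn\<inverse>" "(c, c2) \<in> turn\<inverse>"
  then have t: "(c1, c) \<in> turn" "(c2, c) \<in> turn" by auto
  obtain f1 j1 f i where 1: "c1 = (f1, nxt j1)" "c = (f, prv i)" "(f1, j1) \<in> corners F" "(f, i) \<in> corners F"
    "(f1, j1) \<noteq> (f, i)" "se (f1, j1) = se (f, i)"
    using t(1) by (rule turnE)
  obtain f2 j2 g k where 2: "c2 = (f2, nxt j2)" "c = (g, prv k)" "(f2, j2) \<in> corners F" "(g, k) \<in> corners F"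
    "(f2, j2) \<noteq> (g, k)" "se (f2, j2) = se (g, k)"
    using t(2) by (rule turnE)
  have "nxt (prv i) = nxt (prv k)" "g = f" using 1 2 by auto
  then have "k = i" "g = f" using nxt_prv corner_index[OF 1(4)] corner_index[OF 2(4)] by metis+
  then have "(f1, j1) = (f2, j2)"
    using 1 2 by (intro unique_mate[of "(f, i)"]) (auto simp: side_mates_def)
  then show "c1 = c2" using 1 2 by simp
qed

lemma turn_cv:
  assumes "(c, c') \<in> turn"
  shows "c \<in> corners F" "c' \<in> corners F" "cv c = cv c'"
  using assms by (auto elim!: turnE simp: nxt_in_corners prv_in_corners intro: glued_ends)

lemma bdry_side_terminal:
  assumes "(f, i) \<in> corners F"
  shows "(f, nxt i) \<in> Domain turn \<longleftrightarrow> se (f, i) \<notin> Eb"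
proof
  assume "(f, nxt i) \<in> Domain turn"
  then obtain c where "((f, nxt i), c) \<in> turn" by auto
  then obtain g k f' j where *: "(f, nxt i) = (g, nxt k)" "(g, k) \<in> corners F" "(f', j) \<in> corners F"
      "(g, k) \<noteq> (f', j)" "se (g, k) = se (f', j)"
    by (rule turnE)
  have "prv (nxt i) = prv (nxt k)" "g = f" using *(1) by auto
  then have "k = i" "g = f" using prv_nxt corner_index[OF assms] corner_index[OF *(2)] by metis+
  then show "se (f, i) \<notin> Eb" using * bdry_edge_unique_side by metis
next
  assume "se (f, i) \<notin> Eb"
  then have "card (mates (f, i)) = 2" using card_mates[OF assms] bdry_edge_iff[OF assms] by auto
  then obtain x y where xy: "mates (f, i) = {x, y}" "x \<noteq> y" by (meson card_2_iff)
  define s where "s = (if x = (f, i) then y else x)"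
  have "s \<in> mates (f, i)" "s \<noteq> (f, i)" using xy by (auto simp: s_def)
  then have "((f, nxt i), (fst s, prv (snd s))) \<in> turn"
    using assms by (intro turnI) (auto simp: side_mates_def)
  then show "(f, nxt i) \<in> Domain turn" by auto
qed

lemma bdry_side_initial:
  assumes "(f, i) \<in> corners F" "se (f, i) \<in> Eb"
  shows "(f, prv i) \<notin> Range turn"
proof
  assume "(f, prv i) \<in> Range turn"
  then obtain c where "(c, (f, prv i)) \<in> turn" by auto
  then obtain f' j g k where *: "(f, prv i) = (g, prv k)" "(f', j) \<in> corners F" "(g, k) \<in> corners F"
      "(f', j) \<noteq> (g, k)" "se (f', j) = se (g, k)"
    by (rule turnE)
  have "nxt (prv i) = nxt (prv k)" "g = f" using *(1) by auto
  then have "k = i" "g = f" using nxt_prv corner_index[OF assms(1)] corner_index[OF *(3)] by metis+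
  then show False using * assms bdry_edge_unique_side by metis
qed

text \<open>Boundary sides are matched with boundary edges and, through the corner at their
  \<open>nxt\<close> end, with boundary vertices. That corner has no successor under
  \<open>turn\<close>, and a vertex carries at most one such corner, which gives injectivity. The
  equality says that the boundary has Euler characteristic zero.\<close>

lemma card_bdry: "card Vb = card Eb"
proof -
  define B where "B = {s \<in> corners F. se s \<in> Eb}"
  define h where "h s = cv (fst s, nxt (snd s))" for s
  have "bij_betw se B Eb"
    unfolding bij_betw_def
  proof
    show "inj_on se B"
      unfolding B_def by (auto intro!: inj_onI dest: bdry_edge_unique_side)
    show "se ` B = Eb"
      unfolding B_def bdry_edges_def by auto
  qed
  moreover have "bij_betw h B Vb"
    unfolding bij_betw_def
  proof
    show "inj_on h B"
    proof (rule inj_onI)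
      fix s s' assume s: "s \<in> B" and s': "s' \<in> B" and eq: "h s = h s'"
      define c c' where "c = (fst s, nxt (snd s))" and "c' = (fst s', nxt (snd s'))"
      have in_corners: "s \<in> corners F" "s' \<in> corners F" using s s' by (auto simp: B_def)
      then have cc: "c \<in> corners F" "c' \<in> corners F"
        unfolding c_def c'_def by (metis nxt_in_corners prod.collapse)+
      have t: "c \<notin> Domain turn" "c' \<notin> Domain turn"
        unfolding c_def c'_def using s s' bdry_side_terminal[of "fst s" "snd s"]
          bdry_side_terminal[of "fst s'" "snd s'"] by (auto simp: B_def)
      have "(c, c') \<in> (turn \<union> turn\<inverse>)\<^sup>*"
        using eq cv_eq_iff[OF cc] unfolding h_def c_def c'_def glue_rel_turn by simp
      then have "(c, c') \<in> turn\<^sup>*"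
        by (rule single_valued_rtrancl_to_terminal[OF single_valued_turn t(2)])
      then have "c = c'" using t(1) by (auto elim: converse_rtranclE)
      then have "fst s = fst s'" "prv (nxt (snd s)) = prv (nxt (snd s'))"
        unfolding c_def c'_def by auto
      then show "s = s'"
        using in_corners prv_nxt corner_index by (metis prod.collapse)
    qed
    show "h ` B = Vb"
    proof (intro equalityI subsetI)
      fix v assume "v \<in> h ` B"
      then obtain f i where fi: "(f, i) \<in> corners F" "se (f, i) \<in> Eb" "v = cv (f, nxt i)"
        by (auto simp: B_def h_def)
      then show "v \<in> Vb"
        unfolding bdry_verts_def using cv_in_V[OF nxt_in_corners[OF fi(1)]]
        by (auto intro!: bexI[of _ "se (f, i)"] simp: edge_meets_iff)
    next
      fix v assume "v \<in> Vb"
      then obtain e where e: "v \<in> V" "e \<in> Eb" "edge_meets F cv se {v} e" by (auto simp: bdry_verts_def)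
      then obtain s where s: "s \<in> corners F" "e = se s" by (auto simp: bdry_edges_def)
      obtain f i where fi: "s = (f, i)" by (cases s)
      note fi = s[unfolded fi] e(2)
      from e(3) fi have "cv (f, nxt i) = v \<or> cv (f, prv i) = v" by (simp add: edge_meets_iff)
      moreover have "v \<in> h ` B" if "cv (f, nxt i) = v"
        using fi that by (auto simp: h_def B_def intro!: image_eqI[of _ _ "(f, i)"])
      moreover have "v \<in> h ` B" if pv: "cv (f, prv i) = v"
      proof -
        define C where "C = {c \<in> corners F. cv c = v}"
        \<comment> \<open>Otherwise \<open>turn\<close> would induce an injective self-map of the
          finite set of corners at \<open>v\<close>, hence a surjective one, although the corner
          \<open>(f, prv i)\<close> has no predecessor.\<close>
        have "\<not> C \<subseteq> Domain turn"
        proof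
          assume "C \<subseteq> Domain turn"
          then have "\<forall>c\<in>C. \<exists>c'. (c, c') \<in> turn"
            by (simp only: subset_iff Domain_iff Ball_def)
          then obtain \<phi> where \<phi>: "\<And>c. c \<in> C \<Longrightarrow> (c, \<phi> c) \<in> turn" by metis
          have "\<phi> ` C \<subseteq> C"
          proof (rule image_subsetI)
            fix c assume c: "c \<in> C"
            show "\<phi> c \<in> C" using turn_cv[OF \<phi>[OF c]] c by (simp add: C_def)
          qed
          moreover have "inj_on \<phi> C"
          proof (rule inj_onI)
            fix x y assume xy: "x \<in> C" "y \<in> C" "\<phi> x = \<phi> y"
            show "x = y"
              by (rule single_valuedD[OF single_valued_turn_converse, of "\<phi> x"])
                (use \<phi>[OF xy(1)] \<phi>[OF xy(2)] xy(3) in simp_all)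
          qed
          ultimately have "\<phi> ` C = C"
            by (intro endo_inj_surj) (auto simp: C_def)
          moreover have "(f, prv i) \<in> C" using fi pv by (auto simp: C_def prv_in_corners)
          ultimately have "(f, prv i) \<in> \<phi> ` C" by simp
          then obtain c where "(f, prv i) = \<phi> c" "c \<in> C" by (rule imageE)
          then have "(f, prv i) \<in> Range turn" using \<phi>[of c] by (simp add: RangeI)
          then show False using bdry_side_initial fi by auto
        qed
        then obtain g k where gk: "(g, k) \<in> corners F" "cv (g, k) = v" "(g, k) \<notin> Domain turn"
          unfolding C_def by auto
        have k: "nxt (prv k) = k" using nxt_prv corner_index[OF gk(1)] by simp
        have p: "(g, prv k) \<in> corners F" using gk(1) by (rule prv_in_corners)
        then have "se (g, prv k) \<in> Eb" using bdry_side_terminal[OF p] gk(3) k by simp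
        then show ?thesis using p k gk(2) by (auto simp: h_def B_def intro!: image_eqI[of _ _ "(g, prv k)"])
      qed
      ultimately show "v \<in> h ` B" by blast
    qed
  qed
  ultimately show ?thesis by (metis bij_betw_same_card)
qed

section \<open>Euler characteristics expressed by triangles\<close>

lemma sides_meeting_count:
  fixes A :: "'v set"
  defines "m \<equiv> \<lambda>s. edge_meets F cv se A (se s)"
  shows "card {s \<in> corners F. m s} = 2 * card {e \<in> E - Eb. edge_meets F cv se A e} + card {e \<in> Eb. edge_meets F cv se A e}"
proof -
  let ?T = "{e \<in> E. edge_meets F cv se A e}" and ?S = "{s \<in> corners F. m s}"
  have "card ?S = (\<Sum>e\<in>?T. card {s \<in> ?S. se s = e})"
    using sum.group[of ?S ?T se "\<lambda>_. 1::nat"] by (simp add: m_def edges_def image_subset_iff)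
  also have "\<dots> = (\<Sum>e\<in>?T. if e \<in> Eb then 1 else 2)"
  proof (rule sum.cong)
    fix e assume e: "e \<in> ?T"
    then obtain s where s: "s \<in> corners F" "e = se s" by (auto simp: edges_def)
    have "{s' \<in> ?S. se s' = e} = mates s"
      using e s by (auto simp: side_mates_def m_def)
    then show "card {s \<in> ?S. se s = e} = (if e \<in> Eb then 1 else 2)"
      using card_mates[OF s(1)] bdry_edge_iff[OF s(1)] s(2) by auto
  qed simp
  also have "\<dots> = card (?T \<inter> Eb) + 2 * card (?T - Eb)"
    by (subst sum.If_cases) (simp_all add: Int_def Diff_eq Compl_eq)
  moreover have "?T \<inter> Eb = {e \<in> Eb. edge_meets F cv se A e}" "?T - Eb = {e \<in> E - Eb. edge_meets F cv se A e}"
    using Eb_subset by auto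
  ultimately show ?thesis by simp
qed

text \<open>Each triangle has 0, 2 or 3 sides meeting \<open>A\<close>, according to whether none,
  one or at least two of its corners lie in \<open>A\<close>. So the edge terms, counted by sides,
  cancel the face terms and leave only one \<open>pi\<close> for each triangle with two corners in
  \<open>A\<close>.\<close>

lemma chi_G_formula:
  assumes "A \<subseteq> V"
  shows "2 * pi * of_int (chi_G_int F cv se A) + pi * of_int (chi_G_bd F cv se A)
     = (\<Sum>v\<in>A. flat_angle F cv se v) - pi * (\<Sum>f\<in>F. of_bool (two_in cv A f))"
proof -
  have fin: "finite A" using assms finite_V by (rule finite_subset)
  define hit where "hit f \<longleftrightarrow> (\<exists>i \<in> {0, 1, 2}. cv (f, i) \<in> A)" for f
  define nI nB eI eB nf where "nI = card (A \<inter> V - Vb)" and "nB = card (A \<inter> Vb)"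
    and "eI = card {e \<in> E - Eb. edge_meets F cv se A e}" and "eB = card {e \<in> Eb. edge_meets F cv se A e}"
    and "nf = card {f \<in> F. hit f}"
  have "A \<inter> V - Vb = A \<inter> - Vb" using assms by auto
  then have "(\<Sum>v\<in>A. flat_angle F cv se v) = pi * real nB + 2 * pi * real nI"
    unfolding flat_angle_def nI_def nB_def using fin by (subst sum.If_cases) simp_all
  moreover have "real (2 * eI + eB) = (\<Sum>f\<in>F. 2 * of_bool (hit f) + of_bool (two_in cv A f))"
  proof -
    have "real (2 * eI + eB) = (\<Sum>s\<in>corners F. of_bool (edge_meets F cv se A (se s)))"
      unfolding eI_def eB_def sides_meeting_count[symmetric] by (simp add: Int_def)
    also have "\<dots> = (\<Sum>f\<in>F. 2 * of_bool (hit f) + of_bool (two_in cv A f))"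
      unfolding sum_corners
    proof (rule sum.cong)
      fix f assume "f \<in> F"
      then have "(f, 0) \<in> corners F" "(f, 1) \<in> corners F" "(f, 2) \<in> corners F" by (auto simp: corners_def)
      then show "of_bool (edge_meets F cv se A (se (f, 0))) + of_bool (edge_meets F cv se A (se (f, 1)))
          + of_bool (edge_meets F cv se A (se (f, 2)))
        = (2 * of_bool (hit f) + of_bool (two_in cv A f) :: real)"
        by (simp add: edge_meets_iff two_in_def hit_def)
    qed simp
    finally show ?thesis .
  qed
  then have "real (2 * eI + eB) = 2 * real nf + (\<Sum>f\<in>F. of_bool (two_in cv A f))"
    unfolding nf_def by (simp add: sum.distrib sum_distrib_left[symmetric] Int_def)
  moreover have "of_int (chi_G_int F cv se A) = real nI - real eI + real nf"
    "of_int (chi_G_bd F cv se A) = real nB - real eB"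
    unfolding chi_G_int_def chi_G_bd_def nI_def nB_def eI_def eB_def nf_def hit_def by simp_all
  ultimately have eq: "(\<Sum>v\<in>A. flat_angle F cv se v) = pi * real nB + 2 * pi * real nI"
    and count: "2 * of_int (chi_G_int F cv se A) + of_int (chi_G_bd F cv se A)
      = 2 * real nI + real nB - (\<Sum>f\<in>F. of_bool (two_in cv A f))"
    by linarith+
  have "2 * pi * of_int (chi_G_int F cv se A) + pi * of_int (chi_G_bd F cv se A)
      = pi * (2 * of_int (chi_G_int F cv se A) + of_int (chi_G_bd F cv se A))"
    by (simp add: algebra_simps)
  then show ?thesis unfolding count eq by (simp add: algebra_simps)
qed

text \<open>The case \<open>A = V\<close> of the preceding count, where the boundary contributes
  zero by \<open>card_bdry\<close>. It is the combinatorial half of Gauss-Bonnet; the other half is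
  the angle sum of a triangle.\<close>

lemma euler_char_formula:
  "2 * pi * of_int (euler_char F cv se) = (\<Sum>v\<in>V. flat_angle F cv se v) - pi * real (card F)"
proof -
  have meets: "edge_meets F cv se V e" if e: "e \<in> E" for e
  proof -
    obtain f i where fi: "(f, i) \<in> corners F" "e = se (f, i)"
      using e by (auto simp: edges_def)
    show ?thesis unfolding fi(2) edge_meets_iff[OF fi(1)] using cv_in_V[OF nxt_in_corners[OF fi(1)]] by simp
  qed
  have two: "two_in cv V f" "\<exists>i\<in>{0,1,2}. cv (f, i) \<in> V" if "f \<in> F" for f
    using that by (auto simp: two_in_def corners_def intro!: cv_in_V)
  have "chi_G_bd F cv se V = 0"
  proof -
    have "{e \<in> Eb. edge_meets F cv se V e} = Eb" "V \<inter> Vb = Vb"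
      using meets Eb_subset Vb_subset by auto
    then show ?thesis by (simp add: chi_G_bd_def card_bdry)
  qed
  moreover have "chi_G_int F cv se V = euler_char F cv se"
  proof -
    have "{e \<in> E - Eb. edge_meets F cv se V e} = E - Eb" using meets by auto
    moreover have "{f \<in> F. \<exists>i \<in> {0, 1, 2}. cv (f, i) \<in> V} = F" using two(2) by auto
    moreover have "card (V - Vb) = card V - card Vb" "card (E - Eb) = card E - card Eb"
      using Vb_subset Eb_subset by (auto intro!: card_Diff_subset intro: finite_subset)
    moreover have "card Vb \<le> card V" "card Eb \<le> card E"
      using Vb_subset Eb_subset by (auto intro!: card_mono)
    ultimately show ?thesis unfolding chi_G_int_def euler_char_def by (simp add: card_bdry)
  qed
  ultimately show ?thesis using chi_G_formula[OF order_refl] two(1) by simp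
qed

end

section \<open>Angles and curvature on the surface\<close>

lemma finite_uniform_upper:
  fixes P :: "'a \<Rightarrow> real \<Rightarrow> bool"
  assumes "finite S" "\<And>s. s \<in> S \<Longrightarrow> \<exists>K\<ge>0. P s K"
    and mono: "\<And>s K K'. s \<in> S \<Longrightarrow> P s K \<Longrightarrow> K \<le> K' \<Longrightarrow> P s K'"
  shows "\<exists>K\<ge>0. \<forall>s\<in>S. P s K"
proof -
  obtain k where k: "\<And>s. s \<in> S \<Longrightarrow> 0 \<le> k s \<and> P s (k s)"
    using assms(2) by metis
  have "k s \<le> sum k S" if "s \<in> S" for s
    using assms(1) k that by (intro member_le_sum) auto
  then have "P s (sum k S)" if "s \<in> S" for s
    using mono[of s "k s" "sum k S"] k that by blast
  moreover have "0 \<le> sum k S" using k by (simp add: sum_nonneg)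
  ultimately show ?thesis by blast
qed

lemma finite_uniform_lower:
  fixes P :: "'a \<Rightarrow> real \<Rightarrow> bool"
  assumes "finite S" "\<And>s. s \<in> S \<Longrightarrow> \<exists>\<delta>>0. P s \<delta>"
    and mono: "\<And>s \<delta> \<delta>'. s \<in> S \<Longrightarrow> P s \<delta> \<Longrightarrow> 0 < \<delta>' \<Longrightarrow> \<delta>' \<le> \<delta> \<Longrightarrow> P s \<delta>'"
  shows "\<exists>\<delta>>0. \<forall>s\<in>S. P s \<delta>"
proof -
  obtain d where d: "\<And>s. s \<in> S \<Longrightarrow> 0 < d s \<and> P s (d s)"
    using assms(2) by metis
  define \<delta> where "\<delta> = Min (insert 1 (d ` S))"
  have "0 < \<delta>" "\<And>s. s \<in> S \<Longrightarrow> \<delta> \<le> d s"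
    using assms(1) d by (auto simp: \<delta>_def)
  then show ?thesis
    using d mono by (intro exI[of _ \<delta>]) blast
qed

locale circle_pattern = triangulated_surface F cv se
  for F :: "'f set" and cv :: "'f \<times> nat \<Rightarrow> 'v" and se :: "'f \<times> nat \<Rightarrow> 'e" +
  fixes \<Theta> :: "'e \<Rightarrow> real"
  assumes Theta_range: "\<And>e. e \<in> edges F se \<Longrightarrow> 0 \<le> \<Theta> e \<and> \<Theta> e < pi"
    and cond_C1: "cond_C1 F se \<Theta>"
begin

definition I :: "'f \<Rightarrow> nat \<Rightarrow> real" where
  "I f i = cos (\<Theta> (se (f, i)))"

definition angle :: "('v \<Rightarrow> real) \<Rightarrow> 'f \<times> nat \<Rightarrow> real" where
  "angle u c = corner_angle cv se \<Theta> (\<lambda>v. exp (u v)) c"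

definition field :: "('v \<Rightarrow> real) \<Rightarrow> 'v \<Rightarrow> real" where
  "field u v = K_av F cv se - curv F cv se \<Theta> (\<lambda>v. exp (u v)) v"

lemma corner_Theta: "(f, i) \<in> corners F \<Longrightarrow> 0 \<le> \<Theta> (se (f, i)) \<and> \<Theta> (se (f, i)) < pi"
  by (intro Theta_range) (simp add: edges_def)

lemma face_corners: "f \<in> F \<Longrightarrow> i \<in> {0, 1, 2} \<Longrightarrow> (f, i) \<in> corners F"
  by (auto simp: corners_def)

lemma face_triple:
  assumes c: "(f, i) \<in> corners F"
  shows "circle_triple (I f i) (I f (nxt i)) (I f (prv i))"
proof -
  have f: "f \<in> F" and i: "i \<in> {0, 1, 2}" using c by (auto simp: corners_def)
  have gt: "- 1 < I f j" if "j \<in> {0, 1, 2}" for j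
    using cos_monotone_0_pi[of "\<Theta> (se (f, j))" pi] corner_Theta[OF face_corners[OF f that]]
    by (simp add: I_def)
  have "0 \<le> I f j + I f (nxt j) * I f (prv j)" if "j \<in> {0, 1, 2}" for j
    using cond_C1 face_corners[OF f that] unfolding cond_C1_def I_def by fastforce
  from this[of 0] this[of 1] this[of 2] gt[of 0] gt[of 1] gt[of 2] show ?thesis
    using i by unfold_locales (auto simp: I_def mult.commute)
qed

lemma angle_eq:
  assumes c: "(f, i) \<in> corners F"
  shows "angle u (f, i) = tri_angle (I f i) (I f (nxt i)) (I f (prv i))
     (exp (u (cv (f, i)))) (exp (u (cv (f, nxt i)))) (exp (u (cv (f, prv i))))"
proof -
  have i: "i \<in> {0, 1, 2}" using c by (auto simp: corners_def)
  interpret T: circle_triple "I f i" "I f (nxt i)" "I f (prv i)" by (rule face_triple[OF c])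
  interpret T2: circle_triple "I f (nxt i)" "I f (prv i)" "I f i" by (rule T.rotate)
  interpret T3: circle_triple "I f (prv i)" "I f i" "I f (nxt i)" by (rule T2.rotate)
  let ?r1 = "exp (u (cv (f, i)))" and ?r2 = "exp (u (cv (f, nxt i)))" and ?r3 = "exp (u (cv (f, prv i)))"
  have ix: "nxt (nxt i) = prv i" "prv (prv i) = nxt i" "nxt (prv i) = i" "prv (nxt i) = i"
    using i by auto
  have len: "side_len cv se \<Theta> (\<lambda>v. exp (u v)) (f, i) = sqrt (tri_len2 (I f i) ?r2 ?r3)"
    "side_len cv se \<Theta> (\<lambda>v. exp (u v)) (f, nxt i) = sqrt (tri_len2 (I f (nxt i)) ?r3 ?r1)"
    "side_len cv se \<Theta> (\<lambda>v. exp (u v)) (f, prv i) = sqrt (tri_len2 (I f (prv i)) ?r1 ?r2)"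
    by (simp_all add: side_len_def tri_len2_def I_def ix)
  have pos: "0 < tri_len2 (I f i) ?r2 ?r3" "0 < tri_len2 (I f (nxt i)) ?r3 ?r1" "0 < tri_len2 (I f (prv i)) ?r1 ?r2"
    by (auto intro: T2.tri_len2_pos T3.tri_len2_pos T.tri_len2_pos)
  have "tri_len2 (I f (nxt i)) ?r3 ?r1 + tri_len2 (I f (prv i)) ?r1 ?r2 - tri_len2 (I f i) ?r2 ?r3
     = 2 * tri_dot (I f i) (I f (nxt i)) (I f (prv i)) ?r1 ?r2 ?r3"
    by (simp add: tri_len2_def tri_dot_def algebra_simps)
  then show ?thesis
    using pos unfolding angle_def corner_angle_def tri_angle_def
    by (simp add: len Let_def less_imp_le mult.assoc)
qed

lemma angle_bounds:
  assumes "(f, i) \<in> corners F"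
  shows "0 < angle u (f, i)" "angle u (f, i) < pi"
  unfolding angle_eq[OF assms]
  by (intro circle_triple.tri_angle_bounds[OF face_triple[OF assms]]; simp)+

lemma arccos_minus_I:
  assumes "(f, i) \<in> corners F"
  shows "arccos (- I f i) = pi - \<Theta> (se (f, i))"
proof -
  have "arccos (cos (pi - \<Theta> (se (f, i)))) = pi - \<Theta> (se (f, i))"
    using corner_Theta[OF assms] by (intro arccos_cos) auto
  then show ?thesis by (simp add: I_def)
qed

lemma angle_less:
  assumes "(f, i) \<in> corners F"
  shows "angle u (f, i) < pi - \<Theta> (se (f, i))"
  unfolding angle_eq[OF assms] arccos_minus_I[OF assms, symmetric]
  by (rule circle_triple.tri_angle_less_arccos[OF face_triple[OF assms]])

lemma angle_sum:
  assumes "f \<in> F"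
  shows "angle u (f, 0) + angle u (f, 1) + angle u (f, 2) = pi"
proof -
  have c: "(f, 0) \<in> corners F" "(f, 1) \<in> corners F" "(f, 2) \<in> corners F"
    using assms by (auto simp: corners_def)
  show ?thesis
    unfolding angle_eq[OF c(1)] angle_eq[OF c(2)] angle_eq[OF c(3)]
    using circle_triple.tri_angle_sum[OF face_triple[OF c(1)]] by simp
qed

lemma angle_lipschitz:
  "\<exists>K\<ge>0. \<forall>c\<in>corners F. \<forall>u w d. (\<forall>v\<in>V. \<bar>u v - w v\<bar> \<le> d) \<longrightarrow> \<bar>angle u c - angle w c\<bar> \<le> K * d"
proof (rule finite_uniform_upper)
  fix c assume "c \<in> corners F"
  then obtain f i where c: "c = (f, i)" "(f, i) \<in> corners F" by (cases c) auto
  obtain K where "K \<ge> 0" and K: "\<And>a1 a2 a3 b1 b2 b3 d. \<bar>a1 - b1\<bar> \<le> d \<Longrightarrow> \<bar>a2 - b2\<bar> \<le> d \<Longrightarrow> \<bar>a3 - b3\<bar> \<le> d \<Longrightarrow>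
     \<bar>tri_angle (I f i) (I f (nxt i)) (I f (prv i)) (exp a1) (exp a2) (exp a3)
       - tri_angle (I f i) (I f (nxt i)) (I f (prv i)) (exp b1) (exp b2) (exp b3)\<bar> \<le> K * d"
    using circle_triple.tri_angle_lipschitz[OF face_triple[OF c(2)]] by blast
  have "\<bar>angle u c - angle w c\<bar> \<le> K * d" if "\<forall>v\<in>V. \<bar>u v - w v\<bar> \<le> d" for u w d
    unfolding c(1) angle_eq[OF c(2)]
    by (intro K that[rule_format] cv_in_V nxt_in_corners prv_in_corners c(2))
  with \<open>K \<ge> 0\<close> show "\<exists>K\<ge>0. \<forall>u w d. (\<forall>v\<in>V. \<bar>u v - w v\<bar> \<le> d) \<longrightarrow> \<bar>angle u c - angle w c\<bar> \<le> K * d"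
    by blast
next
  fix c and K K' :: real
  assume *: "\<forall>u w d. (\<forall>v\<in>V. \<bar>u v - w v\<bar> \<le> d) \<longrightarrow> \<bar>angle u c - angle w c\<bar> \<le> K * d" "K \<le> K'"
  show "\<forall>u w d. (\<forall>v\<in>V. \<bar>u v - w v\<bar> \<le> d) \<longrightarrow> \<bar>angle u c - angle w c\<bar> \<le> K' * d"
  proof (intro allI impI)
    fix u w :: "'v \<Rightarrow> real" and d assume d: "\<forall>v\<in>V. \<bar>u v - w v\<bar> \<le> d"
    then have "0 \<le> d" using V_ne by (metis abs_ge_zero ex_in_conv order_trans)
    then have "K * d \<le> K' * d" using *(2) by (rule mult_right_mono[rotated])
    then show "\<bar>angle u c - angle w c\<bar> \<le> K' * d" using *(1) d by fastforce
  qed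
qed simp

section \<open>Dirichlet energy, monotonicity of the field and the Poincare inequality\<close>

definition face_energy :: "('v \<Rightarrow> real) \<Rightarrow> 'f \<Rightarrow> real" where
  "face_energy x f = (x (cv (f, 0)) - x (cv (f, 1)))\<^sup>2 + (x (cv (f, 1)) - x (cv (f, 2)))\<^sup>2 + (x (cv (f, 2)) - x (cv (f, 0)))\<^sup>2"

text \<open>Dirichlet energy with unit weights. It replaces the radius-dependent weights as soon as
  the logarithmic radii are confined to a box.\<close>

definition energy :: "('v \<Rightarrow> real) \<Rightarrow> real" where
  "energy x = (\<Sum>f\<in>F. face_energy x f)"

lemma face_energy_nonneg: "0 \<le> face_energy x f"
  by (simp add: face_energy_def)

lemma angle_monotone:
  "\<exists>\<delta>>0. \<forall>f\<in>F. \<forall>u w. (\<forall>v\<in>V. \<bar>u v\<bar> \<le> R \<and> \<bar>w v\<bar> \<le> R) \<longrightarrow>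
     (angle u (f, 0) - angle w (f, 0)) * (u (cv (f, 0)) - w (cv (f, 0)))
   + (angle u (f, 1) - angle w (f, 1)) * (u (cv (f, 1)) - w (cv (f, 1)))
   + (angle u (f, 2) - angle w (f, 2)) * (u (cv (f, 2)) - w (cv (f, 2)))
   \<le> - \<delta> * face_energy (\<lambda>v. u v - w v) f"
proof (rule finite_uniform_lower)
  fix f assume f: "f \<in> F"
  have c: "(f, 0) \<in> corners F" "(f, 1) \<in> corners F" "(f, 2) \<in> corners F"
    using f by (auto simp: corners_def)
  have cV: "cv (f, 0) \<in> V" "cv (f, 1) \<in> V" "cv (f, 2) \<in> V" using c by (auto intro: cv_in_V)
  interpret circle_triple "I f 0" "I f 1" "I f 2" using face_triple[OF c(1)] by simp
  obtain \<delta> where "\<delta> > 0" and \<delta>: "\<And>a1 a2 a3 b1 b2 b3. \<bar>a1\<bar> \<le> R \<Longrightarrow> \<bar>a2\<bar> \<le> R \<Longrightarrow> \<bar>a3\<bar> \<le> R \<Longrightarrow>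
      \<bar>b1\<bar> \<le> R \<Longrightarrow> \<bar>b2\<bar> \<le> R \<Longrightarrow> \<bar>b3\<bar> \<le> R \<Longrightarrow>
     (tri_angle (I f 0) (I f 1) (I f 2) (exp a1) (exp a2) (exp a3) - tri_angle (I f 0) (I f 1) (I f 2) (exp b1) (exp b2) (exp b3)) * (a1 - b1)
   + (tri_angle (I f 1) (I f 2) (I f 0) (exp a2) (exp a3) (exp a1) - tri_angle (I f 1) (I f 2) (I f 0) (exp b2) (exp b3) (exp b1)) * (a2 - b2)
   + (tri_angle (I f 2) (I f 0) (I f 1) (exp a3) (exp a1) (exp a2) - tri_angle (I f 2) (I f 0) (I f 1) (exp b3) (exp b1) (exp b2)) * (a3 - b3)
   \<le> - \<delta> * (((a1 - b1) - (a2 - b2))\<^sup>2 + ((a2 - b2) - (a3 - b3))\<^sup>2 + ((a3 - b3) - (a1 - b1))\<^sup>2)"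
    using tri_angle_monotone[of R] by blast
  show "\<exists>\<delta>>0. \<forall>u w. (\<forall>v\<in>V. \<bar>u v\<bar> \<le> R \<and> \<bar>w v\<bar> \<le> R) \<longrightarrow>
     (angle u (f, 0) - angle w (f, 0)) * (u (cv (f, 0)) - w (cv (f, 0)))
   + (angle u (f, 1) - angle w (f, 1)) * (u (cv (f, 1)) - w (cv (f, 1)))
   + (angle u (f, 2) - angle w (f, 2)) * (u (cv (f, 2)) - w (cv (f, 2)))
   \<le> - \<delta> * face_energy (\<lambda>v. u v - w v) f"
    unfolding angle_eq[OF c(1)] angle_eq[OF c(2)] angle_eq[OF c(3)] face_energy_def nxt_prv_simps
    using \<open>\<delta> > 0\<close> cV by (intro exI[of _ \<delta>] conjI allI impI \<delta>) auto
next
  fix f :: 'f and \<delta> \<delta>' :: real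
  assume *: "\<forall>u w. (\<forall>v\<in>V. \<bar>u v\<bar> \<le> R \<and> \<bar>w v\<bar> \<le> R) \<longrightarrow>
     (angle u (f, 0) - angle w (f, 0)) * (u (cv (f, 0)) - w (cv (f, 0)))
   + (angle u (f, 1) - angle w (f, 1)) * (u (cv (f, 1)) - w (cv (f, 1)))
   + (angle u (f, 2) - angle w (f, 2)) * (u (cv (f, 2)) - w (cv (f, 2)))
   \<le> - \<delta> * face_energy (\<lambda>v. u v - w v) f" and "\<delta>' \<le> \<delta>"
  then have "- \<delta> * face_energy (\<lambda>v. u v - w v) f \<le> - \<delta>' * face_energy (\<lambda>v. u v - w v) f" for u w
    by (intro mult_right_mono face_energy_nonneg) simp
  with * show "\<forall>u w. (\<forall>v\<in>V. \<bar>u v\<bar> \<le> R \<and> \<bar>w v\<bar> \<le> R) \<longrightarrow>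
     (angle u (f, 0) - angle w (f, 0)) * (u (cv (f, 0)) - w (cv (f, 0)))
   + (angle u (f, 1) - angle w (f, 1)) * (u (cv (f, 1)) - w (cv (f, 1)))
   + (angle u (f, 2) - angle w (f, 2)) * (u (cv (f, 2)) - w (cv (f, 2)))
   \<le> - \<delta>' * face_energy (\<lambda>v. u v - w v) f"
    by (meson order_trans)
qed simp

lemma field_eq:
  "field u v = K_av F cv se - flat_angle F cv se v + (\<Sum>c | c \<in> corners F \<and> cv c = v. angle u c)"
  unfolding field_def curv_def cone_angle_def flat_angle_def angle_def by simp

lemma sum_vertices_corners:
  fixes x :: "'v \<Rightarrow> real"
  assumes "A \<subseteq> V"
  shows "(\<Sum>v\<in>A. x v * (\<Sum>c | c \<in> corners F \<and> cv c = v. g c)) = (\<Sum>c\<in>corners F. of_bool (cv c \<in> A) * (x (cv c) * g c))"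
proof -
  have fin: "finite A" using assms finite_V by (rule finite_subset)
  have "(\<Sum>v\<in>A. x v * (\<Sum>c | c \<in> corners F \<and> cv c = v. g c)) = (\<Sum>v\<in>A. \<Sum>c | c \<in> {c\<in>corners F. cv c \<in> A} \<and> cv c = v. x (cv c) * g c)"
    unfolding sum_distrib_left by (intro sum.cong) auto
  also have "\<dots> = (\<Sum>c | c \<in> corners F \<and> cv c \<in> A. x (cv c) * g c)"
    using fin by (intro sum.group) auto
  also have "\<dots> = (\<Sum>c\<in>corners F. of_bool (cv c \<in> A) * (x (cv c) * g c))"
    by (intro sum.mono_neutral_cong_left) auto
  finally show ?thesis .
qed

lemma sum_field:
  assumes "A \<subseteq> V"
  shows "(\<Sum>v\<in>A. field u v) = K_av F cv se * real (card A) - (\<Sum>v\<in>A. flat_angle F cv se v)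
     + (\<Sum>c\<in>corners F. of_bool (cv c \<in> A) * angle u c)"
  unfolding field_eq sum.distrib sum_subtractf
  using sum_vertices_corners[OF assms, of "\<lambda>_. 1" "angle u"] by simp

lemma K_av_card: "K_av F cv se * real (card V) = (\<Sum>v\<in>V. flat_angle F cv se v) - pi * real (card F)"
  using V_ne euler_char_formula by (simp add: K_av_def card_eq_0_iff)

lemma sum_field_V: "(\<Sum>v\<in>V. field u v) = 0"
proof -
  have "(\<Sum>c\<in>corners F. of_bool (cv c \<in> V) * angle u c) = (\<Sum>c\<in>corners F. angle u c)"
    by (intro sum.cong) (auto simp: cv_in_V)
  also have "\<dots> = (\<Sum>f\<in>F. pi)"
    unfolding sum_corners by (intro sum.cong refl angle_sum)
  finally show ?thesis using sum_field[OF order_refl, of u] K_av_card by simp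
qed

lemma field_lipschitz: "\<exists>L. sup_lipschitz_on V L field"
proof -
  obtain K where "K \<ge> 0" and K: "\<And>c u w d. c \<in> corners F \<Longrightarrow> (\<forall>v\<in>V. \<bar>u v - w v\<bar> \<le> d) \<Longrightarrow> \<bar>angle u c - angle w c\<bar> \<le> K * d"
    using angle_lipschitz by blast
  have "sup_lipschitz_on V (real (card (corners F)) * K) field"
    unfolding sup_lipschitz_on_def
  proof (intro conjI allI impI ballI)
    show "0 \<le> real (card (corners F)) * K" using \<open>K \<ge> 0\<close> by simp
    fix u w :: "'v \<Rightarrow> real" and d v assume d: "\<forall>w'\<in>V. \<bar>u w' - w w'\<bar> \<le> d" and "v \<in> V"
    have "field u v - field w v = (\<Sum>c | c \<in> corners F \<and> cv c = v. angle u c - angle w c)"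
      unfolding field_eq by (simp add: sum_subtractf)
    also have "\<bar>\<dots>\<bar> \<le> (\<Sum>c | c \<in> corners F \<and> cv c = v. \<bar>angle u c - angle w c\<bar>)"
      by (rule sum_abs)
    also have "\<dots> \<le> (\<Sum>c\<in>corners F. \<bar>angle u c - angle w c\<bar>)"
      by (intro sum_mono2) auto
    also have "\<dots> \<le> (\<Sum>c\<in>corners F. K * d)"
      using K d by (intro sum_mono) blast
    finally show "\<bar>field u v - field w v\<bar> \<le> real (card (corners F)) * K * d" by simp
  qed
  then show ?thesis by blast
qed

text \<open>In differences of the field, \<open>K_av\<close> and the flat angles cancel. Regrouping
  the sum from vertices to corners and then to triangles leaves the estimate for a single
  triangle.\<close>

lemma field_monotone:
  "\<exists>\<delta>>0. \<forall>u w. (\<forall>v\<in>V. \<bar>u v\<bar> \<le> R \<and> \<bar>w v\<bar> \<le> R) \<longrightarrow>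
     (\<Sum>v\<in>V. (u v - w v) * (field u v - field w v)) \<le> - \<delta> * energy (\<lambda>v. u v - w v)"
proof -
  obtain \<delta> where "\<delta> > 0" and \<delta>: "\<And>f u w. f \<in> F \<Longrightarrow> (\<forall>v\<in>V. \<bar>u v\<bar> \<le> R \<and> \<bar>w v\<bar> \<le> R) \<Longrightarrow>
     (angle u (f, 0) - angle w (f, 0)) * (u (cv (f, 0)) - w (cv (f, 0)))
   + (angle u (f, 1) - angle w (f, 1)) * (u (cv (f, 1)) - w (cv (f, 1)))
   + (angle u (f, 2) - angle w (f, 2)) * (u (cv (f, 2)) - w (cv (f, 2)))
   \<le> - \<delta> * face_energy (\<lambda>v. u v - w v) f"
    using angle_monotone[of R] by blast
  have "(\<Sum>v\<in>V. (u v - w v) * (field u v - field w v)) \<le> - \<delta> * energy (\<lambda>v. u v - w v)"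
    if "\<forall>v\<in>V. \<bar>u v\<bar> \<le> R \<and> \<bar>w v\<bar> \<le> R" for u w
  proof -
    have "(\<Sum>v\<in>V. (u v - w v) * (field u v - field w v))
      = (\<Sum>v\<in>V. (u v - w v) * (\<Sum>c | c \<in> corners F \<and> cv c = v. angle u c - angle w c))"
      unfolding field_eq by (simp add: sum_subtractf)
    also have "\<dots> = (\<Sum>c\<in>corners F. of_bool (cv c \<in> V) * ((u (cv c) - w (cv c)) * (angle u c - angle w c)))"
      by (rule sum_vertices_corners) simp
    also have "\<dots> = (\<Sum>c\<in>corners F. (angle u c - angle w c) * (u (cv c) - w (cv c)))"
      by (intro sum.cong) (auto simp: cv_in_V)
    also have "\<dots> \<le> (\<Sum>f\<in>F. - \<delta> * face_energy (\<lambda>v. u v - w v) f)"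
      unfolding sum_corners using \<delta> that by (intro sum_mono) blast
    finally show ?thesis unfolding energy_def sum_distrib_left .
  qed
  with \<open>\<delta> > 0\<close> show ?thesis by blast
qed

lemma energy_nonneg: "0 \<le> energy x"
  unfolding energy_def by (intro sum_nonneg face_energy_nonneg)

text \<open>Any two points lie in some box; \<open>\<delta>\<close> depends on the box, the sign
  does not.\<close>

lemma field_monotone': "(\<Sum>v\<in>V. (u v - w v) * (field u v - field w v)) \<le> 0"
proof -
  define R where "R = (\<Sum>v\<in>V. \<bar>u v\<bar> + \<bar>w v\<bar>)"
  have "\<bar>u v\<bar> + \<bar>w v\<bar> \<le> R" if "v \<in> V" for v
    unfolding R_def using that by (intro member_le_sum) auto
  then have "\<forall>v\<in>V. \<bar>u v\<bar> \<le> R \<and> \<bar>w v\<bar> \<le> R" by fastforce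
  moreover obtain \<delta> where "\<delta> > 0" "\<And>u w. (\<forall>v\<in>V. \<bar>u v\<bar> \<le> R \<and> \<bar>w v\<bar> \<le> R) \<Longrightarrow>
     (\<Sum>v\<in>V. (u v - w v) * (field u v - field w v)) \<le> - \<delta> * energy (\<lambda>v. u v - w v)"
    using field_monotone[of R] by blast
  ultimately have "(\<Sum>v\<in>V. (u v - w v) * (field u v - field w v)) \<le> - \<delta> * energy (\<lambda>v. u v - w v)"
    by blast
  also have "\<dots> \<le> 0" using \<open>\<delta> > 0\<close> energy_nonneg by simp
  finally show ?thesis .
qed

lemma corner_difference_le:
  assumes "(f, i) \<in> corners F" "(f, j) \<in> corners F"
  shows "\<bar>x (cv (f, i)) - x (cv (f, j))\<bar> \<le> sqrt (energy x)"
proof -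
  have "f \<in> F" and ij: "i \<in> {0, 1, 2}" "j \<in> {0, 1, 2}" using assms by (auto simp: corners_def)
  have "face_energy x f \<le> energy x"
    unfolding energy_def using \<open>f \<in> F\<close> face_energy_nonneg by (intro member_le_sum) auto
  moreover have "(x (cv (f, i)) - x (cv (f, j)))\<^sup>2 \<le> face_energy x f"
    using ij unfolding face_energy_def by (auto simp: power2_commute)
  ultimately show ?thesis by (intro real_le_rsqrt) simp
qed

text \<open>Consecutive triangles of a chain share a vertex, and moving between two corners of one
  triangle costs at most \<open>sqrt (energy x)\<close>; so \<open>N\<close> counts the triangles of
  the chain.\<close>

lemma poincare_faces:
  assumes "(f, f') \<in> (face_adj F se)\<^sup>*" "f \<in> F"
  shows "f' \<in> F \<and> (\<exists>N\<ge>0. \<forall>x i j. (f, i) \<in> corners F \<longrightarrow> (f', j) \<in> corners F \<longrightarrow>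
           \<bar>x (cv (f, i)) - x (cv (f', j))\<bar> \<le> N * sqrt (energy x))"
  using assms
proof (induction rule: rtrancl_induct)
  case base
  then show ?case using corner_difference_le by (intro conjI exI[of _ 1]) auto
next
  case (step g h)
  from step.IH step.prems obtain N where "N \<ge> 0" and N: "\<And>x i j. (f, i) \<in> corners F \<Longrightarrow> (g, j) \<in> corners F \<Longrightarrow>
     \<bar>x (cv (f, i)) - x (cv (g, j))\<bar> \<le> N * sqrt (energy x)" by blast
  obtain k l where kl: "(g, k) \<in> corners F" "(h, l) \<in> corners F" "se (g, k) = se (h, l)"
    using step.hyps unfolding face_adj_def by blast
  have "\<exists>k' l'. (g, k') \<in> corners F \<and> (h, l') \<in> corners F \<and> cv (g, k') = cv (h, l')"
  proof (cases "(g, k) = (h, l)")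
    case False
    then show ?thesis
      using glued_ends(1)[OF kl(1,2) False kl(3)] nxt_in_corners[OF kl(1)] prv_in_corners[OF kl(2)] by blast
  qed (use kl in blast)
  then obtain k' l' where kl': "(g, k') \<in> corners F" "(h, l') \<in> corners F" "cv (g, k') = cv (h, l')"
    by blast
  have "\<bar>x (cv (f, i)) - x (cv (h, j))\<bar> \<le> (N + 1) * sqrt (energy x)"
    if "(f, i) \<in> corners F" "(h, j) \<in> corners F" for x i j
    using N[OF that(1) kl'(1), of x] corner_difference_le[OF kl'(2) that(2), of x] kl'(3)
    by (simp add: distrib_right)
  moreover have "h \<in> F" using kl(2) by (auto simp: corners_def)
  ultimately show ?case using \<open>N \<ge> 0\<close> by (intro conjI exI[of _ "N + 1"]) auto
qed

lemma poincare_differences: "\<exists>N\<ge>0. \<forall>x. \<forall>v\<in>V. \<forall>w\<in>V. \<bar>x v - x w\<bar> \<le> N * sqrt (energy x)"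
proof -
  have "\<exists>N\<ge>0. \<forall>p\<in>F \<times> F. \<forall>x i j. (fst p, i) \<in> corners F \<longrightarrow> (snd p, j) \<in> corners F \<longrightarrow>
           \<bar>x (cv (fst p, i)) - x (cv (snd p, j))\<bar> \<le> N * sqrt (energy x)"
  proof (rule finite_uniform_upper)
    fix p assume "p \<in> F \<times> F"
    then have p: "fst p \<in> F" "(fst p, snd p) \<in> (face_adj F se)\<^sup>*"
      by (auto intro: faces_connected)
    show "\<exists>K\<ge>0. \<forall>x i j. (fst p, i) \<in> corners F \<longrightarrow> (snd p, j) \<in> corners F \<longrightarrow>
           \<bar>x (cv (fst p, i)) - x (cv (snd p, j))\<bar> \<le> K * sqrt (energy x)"
      using poincare_faces[OF p(2,1)] by (rule conjunct2)
  next
    fix p :: "'f \<times> 'f" and K K' :: real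
    assume *: "\<forall>x i j. (fst p, i) \<in> corners F \<longrightarrow> (snd p, j) \<in> corners F \<longrightarrow>
           \<bar>x (cv (fst p, i)) - x (cv (snd p, j))\<bar> \<le> K * sqrt (energy x)" and "K \<le> K'"
    have "K * sqrt (energy x) \<le> K' * sqrt (energy x)" for x
      using \<open>K \<le> K'\<close> energy_nonneg by (intro mult_right_mono) auto
    with * show "\<forall>x i j. (fst p, i) \<in> corners F \<longrightarrow> (snd p, j) \<in> corners F \<longrightarrow>
           \<bar>x (cv (fst p, i)) - x (cv (snd p, j))\<bar> \<le> K' * sqrt (energy x)"
      by (meson order_trans)
  qed simp
  then obtain N where "N \<ge> 0" and N: "\<And>f g x i j. f \<in> F \<Longrightarrow> g \<in> F \<Longrightarrow> (f, i) \<in> corners F \<Longrightarrow> (g, j) \<in> corners F \<Longrightarrow>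
           \<bar>x (cv (f, i)) - x (cv (g, j))\<bar> \<le> N * sqrt (energy x)"
    by fastforce
  have "\<bar>x v - x w\<bar> \<le> N * sqrt (energy x)" if vw: "v \<in> V" "w \<in> V" for x v w
  proof -
    obtain f i g j where "v = cv (f, i)" "w = cv (g, j)" "(f, i) \<in> corners F" "(g, j) \<in> corners F"
      using vw by (auto simp: verts_def)
    moreover have "f \<in> F" "g \<in> F" using calculation by (auto simp: corners_def)
    ultimately show ?thesis using N by blast
  qed
  with \<open>N \<ge> 0\<close> show ?thesis by blast
qed

text \<open>For zero sum, \<open>n * x v\<close> is the sum of the differences
  \<open>x v - x w\<close>, so bounds on differences bound the values.\<close>

lemma poincare: "\<exists>C>0. \<forall>x. (\<Sum>v\<in>V. x v) = 0 \<longrightarrow> C * (\<Sum>v\<in>V. (x v)\<^sup>2) \<le> energy x"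
proof -
  obtain N where "N \<ge> 0" and N: "\<And>x v w. v \<in> V \<Longrightarrow> w \<in> V \<Longrightarrow> \<bar>x v - x w\<bar> \<le> N * sqrt (energy x)"
    using poincare_differences by blast
  define n where "n = real (card V)"
  have n: "n > 0" unfolding n_def using V_ne by (simp add: card_gt_0_iff)
  \<comment> \<open>The added 1 keeps \<open>B\<close> positive even when
    \<open>N = 0\<close>.\<close>
  define B where "B = n * N\<^sup>2 + 1"
  have B: "B > 0" unfolding B_def using n by (simp add: add_nonneg_pos)
  have "(\<Sum>v\<in>V. (x v)\<^sup>2) \<le> B * energy x" if x: "(\<Sum>v\<in>V. x v) = 0" for x
  proof -
    have "(x v)\<^sup>2 \<le> N\<^sup>2 * energy x" if v: "v \<in> V" for v
    proof -
      have "n * x v = (\<Sum>w\<in>V. x v - x w)" using x by (simp add: sum_subtractf n_def)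
      also have "\<bar>\<dots>\<bar> \<le> (\<Sum>w\<in>V. N * sqrt (energy x))"
        using N[OF v] by (intro order_trans[OF sum_abs] sum_mono) auto
      finally have "n * \<bar>x v\<bar> \<le> n * (N * sqrt (energy x))"
        using n by (simp add: abs_mult n_def)
      then have "\<bar>x v\<bar> \<le> N * sqrt (energy x)" using n by simp
      then have "\<bar>x v\<bar>\<^sup>2 \<le> (N * sqrt (energy x))\<^sup>2" by (intro power_mono) auto
      then show ?thesis using energy_nonneg[of x] by (simp add: power_mult_distrib)
    qed
    then have "(\<Sum>v\<in>V. (x v)\<^sup>2) \<le> (\<Sum>v\<in>V. N\<^sup>2 * energy x)" by (intro sum_mono) auto
    also have "\<dots> = n * N\<^sup>2 * energy x" by (simp add: n_def)
    also have "\<dots> \<le> B * energy x" unfolding B_def using energy_nonneg[of x] by (intro mult_right_mono) auto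
    finally show ?thesis .
  qed
  then have "\<forall>x. (\<Sum>v\<in>V. x v) = 0 \<longrightarrow> (1 / B) * (\<Sum>v\<in>V. (x v)\<^sup>2) \<le> energy x"
    using B by (simp add: field_simps)
  moreover have "1 / B > 0" using B by simp
  ultimately show ?thesis by blast
qed

text \<open>Angles do not change when a constant is added to all logarithmic radii, so strict
  contraction is available only for differences of zero sum.\<close>

lemma field_contraction:
  "\<exists>c>0. \<forall>u w. (\<forall>v\<in>V. \<bar>u v\<bar> \<le> R \<and> \<bar>w v\<bar> \<le> R) \<longrightarrow> (\<Sum>v\<in>V. u v - w v) = 0 \<longrightarrow>
     (\<Sum>v\<in>V. (u v - w v) * (field u v - field w v)) \<le> - c * (\<Sum>v\<in>V. (u v - w v)\<^sup>2)"
proof -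
  obtain \<delta> where "\<delta> > 0" and \<delta>: "\<And>u w. (\<forall>v\<in>V. \<bar>u v\<bar> \<le> R \<and> \<bar>w v\<bar> \<le> R) \<Longrightarrow>
     (\<Sum>v\<in>V. (u v - w v) * (field u v - field w v)) \<le> - \<delta> * energy (\<lambda>v. u v - w v)"
    using field_monotone[of R] by blast
  obtain C where "C > 0" and C: "\<And>x. (\<Sum>v\<in>V. x v) = 0 \<Longrightarrow> C * (\<Sum>v\<in>V. (x v)\<^sup>2) \<le> energy x"
    using poincare by blast
  have "(\<Sum>v\<in>V. (u v - w v) * (field u v - field w v)) \<le> - (\<delta> * C) * (\<Sum>v\<in>V. (u v - w v)\<^sup>2)"
    if "\<forall>v\<in>V. \<bar>u v\<bar> \<le> R \<and> \<bar>w v\<bar> \<le> R" "(\<Sum>v\<in>V. u v - w v) = 0" for u w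
  proof -
    have "\<delta> * (C * (\<Sum>v\<in>V. (u v - w v)\<^sup>2)) \<le> \<delta> * energy (\<lambda>v. u v - w v)"
      using C[OF that(2)] \<open>\<delta> > 0\<close> by (intro mult_left_mono) auto
    then show ?thesis using \<delta>[OF that(1)] by (simp add: mult.assoc)
  qed
  moreover have "\<delta> * C > 0" using \<open>\<delta> > 0\<close> \<open>C > 0\<close> by simp
  ultimately show ?thesis by blast
qed

section \<open>Sets of small circles\<close>

text \<open>The supremum, over all radii, of the total angle that the triangle \<open>f\<close> has at vertices of \<open>A\<close>.\<close>

definition max_angle :: "'v set \<Rightarrow> 'f \<Rightarrow> real" where
  "max_angle A f = (if two_in cv A f then pi
     else \<Sum>i\<in>{0, 1, 2}. of_bool (cv (f, i) \<in> A) * (pi - \<Theta> (se (f, i))))"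

definition face_angle :: "'v set \<Rightarrow> ('v \<Rightarrow> real) \<Rightarrow> 'f \<Rightarrow> real" where
  "face_angle A u f = (\<Sum>i\<in>{0, 1, 2}. of_bool (cv (f, i) \<in> A) * angle u (f, i))"

lemma face_angle_expand:
  "face_angle A u f = of_bool (cv (f, 0) \<in> A) * angle u (f, 0)
      + of_bool (cv (f, 1) \<in> A) * angle u (f, 1) + of_bool (cv (f, 2) \<in> A) * angle u (f, 2)"
  by (simp add: face_angle_def del: sum_of_bool_mult_eq sum_mult_of_bool_eq)

lemma max_angle_expand:
  "max_angle A f = (if two_in cv A f then pi else of_bool (cv (f, 0) \<in> A) * (pi - \<Theta> (se (f, 0)))
      + of_bool (cv (f, 1) \<in> A) * (pi - \<Theta> (se (f, 1))) + of_bool (cv (f, 2) \<in> A) * (pi - \<Theta> (se (f, 2))))"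
  by (simp add: max_angle_def del: sum_of_bool_mult_eq sum_mult_of_bool_eq)

lemma sum_corners_face_angle: "(\<Sum>c\<in>corners F. of_bool (cv c \<in> A) * angle u c) = (\<Sum>f\<in>F. face_angle A u f)"
  unfolding sum_corners face_angle_expand ..

text \<open>A corner in the link is the only corner of its triangle in \<open>A\<close>; these are
  exactly the corners that contribute to \<open>max_angle\<close> when \<open>two_in\<close>
  fails.\<close>

lemma sum_max_angle:
  "(\<Sum>f\<in>F. max_angle A f) = (\<Sum>(f, i)\<in>Lk F cv A. pi - \<Theta> (se (f, i))) + pi * (\<Sum>f\<in>F. of_bool (two_in cv A f))"
proof -
  have "(\<Sum>(f, i)\<in>Lk F cv A. pi - \<Theta> (se (f, i))) = (\<Sum>c\<in>corners F. of_bool (c \<in> Lk F cv A) * (pi - \<Theta> (se c)))"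
    by (intro sum.mono_neutral_cong_left) (auto simp: Lk_def)
  also have "\<dots> = (\<Sum>f\<in>F. max_angle A f - pi * of_bool (two_in cv A f))"
    unfolding sum_corners
  proof (rule sum.cong)
    fix f assume "f \<in> F"
    then have "(f, 0) \<in> corners F" "(f, 1) \<in> corners F" "(f, 2) \<in> corners F" by (auto simp: corners_def)
    then show "of_bool ((f, 0) \<in> Lk F cv A) * (pi - \<Theta> (se (f, 0)))
      + of_bool ((f, 1) \<in> Lk F cv A) * (pi - \<Theta> (se (f, 1)))
      + of_bool ((f, 2) \<in> Lk F cv A) * (pi - \<Theta> (se (f, 2)))
      = max_angle A f - pi * of_bool (two_in cv A f)"
      unfolding max_angle_expand by (auto simp: two_in_def Lk_def of_bool_def)
  qed simp
  finally show ?thesis by (simp add: sum_subtractf sum_distrib_left)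
qed

text \<open>For proper nonempty \<open>A\<close> this is the supremum of the sum of
  \<open>field u\<close> over \<open>A\<close>: it is a strict upper bound and is approached when
  the circles at \<open>A\<close> become small relative to all others. Its positivity is
  (E3).\<close>

definition slack :: "'v set \<Rightarrow> real" where
  "slack A = K_av F cv se * real (card A) - (\<Sum>v\<in>A. flat_angle F cv se v) + (\<Sum>f\<in>F. max_angle A f)"

lemma slack_pos_iff:
  assumes "A \<subseteq> V"
  shows "0 < slack A \<longleftrightarrow> 2 * pi * of_int (euler_char F cv se) * real (card A) / real (card V)
    > - (\<Sum>(f, i) \<in> Lk F cv A. pi - \<Theta> (se (f, i)))
      + 2 * pi * of_int (chi_G_int F cv se A) + pi * of_int (chi_G_bd F cv se A)"
proof -
  have "2 * pi * of_int (euler_char F cv se) * real (card A) / real (card V) = K_av F cv se * real (card A)"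
    by (simp add: K_av_def)
  then show ?thesis
    using chi_G_formula[OF assms] sum_max_angle[of A] unfolding slack_def by linarith
qed

text \<open>With one corner in \<open>A\<close> the bound is \<open>angle_less\<close>; with two it
  is \<open>pi\<close> minus the positive third angle; with three there is equality. Thus strictness
  holds exactly when corners inside and outside \<open>A\<close> are mixed.\<close>

lemma face_angle_le:
  assumes "f \<in> F"
  shows "face_angle A u f \<le> max_angle A f"
    and "cv (f, i) \<in> A \<Longrightarrow> cv (f, j) \<notin> A \<Longrightarrow> i \<in> {0, 1, 2} \<Longrightarrow> j \<in> {0, 1, 2} \<Longrightarrow> face_angle A u f < max_angle A f"
proof -
  have c: "(f, 0) \<in> corners F" "(f, 1) \<in> corners F" "(f, 2) \<in> corners F"
    using assms by (auto simp: corners_def)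
  note facts = angle_sum[OF assms, of u] angle_bounds[OF c(1), of u] angle_bounds[OF c(2), of u] angle_bounds[OF c(3), of u]
    angle_less[OF c(1), of u] angle_less[OF c(2), of u] angle_less[OF c(3), of u]
  show "face_angle A u f \<le> max_angle A f"
    using facts unfolding face_angle_expand max_angle_expand two_in_def
    by (cases "cv (f, 0) \<in> A"; cases "cv (f, 1) \<in> A"; cases "cv (f, 2) \<in> A"; simp; linarith)
  show "cv (f, i) \<in> A \<Longrightarrow> cv (f, j) \<notin> A \<Longrightarrow> i \<in> {0, 1, 2} \<Longrightarrow> j \<in> {0, 1, 2} \<Longrightarrow> face_angle A u f < max_angle A f"
    using facts unfolding face_angle_expand max_angle_expand two_in_def
    by (cases "cv (f, 0) \<in> A"; cases "cv (f, 1) \<in> A"; cases "cv (f, 2) \<in> A"; auto)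
qed

text \<open>Without such a triangle the indicator function of \<open>A\<close> would have zero
  energy without being constant, against the Poincare estimate.\<close>

lemma mixed_face:
  assumes "A \<subset> V" "A \<noteq> {}"
  shows "\<exists>f\<in>F. \<exists>i\<in>{0, 1, 2}. \<exists>j\<in>{0, 1, 2}. cv (f, i) \<in> A \<and> cv (f, j) \<notin> A"
proof (rule ccontr)
  assume none: "\<not> ?thesis"
  define x :: "'v \<Rightarrow> real" where "x v = of_bool (v \<in> A)" for v
  have "face_energy x f = 0" if "f \<in> F" for f
  proof -
    have "cv (f, 0) \<in> A \<longleftrightarrow> cv (f, 1) \<in> A" "cv (f, 1) \<in> A \<longleftrightarrow> cv (f, 2) \<in> A"
      using none that by blast+
    then show ?thesis by (simp add: face_energy_def x_def)
  qed
  then have E: "energy x = 0" by (simp add: energy_def)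
  obtain v w where vw: "v \<in> A" "w \<in> V" "w \<notin> A" "v \<in> V" using assms by blast
  obtain N where "\<forall>x. \<forall>v\<in>V. \<forall>w\<in>V. \<bar>x v - x w\<bar> \<le> N * sqrt (energy x)"
    using poincare_differences by blast
  then have "\<bar>x v - x w\<bar> \<le> N * sqrt (energy x)" using vw by blast
  then show False using vw by (simp add: x_def E)
qed

text \<open>This gives the necessity of (E3): at a metric of constant curvature the left side is
  zero.\<close>

lemma sum_field_less_slack:
  assumes "A \<subset> V" "A \<noteq> {}"
  shows "(\<Sum>v\<in>A. field u v) < slack A"
proof -
  obtain f i j where "f \<in> F" "i \<in> {0, 1, 2}" "j \<in> {0, 1, 2}" "cv (f, i) \<in> A" "cv (f, j) \<notin> A"
    using mixed_face[OF assms] by blast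
  then have "face_angle A u f < max_angle A f" by (intro face_angle_le(2))
  then have "(\<Sum>f\<in>F. face_angle A u f) < (\<Sum>f\<in>F. max_angle A f)"
    using \<open>f \<in> F\<close> by (intro sum_strict_mono_ex1) (auto intro: face_angle_le(1))
  then show ?thesis
    using sum_field[of A u] assms unfolding slack_def sum_corners_face_angle by auto
qed

lemma angle_small_circle:
  assumes c: "(f, i) \<in> corners F" and "0 < \<epsilon>"
  shows "\<exists>G. \<forall>u. u (cv (f, nxt i)) - u (cv (f, i)) \<ge> G \<longrightarrow> u (cv (f, prv i)) - u (cv (f, i)) \<ge> G \<longrightarrow>
     pi - \<Theta> (se (f, i)) - \<epsilon> \<le> angle u (f, i)"
proof -
  obtain G where "\<And>a1 a2 a3. a2 - a1 \<ge> G \<Longrightarrow> a3 - a1 \<ge> G \<Longrightarrow>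
    \<bar>tri_angle (I f i) (I f (nxt i)) (I f (prv i)) (exp a1) (exp a2) (exp a3) - arccos (- I f i)\<bar> < \<epsilon>"
    using circle_triple.tri_angle_small_circle[OF face_triple[OF c] \<open>0 < \<epsilon>\<close>] by blast
  then show ?thesis
    unfolding angle_eq[OF c] arccos_minus_I[OF c, symmetric] by (intro exI[of _ G]) (fastforce simp: abs_less_iff)
qed

lemma angle_large_circle:
  assumes c: "(f, i) \<in> corners F" and "0 < \<epsilon>"
  shows "\<exists>G. \<forall>u. u (cv (f, i)) - u (cv (f, nxt i)) \<ge> G \<longrightarrow> u (cv (f, i)) - u (cv (f, prv i)) \<ge> G \<longrightarrow>
     angle u (f, i) \<le> \<epsilon>"
proof -
  obtain G where "\<And>a1 a2 a3. a1 - a2 \<ge> G \<Longrightarrow> a1 - a3 \<ge> G \<Longrightarrow>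
    tri_angle (I f i) (I f (nxt i)) (I f (prv i)) (exp a1) (exp a2) (exp a3) < \<epsilon>"
    using circle_triple.tri_angle_large_circle[OF face_triple[OF c] \<open>0 < \<epsilon>\<close>] by blast
  then show ?thesis
    unfolding angle_eq[OF c] by (intro exI[of _ G]) (fastforce simp: less_imp_le)
qed

definition separated :: "real \<Rightarrow> 'v set \<Rightarrow> ('v \<Rightarrow> real) \<Rightarrow> bool" where
  "separated G A u \<longleftrightarrow> (\<forall>v\<in>A. \<forall>w\<in>V - A. G \<le> u w - u v)"

lemma separated_mono: "separated G A u \<Longrightarrow> G' \<le> G \<Longrightarrow> separated G' A u"
  unfolding separated_def by (meson order_trans)

text \<open>A single corner in \<open>A\<close> belongs to a small circle between two large ones,
  and its angle tends to \<open>pi - \<Theta>\<close>. For two corners in \<open>A\<close>, the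
  third circle is large against both, so its angle tends to zero and the other two absorb
  \<open>pi\<close>.\<close>

lemma face_angle_limit:
  assumes f: "f \<in> F" and "0 < \<epsilon>"
  shows "\<exists>G\<ge>0. \<forall>u. separated G A u \<longrightarrow> max_angle A f - \<epsilon> \<le> face_angle A u f"
proof -
  have c: "(f, i) \<in> corners F" if "i \<in> {0, 1, 2}" for i
    using f that by (auto simp: corners_def)
  have "\<exists>G\<ge>0. \<forall>i\<in>{0,1,2}. \<forall>u.
     (G \<le> u (cv (f, nxt i)) - u (cv (f, i)) \<longrightarrow> G \<le> u (cv (f, prv i)) - u (cv (f, i)) \<longrightarrow> pi - \<Theta> (se (f, i)) - \<epsilon> \<le> angle u (f, i)) \<and>
     (G \<le> u (cv (f, i)) - u (cv (f, nxt i)) \<longrightarrow> G \<le> u (cv (f, i)) - u (cv (f, prv i)) \<longrightarrow> angle u (f, i) \<le> \<epsilon>)"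
  proof (rule finite_uniform_upper)
    fix i :: nat assume i: "i \<in> {0, 1, 2}"
    obtain G1 G2 where
      "\<And>u. G1 \<le> u (cv (f, nxt i)) - u (cv (f, i)) \<Longrightarrow> G1 \<le> u (cv (f, prv i)) - u (cv (f, i)) \<Longrightarrow> pi - \<Theta> (se (f, i)) - \<epsilon> \<le> angle u (f, i)"
      "\<And>u. G2 \<le> u (cv (f, i)) - u (cv (f, nxt i)) \<Longrightarrow> G2 \<le> u (cv (f, i)) - u (cv (f, prv i)) \<Longrightarrow> angle u (f, i) \<le> \<epsilon>"
      using angle_small_circle[OF c[OF i] \<open>0 < \<epsilon>\<close>] angle_large_circle[OF c[OF i] \<open>0 < \<epsilon>\<close>] by blast
    then show "\<exists>G\<ge>0. \<forall>u.
     (G \<le> u (cv (f, nxt i)) - u (cv (f, i)) \<longrightarrow> G \<le> u (cv (f, prv i)) - u (cv (f, i)) \<longrightarrow> pi - \<Theta> (se (f, i)) - \<epsilon> \<le> angle u (f, i)) \<and>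
     (G \<le> u (cv (f, i)) - u (cv (f, nxt i)) \<longrightarrow> G \<le> u (cv (f, i)) - u (cv (f, prv i)) \<longrightarrow> angle u (f, i) \<le> \<epsilon>)"
      by (intro exI[of _ "max 0 (max G1 G2)"]) auto
  qed (auto intro: order_trans)
  then obtain G where "G \<ge> 0" and
    small: "\<And>i u. i \<in> {0, 1, 2} \<Longrightarrow> G \<le> u (cv (f, nxt i)) - u (cv (f, i)) \<Longrightarrow> G \<le> u (cv (f, prv i)) - u (cv (f, i)) \<Longrightarrow> pi - \<Theta> (se (f, i)) - \<epsilon> \<le> angle u (f, i)" and
    large: "\<And>i u. i \<in> {0, 1, 2} \<Longrightarrow> G \<le> u (cv (f, i)) - u (cv (f, nxt i)) \<Longrightarrow> G \<le> u (cv (f, i)) - u (cv (f, prv i)) \<Longrightarrow> angle u (f, i) \<le> \<epsilon>"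
    by blast
  have "max_angle A f - \<epsilon> \<le> face_angle A u f" if sep: "separated G A u" for u
  proof -
    have cV: "cv (f, 0) \<in> V" "cv (f, 1) \<in> V" "cv (f, 2) \<in> V" using c by (auto intro!: cv_in_V)
    have gap: "G \<le> u (cv (f, j)) - u (cv (f, i))" if "cv (f, i) \<in> A" "cv (f, j) \<notin> A" "j \<in> {0, 1, 2}" for i j
      using sep that cV unfolding separated_def by blast
    note gaps = gap[of 0 1] gap[of 0 2] gap[of 1 0] gap[of 1 2] gap[of 2 0] gap[of 2 1]
    note sm = small[of 0 u] small[of 1 u] small[of 2 u]
    note lg = large[of 0 u] large[of 1 u] large[of 2 u]
    have sum: "angle u (f, 0) + angle u (f, 1) + angle u (f, 2) = pi" by (rule angle_sum[OF f])
    show ?thesis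
      using gaps sm lg sum \<open>0 < \<epsilon>\<close> unfolding face_angle_expand max_angle_expand two_in_def
      by (cases "cv (f, 0) \<in> A"; cases "cv (f, 1) \<in> A"; cases "cv (f, 2) \<in> A"; simp)
  qed
  with \<open>G \<ge> 0\<close> show ?thesis by blast
qed

lemma sum_field_pos_if_separated:
  assumes slack: "\<And>A. A \<subset> V \<Longrightarrow> A \<noteq> {} \<Longrightarrow> 0 < slack A"
  shows "\<exists>G\<ge>0. \<forall>A\<in>{A. A \<subset> V \<and> A \<noteq> {}}. \<forall>u. separated G A u \<longrightarrow> 0 < (\<Sum>v\<in>A. field u v)"
proof (rule finite_uniform_upper)
  show "finite {A. A \<subset> V \<and> A \<noteq> {}}"
    by (rule finite_subset[of _ "Pow V"]) auto
  fix A assume A: "A \<in> {A. A \<subset> V \<and> A \<noteq> {}}"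
  \<comment> \<open>With this error per triangle, half of the slack remains after summation over all
    triangles.\<close>
  define \<epsilon> where "\<epsilon> = slack A / (2 * real (card F))"
  have nF: "real (card F) > 0" using F_ne by (simp add: card_gt_0_iff)
  have "\<epsilon> > 0" unfolding \<epsilon>_def using slack A nF by simp
  have "\<exists>G\<ge>0. \<forall>f\<in>F. \<forall>u. separated G A u \<longrightarrow> max_angle A f - \<epsilon> \<le> face_angle A u f"
    by (rule finite_uniform_upper[OF finite_F]) (auto intro: face_angle_limit[OF _ \<open>\<epsilon> > 0\<close>] dest: separated_mono)
  then obtain G where "G \<ge> 0" and G: "\<And>f u. f \<in> F \<Longrightarrow> separated G A u \<Longrightarrow> max_angle A f - \<epsilon> \<le> face_angle A u f"
    by blast
  have "0 < (\<Sum>v\<in>A. field u v)" if "separated G A u" for u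
  proof -
    have "(\<Sum>f\<in>F. max_angle A f) - real (card F) * \<epsilon> = (\<Sum>f\<in>F. max_angle A f - \<epsilon>)"
      by (simp add: sum_subtractf)
    also have "\<dots> \<le> (\<Sum>f\<in>F. face_angle A u f)"
      using G that by (intro sum_mono) blast
    finally have "slack A - real (card F) * \<epsilon> \<le> (\<Sum>v\<in>A. field u v)"
      using A sum_field[of A u] unfolding slack_def sum_corners_face_angle by auto
    moreover have "real (card F) * \<epsilon> = slack A / 2" unfolding \<epsilon>_def using F_ne by simp
    ultimately show ?thesis using slack[of A] A by auto
  qed
  with \<open>G \<ge> 0\<close> show "\<exists>G\<ge>0. \<forall>u. separated G A u \<longrightarrow> 0 < (\<Sum>v\<in>A. field u v)" by blast
qed (use separated_mono in blast)

end

section \<open>The flow\<close>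

lemma nonincreasing_on_ray:
  fixes f :: "real \<Rightarrow> real"
  assumes der: "\<And>t. t \<ge> 0 \<Longrightarrow> (f has_real_derivative f' t) (at t within {0..})"
    and le: "\<And>t. t \<ge> 0 \<Longrightarrow> f' t \<le> 0" and st: "0 \<le> s" "s \<le> t"
  shows "f t \<le> f s"
proof (cases "s = t")
  case False
  with st have "s < t" by simp
  show ?thesis
  proof (rule DERIV_nonpos_imp_decreasing_open[OF st(2)])
    fix x assume "s < x" "x < t"
    then have "at x within {0..} = at x" using st by (intro at_within_interior) auto
    then show "\<exists>y. (f has_real_derivative y) (at x) \<and> y \<le> 0"
      using der[of x] le[of x] st \<open>s < x\<close> by auto
  next
    have "continuous_on {0..} f"
      using der by (auto simp: continuous_on_eq_continuous_within intro: DERIV_continuous)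
    then show "continuous_on {s..t} f" by (rule continuous_on_subset) (use st in auto)
  qed
qed simp

lemma exponential_decay:
  fixes f :: "real \<Rightarrow> real"
  assumes der: "\<And>t. t \<ge> 0 \<Longrightarrow> (f has_real_derivative f' t) (at t within {0..})"
    and le: "\<And>t. t \<ge> 0 \<Longrightarrow> f' t \<le> - c * f t" and t: "0 \<le> t"
  shows "f t \<le> f 0 * exp (- c * t)"
proof -
  have "f t * exp (c * t) \<le> f 0 * exp (c * 0)"
  proof (rule nonincreasing_on_ray[where f = "\<lambda>t. f t * exp (c * t)", OF _ _ order_refl t])
    fix t :: real assume t: "t \<ge> 0"
    show "((\<lambda>t. f t * exp (c * t)) has_real_derivative (f' t + c * f t) * exp (c * t)) (at t within {0..})"
      by (auto intro!: derivative_eq_intros der[OF t] simp: algebra_simps)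
    have "f' t + c * f t \<le> 0" using le[OF t] by simp
    then show "(f' t + c * f t) * exp (c * t) \<le> 0" by (simp add: mult_le_0_iff)
  qed
  then show ?thesis by (simp add: exp_minus field_simps)
qed

lemma exp_decay_tendsto_0:
  fixes c B :: real
  assumes "c > 0"
  shows "((\<lambda>t. B * exp (- c * t)) \<longlongrightarrow> 0) at_top"
proof (rule tendsto_mult_right_zero)
  have "filterlim (\<lambda>t. - c * t) at_bot at_top"
    using assms by (intro filterlim_tendsto_neg_mult_at_bot[OF tendsto_const _ filterlim_ident]) simp
  then show "((\<lambda>t. exp (- c * t)) \<longlongrightarrow> 0) at_top"
    by (rule filterlim_compose[OF exp_at_bot])
qed

lemma tendsto_of_exp_bound:
  fixes f :: "real \<Rightarrow> real"
  assumes c: "c > 0" and le: "\<And>t. t \<ge> 0 \<Longrightarrow> \<bar>f t - l\<bar> \<le> B * exp (- c * t)"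
  shows "(f \<longlongrightarrow> l) at_top"
proof (rule LIM_zero_cancel)
  show "((\<lambda>t. f t - l) \<longlongrightarrow> 0) at_top"
    by (rule Lim_null_comparison[OF _ exp_decay_tendsto_0[OF c, of B]])
      (use le in \<open>auto intro!: eventually_at_top_linorderI[of 0]\<close>)
qed

text \<open>On \<open>[T, T + 1]\<close> the function moves by less than half of
  \<open>\<bar>a\<bar>\<close>. The mean value theorem gives a point whose derivative is that small
  and yet within half of \<open>\<bar>a\<bar>\<close> from \<open>a\<close>.\<close>

lemma limit_derivative_zero:
  fixes f :: "real \<Rightarrow> real"
  assumes der: "\<And>t. t \<ge> 0 \<Longrightarrow> (f has_real_derivative f' t) (at t within {0..})"
    and f: "(f \<longlongrightarrow> l) at_top" and f': "(f' \<longlongrightarrow> a) at_top"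
  shows "a = 0"
proof (rule ccontr)
  assume "a \<noteq> 0"
  then have "\<forall>\<^sub>F t in at_top. dist (f' t) a < \<bar>a\<bar> / 2" using f' by (intro tendstoD) auto
  moreover have "\<forall>\<^sub>F t in at_top. dist (f t) l < \<bar>a\<bar> / 4" using \<open>a \<noteq> 0\<close> f by (intro tendstoD) auto
  ultimately have "\<forall>\<^sub>F t in at_top. dist (f' t) a < \<bar>a\<bar> / 2 \<and> dist (f t) l < \<bar>a\<bar> / 4"
    by (rule eventually_conj)
  then obtain T0 where T0: "\<And>t. t \<ge> T0 \<Longrightarrow> dist (f' t) a < \<bar>a\<bar> / 2 \<and> dist (f t) l < \<bar>a\<bar> / 4"
    by (auto simp: eventually_at_top_linorder)
  define T where "T = max T0 1"
  have T: "T \<ge> T0" "T > 0" by (auto simp: T_def)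
  have "(f has_real_derivative f' x) (at x)" if "T \<le> x" for x
  proof -
    have "at x within {0..} = at x" using that T by (intro at_within_interior) auto
    then show ?thesis using der[of x] that T by simp
  qed
  then obtain z where z: "T < z" "f (T + 1) - f T = (T + 1 - T) * f' z"
    using MVT2[of T "T + 1" f f'] by auto
  have "\<bar>f' z\<bar> < \<bar>a\<bar> / 2"
    using T0[of T] T0[of "T + 1"] T z(2) unfolding dist_real_def by (simp add: abs_if split: if_splits)
  moreover have "\<bar>f' z - a\<bar> < \<bar>a\<bar> / 2" using T0[of z] T z unfolding dist_real_def by simp
  ultimately show False by linarith
qed

text \<open>At the first time one of the functions reaches zero, it would have to do so increasingly.\<close>

lemma barrier_invariance:
  fixes \<phi> \<phi>' :: "'i \<Rightarrow> real \<Rightarrow> real"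
  assumes fin: "finite J"
    and der: "\<And>i t. i \<in> J \<Longrightarrow> t \<ge> 0 \<Longrightarrow> (\<phi> i has_real_derivative \<phi>' i t) (at t within {0..})"
    and init: "\<And>i. i \<in> J \<Longrightarrow> 0 < \<phi> i 0"
    and barrier: "\<And>i t. i \<in> J \<Longrightarrow> t \<ge> 0 \<Longrightarrow> (\<And>j. j \<in> J \<Longrightarrow> 0 \<le> \<phi> j t) \<Longrightarrow> \<phi> i t = 0 \<Longrightarrow> 0 < \<phi>' i t"
    and i: "i \<in> J" and t: "t \<ge> 0"
  shows "0 \<le> \<phi> i t"
proof (rule ccontr)
  assume neg: "\<not> 0 \<le> \<phi> i t"
  have cont: "continuous_on {0..} (\<phi> j)" if "j \<in> J" for j
    using der[OF that] by (auto simp: continuous_on_eq_continuous_within intro: DERIV_continuous)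
  \<comment> \<open>Times of value at most zero are collected, so the violation at \<open>t\<close>
    already lies in \<open>Z\<close>; being closed, \<open>Z\<close> contains its infimum, the first
    contact time.\<close>
  define Z where "Z = (\<Union>j\<in>J. {0..} \<inter> \<phi> j -` {..0})"
  define T where "T = Inf Z"
  have "closed Z"
    unfolding Z_def using fin cont
    by (intro closed_UN ballI continuous_closed_preimage) auto
  moreover have "t \<in> Z" unfolding Z_def using i t neg by (intro UN_I[of i]) auto
  then have "Z \<noteq> {}" by blast
  moreover have bdd: "bdd_below Z" by (auto simp: Z_def bdd_below_def)
  ultimately have "T \<in> Z" unfolding T_def by (intro closed_contains_Inf)
  then obtain j where j: "j \<in> J" "T \<ge> 0" "\<phi> j T \<le> 0" by (auto simp: Z_def)
  have "T > 0" using j init[OF j(1)] by (cases "T = 0") auto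
  have before: "0 < \<phi> k s" if "k \<in> J" "0 \<le> s" "s < T" for k s
  proof (rule ccontr)
    assume "\<not> 0 < \<phi> k s"
    then have "s \<in> Z" using that by (auto simp: Z_def not_less)
    then have "T \<le> s" unfolding T_def using bdd by (rule cInf_lower)
    then show False using that by simp
  qed
  have nonneg: "0 \<le> \<phi> k T" if k: "k \<in> J" for k
  proof (rule tendsto_lowerbound)
    have "(\<phi> k \<longlongrightarrow> \<phi> k T) (at T within {0..})"
      using cont[OF k] \<open>T > 0\<close> by (simp add: continuous_on_def)
    moreover have "at T within {0..} = at T" using \<open>T > 0\<close> by (intro at_within_interior) auto
    ultimately show "(\<phi> k \<longlongrightarrow> \<phi> k T) (at_left T)" by (auto intro: tendsto_within_subset)
    show "\<forall>\<^sub>F s in at_left T. 0 \<le> \<phi> k s"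
      by (rule eventually_at_leftI[OF _ \<open>T > 0\<close>]) (use before[OF k] in \<open>auto intro: less_imp_le\<close>)
  qed simp
  have "\<phi> j T = 0" using nonneg[OF j(1)] j(3) by simp
  then have "0 < \<phi>' j T" using barrier[OF j(1,2)] nonneg by blast
  moreover have "(\<phi> j has_real_derivative \<phi>' j T) (at T)"
  proof -
    have "at T within {0..} = at T" using \<open>T > 0\<close> by (intro at_within_interior) auto
    then show ?thesis using der[OF j(1,2)] by simp
  qed
  ultimately obtain d where d: "d > 0" "\<And>h. 0 < h \<Longrightarrow> h < d \<Longrightarrow> \<phi> j (T - h) < \<phi> j T"
    using DERIV_pos_inc_left by blast
  define h where "h = min (d / 2) (T / 2)"
  have "0 < h" "h < d" "h < T" using d(1) \<open>T > 0\<close> by (auto simp: h_def)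
  then show False using d(2)[of h] before[OF j(1), of "T - h"] \<open>\<phi> j T = 0\<close> by simp
qed

lemma exp_difference_le:
  fixes a b R :: real
  assumes "a \<le> R" "b \<le> R"
  shows "\<bar>exp a - exp b\<bar> \<le> exp R * \<bar>a - b\<bar>"
proof -
  have *: "exp y - exp x \<le> exp R * (y - x)" if "x \<le> y" "y \<le> R" for x y
  proof -
    have "exp y - exp x = exp y * (1 - exp (x - y))" by (simp add: exp_diff field_simps)
    also have "\<dots> \<le> exp y * (y - x)"
    proof (rule mult_left_mono)
      show "1 - exp (x - y) \<le> y - x" using exp_ge_add_one_self[of "x - y"] by linarith
    qed simp
    also have "\<dots> \<le> exp R * (y - x)" using that by (intro mult_right_mono) auto
    finally show ?thesis .
  qed
  show ?thesis
    using *[of a b] *[of b a] assms by (cases "a \<le> b") (auto simp: abs_if)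
qed

context circle_pattern
begin

section \<open>The flow in logarithmic radii\<close>

definition log_flow :: "(real \<Rightarrow> 'v \<Rightarrow> real) \<Rightarrow> bool" where
  "log_flow u \<longleftrightarrow> (\<forall>t\<ge>0. \<forall>v\<in>V. ((\<lambda>s. u s v) has_real_derivative field (u t) v) (at t within {0..}))"

lemma log_flowD: "log_flow u \<Longrightarrow> v \<in> V \<Longrightarrow> t \<ge> 0 \<Longrightarrow> ((\<lambda>s. u s v) has_real_derivative field (u t) v) (at t within {0..})"
  by (simp add: log_flow_def)

lemma curv_cong:
  assumes "\<And>v. v \<in> V \<Longrightarrow> r v = r' v"
  shows "curv F cv se \<Theta> r v = curv F cv se \<Theta> r' v"
proof -
  have "corner_angle cv se \<Theta> r c = corner_angle cv se \<Theta> r' c" if c_in: "c \<in> corners F" for c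
  proof -
    obtain f i where c: "c = (f, i)" "(f, i) \<in> corners F" using c_in by (cases c) auto
    have "side_len cv se \<Theta> r (f, j) = side_len cv se \<Theta> r' (f, j)" if "(f, j) \<in> corners F" for j
      using assms[OF cv_in_V[OF nxt_in_corners[OF that]]] assms[OF cv_in_V[OF prv_in_corners[OF that]]]
      by (simp add: side_len_def)
    from this[OF c(2)] this[OF nxt_in_corners[OF c(2)]] this[OF prv_in_corners[OF c(2)]]
    show ?thesis unfolding c(1) corner_angle_def by simp
  qed
  then show ?thesis unfolding curv_def cone_angle_def by (auto intro!: sum.cong)
qed

lemma field_ln:
  assumes "\<And>v. v \<in> V \<Longrightarrow> 0 < r v"
  shows "field (\<lambda>v. ln (r v)) v = K_av F cv se - curv F cv se \<Theta> r v"
  unfolding field_def using assms by (simp add: curv_cong[of "\<lambda>v. exp (ln (r v))" r])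

lemma flow_solution_log_flow:
  assumes "flow_solution F cv se \<Theta> r0 r"
  shows "log_flow (\<lambda>t v. ln (r t v))"
  unfolding log_flow_def
proof (intro allI impI ballI)
  fix t :: real and v assume t: "t \<ge> 0" and v: "v \<in> V"
  have pos: "\<And>v. v \<in> V \<Longrightarrow> 0 < r t v"
    and der: "((\<lambda>s. r s v) has_real_derivative ((K_av F cv se - curv F cv se \<Theta> (r t) v) * r t v)) (at t within {0..})"
    using assms t v unfolding flow_solution_def by auto
  have eq: "field (\<lambda>v. ln (r t v)) v = K_av F cv se - curv F cv se \<Theta> (r t) v"
    by (rule field_ln) (rule pos)
  show "((\<lambda>s. ln (r s v)) has_real_derivative field (\<lambda>v. ln (r t v)) v) (at t within {0..})"
    unfolding eq using pos[OF v] by (auto intro!: derivative_eq_intros der simp: field_simps)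
qed

lemma log_flow_flow_solution:
  assumes "log_flow u" "\<And>v. v \<in> V \<Longrightarrow> u 0 v = ln (r0 v)" "\<And>v. v \<in> V \<Longrightarrow> 0 < r0 v"
  shows "flow_solution F cv se \<Theta> r0 (\<lambda>t v. exp (u t v))"
  unfolding flow_solution_def
proof (intro conjI allI impI ballI)
  show "exp (u 0 v) = r0 v" if "v \<in> V" for v using assms(2,3)[OF that] by simp
  fix t :: real and v assume t: "t \<ge> 0" and v: "v \<in> V"
  show "0 < exp (u t v)" by simp
  show "((\<lambda>s. exp (u s v)) has_real_derivative (K_av F cv se - curv F cv se \<Theta> (\<lambda>v. exp (u t v)) v) * exp (u t v)) (at t within {0..})"
    using log_flowD[OF assms(1) v t] unfolding field_def by (auto intro!: derivative_eq_intros)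
qed

lemma field_tendsto:
  assumes u: "\<And>v. v \<in> V \<Longrightarrow> ((\<lambda>t. u t v) \<longlongrightarrow> w v) G" and v: "v \<in> V"
  shows "((\<lambda>t. field (u t) v) \<longlongrightarrow> field w v) G"
proof -
  obtain L where L: "sup_lipschitz_on V L field" using field_lipschitz by blast
  have "((\<lambda>t. L * (\<Sum>v\<in>V. \<bar>u t v - w v\<bar>)) \<longlongrightarrow> L * (\<Sum>v\<in>V. \<bar>w v - w v\<bar>)) G"
    by (intro tendsto_intros u)
  then have lim: "((\<lambda>t. L * (\<Sum>v\<in>V. \<bar>u t v - w v\<bar>)) \<longlongrightarrow> 0) G" by simp
  have "\<bar>field (u t) v - field w v\<bar> \<le> L * (\<Sum>v\<in>V. \<bar>u t v - w v\<bar>)" for t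
    by (rule sup_lipschitz_onD[OF L v]) (rule member_le_sum, auto)
  then have "((\<lambda>t. field (u t) v - field w v) \<longlongrightarrow> 0) G"
    by (intro Lim_null_comparison[OF always_eventually lim]) simp
  then show ?thesis by (rule LIM_zero_cancel)
qed

lemma log_flow_exists: "\<exists>u. log_flow u \<and> (\<forall>v\<in>V. u 0 v = u0 v)"
proof -
  obtain L where "sup_lipschitz_on V L field" using field_lipschitz by blast
  from picard_lindeloef_sup_lipschitz[OF finite_V this, of u0] show ?thesis
    unfolding log_flow_def by blast
qed

lemma log_flow_shift:
  assumes "log_flow u" "h \<ge> 0"
  shows "log_flow (\<lambda>t. u (t + h))"
  unfolding log_flow_def
proof (intro allI impI ballI)
  fix t :: real and v assume "t \<ge> 0" "v \<in> V"
  have "((\<lambda>s. u s v) has_real_derivative field (u (t + h)) v) (at (t + h) within (\<lambda>s. s + h) ` {0..})"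
    by (rule has_field_derivative_subset[OF log_flowD[OF assms(1) \<open>v \<in> V\<close>]]) (use assms \<open>t \<ge> 0\<close> in auto)
  then have "((\<lambda>s. u s v) \<circ> (\<lambda>s. s + h) has_real_derivative field (u (t + h)) v * 1) (at t within {0..})"
    by (rule DERIV_image_chain) (auto intro!: derivative_eq_intros)
  then show "((\<lambda>s. u (s + h) v) has_real_derivative field (u (t + h)) v) (at t within {0..})"
    by (simp add: o_def)
qed

text \<open>By Gauss-Bonnet in the form \<open>sum_field_V\<close> the derivative vanishes. In terms
  of the radii, their product is conserved.\<close>

lemma log_flow_sum:
  assumes "log_flow u" "t \<ge> 0"
  shows "(\<Sum>v\<in>V. u t v) = (\<Sum>v\<in>V. u 0 v)"
proof -
  have der: "((\<lambda>t. \<Sum>v\<in>V. u t v) has_real_derivative 0) (at t within {0..})" if "t \<ge> 0" for t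
  proof -
    have "((\<lambda>t. \<Sum>v\<in>V. u t v) has_real_derivative (\<Sum>v\<in>V. field (u t) v)) (at t within {0..})"
      by (rule DERIV_sum) (rule log_flowD[OF assms(1) _ that])
    then show ?thesis unfolding sum_field_V .
  qed
  have "((\<lambda>t. - (\<Sum>v\<in>V. u t v)) has_real_derivative 0) (at t within {0..})" if "t \<ge> 0" for t
    using DERIV_minus[OF der[OF that]] by simp
  then have "- (\<Sum>v\<in>V. u t v) \<le> - (\<Sum>v\<in>V. u 0 v)"
    by (rule nonincreasing_on_ray[where f' = "\<lambda>_. 0"]) (use assms in auto)
  moreover have "(\<Sum>v\<in>V. u t v) \<le> (\<Sum>v\<in>V. u 0 v)"
    by (rule nonincreasing_on_ray[where f' = "\<lambda>_. 0", OF der]) (use assms in auto)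
  ultimately show ?thesis by linarith
qed

lemma sq_distance_deriv:
  assumes "log_flow u" "log_flow w" "t \<ge> 0"
  shows "((\<lambda>t. \<Sum>v\<in>V. (u t v - w t v)\<^sup>2) has_real_derivative
     2 * (\<Sum>v\<in>V. (u t v - w t v) * (field (u t) v - field (w t) v))) (at t within {0..})"
  unfolding sum_distrib_left
  by (rule DERIV_sum) (auto intro!: derivative_eq_intros log_flowD assms)

lemma sq_distance_antimono:
  assumes "log_flow u" "log_flow w" "t \<ge> 0"
  shows "(\<Sum>v\<in>V. (u t v - w t v)\<^sup>2) \<le> (\<Sum>v\<in>V. (u 0 v - w 0 v)\<^sup>2)"
  by (rule nonincreasing_on_ray[OF sq_distance_deriv[OF assms(1,2)]])
    (use assms(3) field_monotone' in \<open>auto simp: mult_le_0_iff\<close>)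

lemma sq_le_sum: "v \<in> V \<Longrightarrow> (x v)\<^sup>2 \<le> (\<Sum>v\<in>V. (x v)\<^sup>2)" for x :: "'v \<Rightarrow> real"
  by (intro member_le_sum) auto

text \<open>Comparing a bounded solution with its own time translates shows that it is Cauchy.\<close>

lemma bounded_log_flow_converges:
  assumes u: "log_flow u" and R: "\<And>t v. t \<ge> 0 \<Longrightarrow> v \<in> V \<Longrightarrow> \<bar>u t v\<bar> \<le> R"
  shows "\<exists>w c B. c > 0 \<and> (\<forall>v\<in>V. field w v = 0) \<and> (\<forall>v\<in>V. \<bar>w v\<bar> \<le> R) \<and>
    (\<forall>t\<ge>0. \<forall>v\<in>V. \<bar>u t v - w v\<bar> \<le> B * exp (- c * t))"
proof -
  obtain c where "c > 0" and c: "\<And>u w. (\<forall>v\<in>V. \<bar>u v\<bar> \<le> R \<and> \<bar>w v\<bar> \<le> R) \<Longrightarrow> (\<Sum>v\<in>V. u v - w v) = 0 \<Longrightarrow>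
     (\<Sum>v\<in>V. (u v - w v) * (field u v - field w v)) \<le> - c * (\<Sum>v\<in>V. (u v - w v)\<^sup>2)"
    using field_contraction[of R] by blast
  \<comment> \<open>At time 0 the solution and any of its translates differ by at most
    \<open>2 * R\<close> in each coordinate, so \<open>B\<close> does not depend on
    \<open>h\<close>.\<close>
  define B where "B = sqrt (real (card V) * (2 * R)\<^sup>2)"
  have step: "\<bar>u (t + h) v - u t v\<bar> \<le> B * exp (- c * t)" if t: "t \<ge> 0" and h: "h \<ge> 0" and v: "v \<in> V" for t h v
  proof -
    note shift = log_flow_shift[OF u h]
    have "(\<Sum>v\<in>V. (u (t + h) v - u t v)\<^sup>2) \<le> (\<Sum>v\<in>V. (u (0 + h) v - u 0 v)\<^sup>2) * exp (- (2 * c) * t)"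
    proof (rule exponential_decay[OF sq_distance_deriv[OF shift u] _ t])
      fix s :: real assume s: "s \<ge> 0"
      \<comment> \<open>Conservation of the sum puts a solution and its translate in the scope of
        \<open>field_contraction\<close>. The squared distance decays at rate \<open>2 * c\<close>,
        the distance at rate \<open>c\<close>.\<close>
      have "(\<Sum>v\<in>V. u (s + h) v - u s v) = 0"
        unfolding sum_subtractf using log_flow_sum[OF u s] log_flow_sum[OF u add_nonneg_nonneg[OF s h]] by linarith
      moreover have "\<forall>v\<in>V. \<bar>u (s + h) v\<bar> \<le> R \<and> \<bar>u s v\<bar> \<le> R" using R s h by simp
      ultimately show "2 * (\<Sum>v\<in>V. (u (s + h) v - u s v) * (field (u (s + h)) v - field (u s) v))
        \<le> - (2 * c) * (\<Sum>v\<in>V. (u (s + h) v - u s v)\<^sup>2)"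
        using c[of "u (s + h)" "u s"] by simp
    qed
    also have "(\<Sum>v\<in>V. (u (0 + h) v - u 0 v)\<^sup>2) \<le> (\<Sum>v\<in>V. (2 * R)\<^sup>2)"
    proof (rule sum_mono)
      fix v assume v: "v \<in> V"
      have "\<bar>u (0 + h) v - u 0 v\<bar> \<le> 2 * R" using R[OF _ v, of "0 + h"] R[OF _ v, of 0] h by simp
      then have "\<bar>u (0 + h) v - u 0 v\<bar>\<^sup>2 \<le> (2 * R)\<^sup>2" by (intro power_mono) auto
      then show "(u (0 + h) v - u 0 v)\<^sup>2 \<le> (2 * R)\<^sup>2" by simp
    qed
    also have "(\<Sum>v\<in>V. (2 * R)\<^sup>2) = B\<^sup>2" by (simp add: B_def)
    also have "B\<^sup>2 * exp (- (2 * c) * t) = (B * exp (- c * t))\<^sup>2"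
      by (simp add: power_mult_distrib flip: exp_double)
    finally have "(u (t + h) v - u t v)\<^sup>2 \<le> (B * exp (- c * t))\<^sup>2"
      using sq_le_sum[OF v, of "\<lambda>v. u (t + h) v - u t v"] by simp
    then have "\<bar>u (t + h) v - u t v\<bar>\<^sup>2 \<le> (B * exp (- c * t))\<^sup>2" by simp
    then show ?thesis by (rule power2_le_imp_le) (simp add: B_def)
  qed
  have decay: "((\<lambda>t. B * exp (- c * t)) \<longlongrightarrow> 0) at_top"
    by (rule exp_decay_tendsto_0[OF \<open>c > 0\<close>])
  define w where "w v = lim (\<lambda>n. u (real n) v)" for v
  have lim: "(\<lambda>n. u (real n) v) \<longlonglongrightarrow> w v" if v: "v \<in> V" for v
  proof -
    have "Cauchy (\<lambda>n. u (real n) v)"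
      unfolding Cauchy_altdef
    proof (intro allI impI)
      fix e :: real assume "0 < e"
      then have "\<forall>\<^sub>F t in at_top. B * exp (- c * t) < e" using decay by (intro order_tendstoD)
      then obtain T where T: "\<And>t. t \<ge> T \<Longrightarrow> B * exp (- c * t) < e" by (auto simp: eventually_at_top_linorder)
      obtain N where N: "real N \<ge> T" using real_arch_simple by blast
      show "\<exists>M. \<forall>m\<ge>M. \<forall>n>m. dist (u (real m) v) (u (real n) v) < e"
      proof (intro exI allI impI)
        fix m n assume "N \<le> m" "m < n"
        then show "dist (u (real m) v) (u (real n) v) < e"
          using step[of "real m" "real n - real m" v] v T[of "real m"] N
          by (simp add: dist_real_def abs_minus_commute)
      qed
    qed
    then show ?thesis unfolding w_def by (simp add: Cauchy_convergent_iff convergent_LIMSEQ_iff)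
  qed
  have conv: "\<bar>u t v - w v\<bar> \<le> B * exp (- c * t)" if t: "t \<ge> 0" and v: "v \<in> V" for t v
  proof (rule tendsto_upperbound)
    show "(\<lambda>n. \<bar>u t v - u (real n) v\<bar>) \<longlonglongrightarrow> \<bar>u t v - w v\<bar>" by (intro tendsto_intros lim v)
    obtain N where N: "real N \<ge> t" using real_arch_simple by blast
    show "\<forall>\<^sub>F n in sequentially. \<bar>u t v - u (real n) v\<bar> \<le> B * exp (- c * t)"
    proof (rule eventually_sequentiallyI[of N])
      fix n assume "N \<le> n"
      then show "\<bar>u t v - u (real n) v\<bar> \<le> B * exp (- c * t)"
        using step[OF t, of "real n - t" v] v N by (simp add: abs_minus_commute)
    qed
  qed simp
  have bound: "\<bar>w v\<bar> \<le> R" if v: "v \<in> V" for v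
    by (rule tendsto_upperbound[OF tendsto_rabs[OF lim[OF v]]]) (use R v in auto)
  have ulim: "((\<lambda>t. u t v) \<longlongrightarrow> w v) at_top" if v: "v \<in> V" for v
    using conv v by (intro tendsto_of_exp_bound[OF \<open>c > 0\<close>, of _ _ B]) blast
  \<comment> \<open>The coordinate converges and its derivative converges to
    \<open>field w v\<close>, so this limit must be zero.\<close>
  have "field w v = 0" if v: "v \<in> V" for v
    by (rule limit_derivative_zero[OF log_flowD[OF u v] ulim[OF v] field_tendsto[OF ulim v]])
  with \<open>c > 0\<close> conv bound show ?thesis by blast
qed

text \<open>The region where \<open>\<Sum>v\<in>A. u v\<close> exceeds its average by at least \<open>- g * |A| * (|V| - |A|)\<close> for all
  \<open>A\<close> is invariant: since \<open>k * (|V| - k)\<close> is strictly concave in \<open>k\<close>, equality for \<open>A\<close> forces a gap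
  of \<open>2 * g\<close> between the values on \<open>A\<close> and those outside, and then the sum over \<open>A\<close> increases.\<close>

lemma log_flow_bounded:
  assumes slack: "\<And>A. A \<subset> V \<Longrightarrow> A \<noteq> {} \<Longrightarrow> 0 < slack A" and u: "log_flow u"
  shows "\<exists>R. \<forall>t\<ge>0. \<forall>v\<in>V. \<bar>u t v\<bar> \<le> R"
proof -
  obtain G where "G \<ge> 0" and G: "\<And>A u. A \<subset> V \<Longrightarrow> A \<noteq> {} \<Longrightarrow> separated G A u \<Longrightarrow> 0 < (\<Sum>v\<in>A. field u v)"
    using sum_field_pos_if_separated[OF slack] by blast
  define n where "n = real (card V)"
  define S where "S = (\<Sum>v\<in>V. u 0 v)"
  \<comment> \<open>Since \<open>k * (n - k) \<ge> 1\<close> for proper nonempty sets, this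
    \<open>g\<close> outweighs all initial sums and makes every \<open>\<phi> A 0\<close> positive;
    as \<open>g \<ge> G\<close>, the gap \<open>2 * g\<close> also reaches the separation
    threshold.\<close>
  define g where "g = G + \<bar>S\<bar> + (\<Sum>v\<in>V. \<bar>u 0 v\<bar>) + 1"
  have n: "n \<ge> 1" unfolding n_def using V_ne by (simp add: Suc_le_eq card_gt_0_iff)
  have g: "g \<ge> G" "g > 0" unfolding g_def using \<open>G \<ge> 0\<close> by (auto simp: sum_nonneg add_nonneg_pos)
  define \<phi> where "\<phi> A t = (\<Sum>v\<in>A. u t v) - real (card A) * S / n + g * real (card A) * (n - real (card A))" for A t
  have \<phi>_empty: "\<phi> {} t = 0" for t by (simp add: \<phi>_def)
  have \<phi>_V: "\<phi> V t = 0" if "t \<ge> 0" for t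
    using log_flow_sum[OF u that] n unfolding \<phi>_def S_def n_def by simp
  define J where "J = {A. A \<subset> V \<and> A \<noteq> {}}"
  have nonneg: "0 \<le> \<phi> A t" if "A \<in> J" "t \<ge> 0" for A t
  proof (rule barrier_invariance[of J \<phi> "\<lambda>A t. \<Sum>v\<in>A. field (u t) v"])
    show "finite J" unfolding J_def by (rule finite_subset[of _ "Pow V"]) auto
  next
    fix A and t :: real assume A: "A \<in> J" and t: "0 \<le> t"
    have "((\<lambda>s. \<Sum>v\<in>A. u s v) has_real_derivative (\<Sum>v\<in>A. field (u t) v)) (at t within {0..})"
      by (rule DERIV_sum) (use A in \<open>auto simp: J_def intro!: log_flowD[OF u _ t]\<close>)
    then show "(\<phi> A has_real_derivative (\<Sum>v\<in>A. field (u t) v)) (at t within {0..})"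
      unfolding \<phi>_def
      by (rule DERIV_cong[OF DERIV_add[OF DERIV_diff[OF _ DERIV_const] DERIV_const]]) simp
  next
    fix A assume "A \<in> J"
    then have A: "A \<subset> V" "A \<noteq> {}" "finite A" by (auto simp: J_def intro: finite_subset)
    define k where "k = real (card A)"
    have k: "1 \<le> k" "k + 1 \<le> n"
      using A psubset_card_mono[OF finite_V A(1)] by (auto simp: k_def n_def Suc_le_eq card_gt_0_iff)
    have "- (\<Sum>v\<in>V. \<bar>u 0 v\<bar>) \<le> (\<Sum>v\<in>A. u 0 v)"
    proof -
      have "\<bar>\<Sum>v\<in>A. u 0 v\<bar> \<le> (\<Sum>v\<in>A. \<bar>u 0 v\<bar>)" by (rule sum_abs)
      also have "\<dots> \<le> (\<Sum>v\<in>V. \<bar>u 0 v\<bar>)" using A by (intro sum_mono2) auto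
      finally show ?thesis by linarith
    qed
    moreover have "k * S / n \<le> \<bar>S\<bar>"
    proof -
      have "k * S \<le> k * \<bar>S\<bar>" using k by (intro mult_left_mono) auto
      also have "\<dots> \<le> n * \<bar>S\<bar>" using k by (intro mult_right_mono) auto
      finally have "k * S \<le> n * \<bar>S\<bar>" .
      then show ?thesis using n by (simp add: field_simps)
    qed
    moreover have "g * 1 * 1 \<le> g * k * (n - k)" using k g by (intro mult_mono) auto
    ultimately show "0 < \<phi> A 0" using \<open>G \<ge> 0\<close> g_def unfolding \<phi>_def k_def[symmetric] by linarith
  next
    fix A and t :: real
    assume "A \<in> J" and t: "0 \<le> t" and nn: "\<And>B. B \<in> J \<Longrightarrow> 0 \<le> \<phi> B t" and zero: "\<phi> A t = 0"
    then have A: "A \<subset> V" "A \<noteq> {}" "finite A" by (auto simp: J_def intro: finite_subset)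
    \<comment> \<open>The neighbouring sets used below may be empty or all of \<open>V\<close>,
      where \<open>\<phi>\<close> is identically zero.\<close>
    have all: "0 \<le> \<phi> B t" if "B \<subseteq> V" for B
      using nn[of B] \<phi>_empty \<phi>_V[OF t] that by (cases "B = {}"; cases "B = V") (auto simp: J_def)
    have "separated G A (u t)"
      unfolding separated_def
    proof (intro ballI)
      fix v w assume v: "v \<in> A" and w: "w \<in> V - A"
      define k where "k = real (card A)"
      have sums: "(\<Sum>v\<in>insert w A. u t v) = (\<Sum>v\<in>A. u t v) + u t w" "(\<Sum>v\<in>A - {v}. u t v) = (\<Sum>v\<in>A. u t v) - u t v"
        using A v w by (simp_all add: sum_diff1)
      have "card A \<ge> 1" using A by (simp add: Suc_le_eq card_gt_0_iff)
      then have cards: "real (card (insert w A)) = k + 1" "real (card (A - {v})) = k - 1"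
        using A v w by (simp_all add: k_def of_nat_diff)
      \<comment> \<open>Adding \<open>w\<close> and removing \<open>v\<close> changes the linear
        terms by \<open>u t w - u t v\<close> in total, while the second difference of
        \<open>k * (n - k)\<close> is -2. With \<open>\<phi> A t = 0\<close> this yields the
        gap.\<close>
      have "0 \<le> \<phi> (insert w A) t + \<phi> (A - {v}) t"
        using A w by (intro add_nonneg_nonneg all) blast+
      also have "\<dots> = 2 * \<phi> A t + (u t w - u t v) - 2 * g"
        unfolding \<phi>_def sums cards k_def[symmetric] by (simp add: algebra_simps add_divide_distrib diff_divide_distrib)
      finally show "G \<le> u t w - u t v" using zero g by linarith
    qed
    then show "0 < (\<Sum>v\<in>A. field (u t) v)" using G A by blast
  qed (use that in auto)
  \<comment> \<open>Singletons bound each coordinate from below; the case \<open>V = {v}\<close> is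
    covered by \<open>\<phi> V t = 0\<close>. The conserved sum then turns the lower bounds into
    upper ones.\<close>
  have lower: "S / n - g * n \<le> u t v" if "t \<ge> 0" "v \<in> V" for t v
  proof -
    have "0 \<le> \<phi> {v} t"
      using nonneg[of "{v}" t] \<phi>_V[OF that(1)] that by (cases "V = {v}") (auto simp: J_def)
    then have "S / n - g * (n - 1) \<le> u t v" by (simp add: \<phi>_def)
    moreover have "g * (n - 1) \<le> g * n" using g by simp
    ultimately show ?thesis by linarith
  qed
  have upper: "u t v \<le> S - (n - 1) * (S / n - g * n)" if "t \<ge> 0" "v \<in> V" for t v
  proof -
    have "(n - 1) * (S / n - g * n) = (\<Sum>w\<in>V - {v}. S / n - g * n)"
      using that V_ne by (simp add: n_def of_nat_diff Suc_le_eq card_gt_0_iff)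
    also have "\<dots> \<le> (\<Sum>w\<in>V - {v}. u t w)" using lower that by (intro sum_mono) auto
    also have "\<dots> = S - u t v" using that log_flow_sum[OF u that(1)] by (simp add: sum_diff1 S_def)
    finally show ?thesis by simp
  qed
  have "\<bar>u t v\<bar> \<le> \<bar>S / n - g * n\<bar> + \<bar>S - (n - 1) * (S / n - g * n)\<bar>" if "t \<ge> 0" "v \<in> V" for t v
    using lower[OF that] upper[OF that] by linarith
  then show ?thesis by blast
qed

lemma zero_field_bounded:
  assumes w: "\<And>v. v \<in> V \<Longrightarrow> field w v = 0" and u: "log_flow u"
  shows "\<exists>R. \<forall>t\<ge>0. \<forall>v\<in>V. \<bar>u t v\<bar> \<le> R"
proof -
  have const: "log_flow (\<lambda>t. w)" unfolding log_flow_def using w by simp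
  define D where "D = (\<Sum>v\<in>V. (u 0 v - w v)\<^sup>2)"
  have "\<bar>u t v\<bar> \<le> sqrt D + (\<Sum>v\<in>V. \<bar>w v\<bar>)" if "t \<ge> 0" "v \<in> V" for t v
  proof -
    have "(u t v - w v)\<^sup>2 \<le> D"
      using sq_distance_antimono[OF u const that(1)] sq_le_sum[OF that(2), of "\<lambda>v. u t v - w v"]
      unfolding D_def by linarith
    then have "\<bar>u t v - w v\<bar> \<le> sqrt D" by (intro real_le_rsqrt) simp
    moreover have "\<bar>w v\<bar> \<le> (\<Sum>v\<in>V. \<bar>w v\<bar>)" using that by (intro member_le_sum) auto
    ultimately show ?thesis by linarith
  qed
  then show ?thesis by blast
qed

section \<open>Metrics of constant curvature and the equivalences\<close>

definition constant_curvature :: "('v \<Rightarrow> real) \<Rightarrow> bool" where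
  "constant_curvature \<rho> \<longleftrightarrow> (\<forall>v\<in>V. \<rho> v > 0) \<and> (\<forall>v\<in>V. curv F cv se \<Theta> \<rho> v = K_av F cv se)"

lemma constant_curvature_exp:
  assumes "\<And>v. v \<in> V \<Longrightarrow> field w v = 0"
  shows "constant_curvature (\<lambda>v. exp (w v))"
  using assms unfolding constant_curvature_def field_def by auto

lemma constant_curvature_ln:
  assumes "constant_curvature \<rho>" "v \<in> V"
  shows "field (\<lambda>v. ln (\<rho> v)) v = 0"
  using assms field_ln[of \<rho> v] by (simp add: constant_curvature_def)

text \<open>Necessity evaluates \<open>sum_field_less_slack\<close> at a zero of the field. For
  sufficiency the flow is started anywhere: it stays bounded, hence converges, and its limit is a
  zero of the field.\<close>

lemma constant_curvature_iff_slack: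
  "(\<exists>\<rho>. constant_curvature \<rho>) \<longleftrightarrow> (\<forall>A. A \<subset> V \<and> A \<noteq> {} \<longrightarrow> 0 < slack A)"
proof
  assume "\<exists>\<rho>. constant_curvature \<rho>"
  then obtain \<rho> where \<rho>: "constant_curvature \<rho>" ..
  show "\<forall>A. A \<subset> V \<and> A \<noteq> {} \<longrightarrow> 0 < slack A"
  proof (intro allI impI)
    fix A assume A: "A \<subset> V \<and> A \<noteq> {}"
    have "(\<Sum>v\<in>A. field (\<lambda>v. ln (\<rho> v)) v) = 0"
      using A constant_curvature_ln[OF \<rho>] by (intro sum.neutral) auto
    then show "0 < slack A" using sum_field_less_slack[of A "\<lambda>v. ln (\<rho> v)"] A by simp
  qed
next
  assume slack: "\<forall>A. A \<subset> V \<and> A \<noteq> {} \<longrightarrow> 0 < slack A"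
  obtain u where u: "log_flow u" using log_flow_exists by blast
  obtain R where R: "\<And>t v. t \<ge> 0 \<Longrightarrow> v \<in> V \<Longrightarrow> \<bar>u t v\<bar> \<le> R"
    using log_flow_bounded[OF _ u] slack by blast
  obtain w where "\<forall>v\<in>V. field w v = 0"
    using bounded_log_flow_converges[OF u R] by blast
  then show "\<exists>\<rho>. constant_curvature \<rho>" using constant_curvature_exp by blast
qed

lemma flow_exists:
  assumes "\<And>v. v \<in> V \<Longrightarrow> 0 < r0 v"
  shows "\<exists>r. flow_solution F cv se \<Theta> r0 r"
proof -
  obtain u where "log_flow u" "\<forall>v\<in>V. u 0 v = ln (r0 v)"
    using log_flow_exists[of "\<lambda>v. ln (r0 v)"] by blast
  then have "flow_solution F cv se \<Theta> r0 (\<lambda>t v. exp (u t v))"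
    using assms by (intro log_flow_flow_solution) auto
  then show ?thesis by blast
qed

text \<open>The limits are a priori only nonnegative, and passing to logarithms needs them positive.
  The product of all radii is a positive constant along the flow, so no coordinate can tend to
  zero.\<close>

lemma flow_limit_constant_curvature:
  assumes r: "flow_solution F cv se \<Theta> r0 r"
    and L: "\<And>v. v \<in> V \<Longrightarrow> ((\<lambda>t. r t v) \<longlongrightarrow> L v) at_top"
  shows "constant_curvature L"
proof -
  define u where "u t v = ln (r t v)" for t v
  have u: "log_flow u" using flow_solution_log_flow[OF r] by (simp add: u_def[abs_def])
  have pos: "0 < r t v" if "t \<ge> 0" "v \<in> V" for t v
    using r that by (simp add: flow_solution_def)
  have "(\<Prod>v\<in>V. r t v) = exp (\<Sum>v\<in>V. u 0 v)" if "t \<ge> 0" for t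
  proof -
    have "(\<Prod>v\<in>V. r t v) = (\<Prod>v\<in>V. exp (u t v))" using pos that by (intro prod.cong) (auto simp: u_def)
    also have "\<dots> = exp (\<Sum>v\<in>V. u t v)" by (simp add: exp_sum)
    finally show ?thesis using log_flow_sum[OF u that] by simp
  qed
  then have "((\<lambda>t. \<Prod>v\<in>V. r t v) \<longlongrightarrow> exp (\<Sum>v\<in>V. u 0 v)) at_top"
    by (intro tendsto_eventually) (auto intro!: eventually_at_top_linorderI[of 0])
  moreover have "((\<lambda>t. \<Prod>v\<in>V. r t v) \<longlongrightarrow> (\<Prod>v\<in>V. L v)) at_top"
    by (intro tendsto_prod L)
  ultimately have "(\<Prod>v\<in>V. L v) = exp (\<Sum>v\<in>V. u 0 v)"
    by (intro tendsto_unique[OF trivial_limit_at_top_linorder])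
  then have ne: "L v \<noteq> 0" if "v \<in> V" for v
    using that by (metis exp_not_eq_zero finite_V prod_zero_iff)
  have L_pos: "0 < L v" if "v \<in> V" for v
  proof -
    have "0 \<le> L v"
      by (rule tendsto_lowerbound[OF L[OF that]])
        (use pos that in \<open>auto intro!: eventually_at_top_linorderI[of 0] less_imp_le\<close>)
    with ne[OF that] show ?thesis by simp
  qed
  have ulim: "((\<lambda>t. u t v) \<longlongrightarrow> ln (L v)) at_top" if "v \<in> V" for v
    unfolding u_def by (intro tendsto_ln L that) (use L_pos[OF that] in simp)
  have "field (\<lambda>v. ln (L v)) v = 0" if v: "v \<in> V" for v
    by (rule limit_derivative_zero[OF log_flowD[OF u v] ulim[OF v] field_tendsto[OF ulim v]])
  then show ?thesis
    using L_pos field_ln[OF L_pos] by (simp add: constant_curvature_def)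
qed

lemma flow_exponential_convergence:
  assumes r: "flow_solution F cv se \<Theta> r0 r" and \<rho>: "constant_curvature \<rho>"
  shows "\<exists>r' C \<alpha>. constant_curvature r' \<and> \<alpha> > 0 \<and> (\<forall>t\<ge>0. \<forall>v\<in>V. \<bar>r t v - r' v\<bar> \<le> C * exp (- \<alpha> * t))"
proof -
  define u where "u t v = ln (r t v)" for t v
  have u: "log_flow u" using flow_solution_log_flow[OF r] by (simp add: u_def[abs_def])
  obtain R where R: "\<And>t v. t \<ge> 0 \<Longrightarrow> v \<in> V \<Longrightarrow> \<bar>u t v\<bar> \<le> R"
    using zero_field_bounded[OF constant_curvature_ln[OF \<rho>] u] by blast
  obtain w c B where "c > 0" and w0: "\<forall>v\<in>V. field w v = 0" and wR: "\<forall>v\<in>V. \<bar>w v\<bar> \<le> R"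
      and conv: "\<forall>t\<ge>0. \<forall>v\<in>V. \<bar>u t v - w v\<bar> \<le> B * exp (- c * t)"
    using bounded_log_flow_converges[OF u R] by blast
  \<comment> \<open>Both \<open>u t v\<close> and \<open>w v\<close> are at most \<open>R\<close>,
    where \<open>exp\<close> is Lipschitz with constant \<open>exp R\<close>; the rate therefore
    passes from logarithmic radii to radii.\<close>
  have "\<bar>r t v - exp (w v)\<bar> \<le> (exp R * B) * exp (- c * t)" if "t \<ge> 0" "v \<in> V" for t v
  proof -
    have "r t v = exp (u t v)" using r that by (simp add: flow_solution_def u_def)
    then have "\<bar>r t v - exp (w v)\<bar> \<le> exp R * \<bar>u t v - w v\<bar>"
      using exp_difference_le[of "u t v" R "w v"] R[OF that] wR that(2) by (simp add: abs_le_iff)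
    also have "\<dots> \<le> exp R * (B * exp (- c * t))" using conv that by (intro mult_left_mono) auto
    finally show ?thesis by (simp add: mult.assoc)
  qed
  moreover have "constant_curvature (\<lambda>v. exp (w v))" using w0 by (intro constant_curvature_exp) blast
  ultimately show ?thesis using \<open>c > 0\<close> by blast
qed

end

theorem theorem0p8:
  fixes F :: "'f set" and cv :: "'f \<times> nat \<Rightarrow> 'v" and se :: "'f \<times> nat \<Rightarrow> 'e"
    and \<Theta> :: "'e \<Rightarrow> real" and r0 :: "'v \<Rightarrow> real"
  assumes tri: "triangulation F cv se"
    and Theta_range: "\<forall>e \<in> edges F se. 0 \<le> \<Theta> e \<and> \<Theta> e < pi"
    and C1: "cond_C1 F se \<Theta>"
    and r0_pos: "\<forall>v \<in> verts F cv. r0 v > 0"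
  shows
    "(\<exists>r. flow_solution F cv se \<Theta> r0 r)
     \<and> ((\<exists>\<rho>. (\<forall>v \<in> verts F cv. \<rho> v > 0) \<and>
            (\<forall>v \<in> verts F cv. curv F cv se \<Theta> \<rho> v = K_av F cv se))
        \<longleftrightarrow>
        (\<forall>A. A \<subset> verts F cv \<and> A \<noteq> {} \<longrightarrow>
            2 * pi * of_int (euler_char F cv se) * real (card A) / real (card (verts F cv))
            > - (\<Sum>(f, i) \<in> Lk F cv A. pi - \<Theta> (se (f, i)))
              + 2 * pi * of_int (chi_G_int F cv se A) + pi * of_int (chi_G_bd F cv se A)))
     \<and> (\<forall>r. flow_solution F cv se \<Theta> r0 r \<longrightarrow>
          (((\<exists>L. \<forall>v \<in> verts F cv. ((\<lambda>t. r t v) \<longlongrightarrow> L v) at_top)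
            \<longleftrightarrow>
            (\<exists>\<rho>. (\<forall>v \<in> verts F cv. \<rho> v > 0) \<and>
                 (\<forall>v \<in> verts F cv. curv F cv se \<Theta> \<rho> v = K_av F cv se)))
           \<and>
           ((\<exists>\<rho>. (\<forall>v \<in> verts F cv. \<rho> v > 0) \<and>
                 (\<forall>v \<in> verts F cv. curv F cv se \<Theta> \<rho> v = K_av F cv se))
            \<longrightarrow>
            (\<exists>r' C \<alpha>. (\<forall>v \<in> verts F cv. r' v > 0) \<and>
                 (\<forall>v \<in> verts F cv. curv F cv se \<Theta> r' v = K_av F cv se) \<and>
                 \<alpha> > 0 \<and>
                 (\<forall>t \<ge> 0. \<forall>v \<in> verts F cv. \<bar>r t v - r' v\<bar> \<le> C * exp (- \<alpha> * t))))))"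
proof -
  interpret circle_pattern F cv se \<Theta>
    using tri Theta_range C1 by unfold_locales auto
  have slack: "(\<forall>A. A \<subset> V \<and> A \<noteq> {} \<longrightarrow> 0 < slack A) \<longleftrightarrow>
      (\<forall>A. A \<subset> verts F cv \<and> A \<noteq> {} \<longrightarrow>
            2 * pi * of_int (euler_char F cv se) * real (card A) / real (card (verts F cv))
            > - (\<Sum>(f, i) \<in> Lk F cv A. pi - \<Theta> (se (f, i)))
              + 2 * pi * of_int (chi_G_int F cv se A) + pi * of_int (chi_G_bd F cv se A))"
    using slack_pos_iff by (meson psubset_imp_subset)
  \<comment> \<open>After rewriting, (E3) reads as the existence of a metric of constant curvature,
    so its equivalence with (E2) becomes trivial and only the statements about solutions
    remain.\<close>
  show ?thesis
    unfolding slack[symmetric] constant_curvature_iff_slack[symmetric, unfolded constant_curvature_def]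
  proof (intro conjI allI impI)
    show "\<exists>r. flow_solution F cv se \<Theta> r0 r" using r0_pos by (intro flow_exists) blast
  next
    fix r assume r: "flow_solution F cv se \<Theta> r0 r"
    let ?const = "\<lambda>\<rho>. (\<forall>v\<in>V. \<rho> v > 0) \<and> (\<forall>v\<in>V. curv F cv se \<Theta> \<rho> v = K_av F cv se)"
    have conv: "\<exists>r' C \<alpha>. constant_curvature r' \<and> \<alpha> > 0 \<and> (\<forall>t\<ge>0. \<forall>v\<in>V. \<bar>r t v - r' v\<bar> \<le> C * exp (- \<alpha> * t))"
      if "\<exists>\<rho>. ?const \<rho>"
      using flow_exponential_convergence[OF r] that unfolding constant_curvature_def by blast
    show "(\<exists>L. \<forall>v\<in>V. ((\<lambda>t. r t v) \<longlongrightarrow> L v) at_top) \<longleftrightarrow> (\<exists>\<rho>. ?const \<rho>)"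
    proof
      assume "\<exists>L. \<forall>v\<in>V. ((\<lambda>t. r t v) \<longlongrightarrow> L v) at_top"
      then show "\<exists>\<rho>. ?const \<rho>"
        using flow_limit_constant_curvature[OF r] unfolding constant_curvature_def by blast
    next
      assume "\<exists>\<rho>. ?const \<rho>"
      from conv[OF this] obtain L C \<alpha> where "\<alpha> > 0" and L: "\<forall>t\<ge>0. \<forall>v\<in>V. \<bar>r t v - L v\<bar> \<le> C * exp (- \<alpha> * t)"
        by blast
      then have "((\<lambda>t. r t v) \<longlongrightarrow> L v) at_top" if "v \<in> V" for v
        using that by (intro tendsto_of_exp_bound[OF \<open>\<alpha> > 0\<close>, of _ _ C]) blast
      then show "\<exists>L. \<forall>v\<in>V. ((\<lambda>t. r t v) \<longlongrightarrow> L v) at_top" by blast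
    qed
    assume "\<exists>\<rho>. ?const \<rho>"
    from conv[OF this] show "\<exists>r' C \<alpha>. (\<forall>v\<in>V. r' v > 0) \<and> (\<forall>v\<in>V. curv F cv se \<Theta> r' v = K_av F cv se) \<and>
        \<alpha> > 0 \<and> (\<forall>t\<ge>0. \<forall>v\<in>V. \<bar>r t v - r' v\<bar> \<le> C * exp (- \<alpha> * t))"
      unfolding constant_curvature_def by blast
  qed simp
qed

end
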